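(* Let $\alpha\in(1,2)$ and let $X=(X_t)_{t\ge 0}$ be a stable Lévy process of index $\alpha$ (with no negative jumps, started at $0$) satisfying $$\mathsf{E}e^{i\lambda X_t}=\exp\Big(t\int_0^\infty (e^{i\lambda x}-1-i\lambda x)\frac{dx}{\Gamma(-\alpha)x^{1+\alpha}}\Big)=e^{t(-i\lambda)^\alpha}\quad(\lambda\in\mathbb{R},\ t\ge0),$$ $$\mathsf{E}e^{-\lambda X_t}=e^{t\lambda^\alpha}\quad(\lambda\ge0,\ t\ge0).$$ Let $S_1=\sup_{0\le t\le1}X_t$. Then the density function $f$ of $S_1$ (continuous version on $(0,\infty)$) is given by $$f(x)=\frac1\pi\int_0^\infty\Big[e^{t^\alpha\cos(\alpha\pi/2)}\cos\big(t^\alpha\sin(\alpha\pi/2)+tx\big)+\frac{1}{\Gamma(1/\alpha)}\int_0^{t^\alpha}\frac{e^{y\cos(\alpha\pi/2)}}{(t^\alpha-y)^{1-1/\alpha}}\sin\big(y\sin(\alpha\pi/2)+tx\big)\,dy\Big]dt$$ for all $x>0$, where the outer integral is understood as the improper integral $\lim_{T\to\infty}\int_0^T$.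
   Context: A Lévy process has càdlàg paths, stationary independent increments and starts at $0$. $\Gamma$ is the Euler gamma function (extended to $\mathbb{R}\setminus\{0,-1,-2,\ldots\}$, so that $\Gamma(-\alpha)>0$ for $\alpha\in(1,2)$), and $(-i\lambda)^\alpha$ is defined using the principal branch. The law of $S_1$ is absolutely continuous on $(0,\infty)$ with a density that has a continuous version on $(0,\infty)$; $f$ denotes this version. *)

theory Defs
  imports "HOL-Probability.Probability"
begin

text \<open>Time is indexed by the reals; only times \<open>t \<ge> 0\<close> are ever constrained.\<close>

definition cadlag :: "(real \<Rightarrow> real) \<Rightarrow> bool" where
  "cadlag p \<longleftrightarrow>
     (\<forall>t\<ge>0. (p \<longlongrightarrow> p t) (at_right t)) \<and>
     (\<forall>t>0. \<exists>l. (p \<longlongrightarrow> l) (at_left t))"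

definition stationary_increments :: "'a measure \<Rightarrow> (real \<Rightarrow> 'a \<Rightarrow> real) \<Rightarrow> bool" where
  "stationary_increments M X \<longleftrightarrow>
     (\<forall>s t h. 0 \<le> s \<longrightarrow> 0 \<le> t \<longrightarrow> 0 \<le> h \<longrightarrow>
        distr M borel (\<lambda>\<omega>. X (s + h) \<omega> - X s \<omega>) = distr M borel (\<lambda>\<omega>. X (t + h) \<omega> - X t \<omega>))"

definition independent_increments :: "'a measure \<Rightarrow> (real \<Rightarrow> 'a \<Rightarrow> real) \<Rightarrow> bool" where
  "independent_increments M X \<longleftrightarrow>
     (\<forall>(n::nat) t. 0 \<le> t 0 \<longrightarrow> (\<forall>i<n. t i \<le> t (Suc i)) \<longrightarrow>
        prob_space.indep_vars M (\<lambda>_. borel) (\<lambda>i \<omega>. X (t (Suc i)) \<omega> - X (t i) \<omega>) {..<n})"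

definition levy_process :: "'a measure \<Rightarrow> (real \<Rightarrow> 'a \<Rightarrow> real) \<Rightarrow> bool" where
  "levy_process M X \<longleftrightarrow>
     prob_space M \<and>
     (\<forall>t\<ge>0. X t \<in> borel_measurable M) \<and>
     (\<forall>\<omega>\<in>space M. cadlag (\<lambda>t. X t \<omega>)) \<and>
     (AE \<omega> in M. X 0 \<omega> = 0) \<and>
     stationary_increments M X \<and>
     independent_increments M X"

text \<open>Equality in law of the processes \<open>(X (c * t))\<close> and \<open>(c powr (1/\<alpha>) * X t)\<close>, \<open>t \<ge> 0\<close>, is
  expressed through their finite-dimensional distributions.\<close>

definition stable_levy_process :: "real \<Rightarrow> 'a measure \<Rightarrow> (real \<Rightarrow> 'a \<Rightarrow> real) \<Rightarrow> bool" where
  "stable_levy_process \<alpha> M X \<longleftrightarrow>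
     levy_process M X \<and>
     (\<forall>c>0. \<forall>I. finite I \<longrightarrow> I \<subseteq> {0..} \<longrightarrow>
        distr M (Pi\<^sub>M I (\<lambda>_. borel)) (\<lambda>\<omega>. \<lambda>t\<in>I. X (c * t) \<omega>) =
        distr M (Pi\<^sub>M I (\<lambda>_. borel)) (\<lambda>\<omega>. \<lambda>t\<in>I. c powr (1 / \<alpha>) * X t \<omega>))"

definition no_negative_jumps :: "'a measure \<Rightarrow> (real \<Rightarrow> 'a \<Rightarrow> real) \<Rightarrow> bool" where
  "no_negative_jumps M X \<longleftrightarrow>
     (AE \<omega> in M. \<forall>t>0. \<forall>l. ((\<lambda>s. X s \<omega>) \<longlongrightarrow> l) (at_left t) \<longrightarrow> l \<le> X t \<omega>)"

definition running_sup :: "(real \<Rightarrow> 'a \<Rightarrow> real) \<Rightarrow> real \<Rightarrow> 'a \<Rightarrow> real" where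
  "running_sup X t \<omega> = (SUP s\<in>{0..t}. X s \<omega>)"

text \<open>These conditions determine \<open>f\<close> uniquely on the open half-line; its values on the rest of
  the line are irrelevant.\<close>

definition continuous_density_on_pos ::
    "'a measure \<Rightarrow> ('a \<Rightarrow> real) \<Rightarrow> (real \<Rightarrow> real) \<Rightarrow> bool" where
  "continuous_density_on_pos M Y f \<longleftrightarrow>
     Y \<in> borel_measurable M \<and>
     continuous_on {0<..} f \<and> (\<forall>x>0. 0 \<le> f x) \<and>
     (\<forall>A\<in>sets borel. A \<subseteq> {0<..} \<longrightarrow>
        emeasure (distr M borel Y) A = (\<integral>\<^sup>+x\<in>A. ennreal (f x) \<partial>lborel))"

definition inner_integrand :: "real \<Rightarrow> real \<Rightarrow> real \<Rightarrow> real \<Rightarrow> real" where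
  "inner_integrand \<alpha> x t y =
     exp (y * cos (\<alpha> * pi / 2)) / (t powr \<alpha> - y) powr (1 - 1 / \<alpha>) *
     sin (y * sin (\<alpha> * pi / 2) + t * x)"

definition outer_integrand :: "real \<Rightarrow> real \<Rightarrow> real \<Rightarrow> real" where
  "outer_integrand \<alpha> x t =
     exp (t powr \<alpha> * cos (\<alpha> * pi / 2)) * cos (t powr \<alpha> * sin (\<alpha> * pi / 2) + t * x) +
     1 / Gamma (1 / \<alpha>) * (LBINT y:{0..t powr \<alpha>}. inner_integrand \<alpha> x t y)"

end

theory Submission
  imports Defs "HOL-Real_Asymp.Real_Asymp"
begin

text \<open>Write \<open>a = 1 / \<alpha>\<close> and \<open>S\<close> for the supremum over \<open>[0, 1]\<close>.  The formula is the Fourier inversion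
  \<open>f x = 1 / \<pi> * \<integral> Re (exp (\<i> t x) * E exp (- \<i> t S)) dt\<close>, so two things are needed: the
  characteristic function of \<open>S\<close>, and a reason why the inversion integral converges to \<open>f x\<close>.

  The characteristic function comes from a random walk.  Let \<open>M_k\<close> be the maximum of the first \<open>k\<close>
  partial sums of the increments over unit intervals.  Peeling off the first increment \<open>\<xi>\<close> shows
  that \<open>M_(k+1)\<close> has the law of \<open>max 0 (\<xi> + M_k)\<close> with independent \<open>\<xi>\<close> and \<open>M_k\<close>.  With
  \<open>r = \<xi> + M_k\<close> and \<open>r^-\<close> its negative part,
  \<open>exp (- z * max 0 r) = exp (- z r) - (exp (z r^-) - 1)\<close> and
  \<open>exp (z r^-) - 1 = z r^- + O(z^2)\<close> in mean, because \<open>r^- \<le> \<xi>^-\<close> and \<open>\<xi>^-\<close> has exponential moments.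
  The increments being centred, \<open>E r^-\<close> is the increment \<open>E M_(k+1) - E M_k\<close>.  This gives an
  approximate linear recursion for \<open>E exp (- z M_k)\<close> (\<open>lindley_transform_step\<close>).  By stability the
  maximum over the grid \<open>j / n\<close> is \<open>M_n / n^a\<close> in law; with \<open>z = \<zeta> / n^a\<close> the accumulated error is of
  order \<open>n * n^(-2 a)\<close>, which vanishes since \<open>\<alpha> < 2\<close>, and \<open>E M_k\<close> grows like \<open>E S * k^a\<close>.  Letting
  \<open>n\<close> tend to infinity yields, with \<open>\<Psi> = \<zeta>^\<alpha>\<close>,
  \<open>E exp (- \<zeta> S) = exp \<Psi> - \<zeta> * a * E S * \<integral>_0^1 s^(a - 1) exp ((1 - s) \<Psi>) ds\<close>
  (\<open>transform_S_mean\<close>).  For real \<open>\<zeta>\<close> tending to infinity the left side stays bounded, which forces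
  \<open>a * E S = 1 / \<Gamma>(a)\<close> (\<open>mean_S\<close>); for \<open>\<zeta> = \<i> t\<close> the identity is the characteristic function, and
  the substitution \<open>y = t^\<alpha> (1 - s)\<close> turns it into the integrand of the statement
  (\<open>outer_integrand_eq_cos\<close>).

  The characteristic function is not absolutely integrable: it decays like \<open>t^(1 - \<alpha>)\<close>.  It equals a
  multiple of \<open>t^(1 - \<alpha>)\<close> up to \<open>O(t^(- \<alpha>))\<close> (\<open>sup_charfun_asymptotics\<close>), so one integration by
  parts against \<open>exp (\<i> t x)\<close>, \<open>x \<noteq> 0\<close>, shows that the improper integral converges
  (\<open>oscillatory_integral_converges\<close>).  Its value is then also its Abel limit, the limit of the
  integrals damped by \<open>exp (- \<epsilon> t)\<close>.  Those are Poisson smoothings of the law of \<open>S\<close>, and they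
  converge to \<open>\<pi> * f x\<close> as soon as \<open>f\<close> is continuous at \<open>x\<close> (\<open>poisson_kernel_limit\<close>).\<close>

section \<open>Maxima of a centred random walk\<close>

text \<open>The law of the maximum of the first \<open>k\<close> partial sums (including the empty one) of independent
  steps with law \<open>\<nu>\<close>, generated by Lindley's recursion.\<close>

primrec lindley :: "real measure \<Rightarrow> nat \<Rightarrow> real measure" where
  "lindley \<nu> 0 = return borel 0"
| "lindley \<nu> (Suc k) = distr (\<nu> \<Otimes>\<^sub>M lindley \<nu> k) borel (\<lambda>(y, w). max 0 (y + w))"

text \<open>The moment \<open>E exp (- 2 y)\<close> dominates everything the negative part of a step contributes to
  transforms with argument in the closed right half of the unit disc.\<close>

locale centred_step =
  fixes \<nu> :: "real measure"
  assumes prob_step: "prob_space \<nu>"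
    and sets_step [measurable_cong, simp]: "sets \<nu> = sets borel"
    and integrable_step: "integrable \<nu> (\<lambda>y. y)"
    and mean_step: "(\<integral>y. y \<partial>\<nu>) = 0"
    and exp_moment_step: "integrable \<nu> (\<lambda>y. exp (- 2 * y))"
begin

sublocale \<nu>: prob_space \<nu> by (rule prob_step)

lemma space_step [simp]: "space \<nu> = UNIV"
  using sets_eq_imp_space_eq[OF sets_step] by simp

lemma sets_lindley [measurable_cong, simp]: "sets (lindley \<nu> k) = sets borel"
  by (cases k) auto

lemma space_lindley [simp]: "space (lindley \<nu> k) = UNIV"
  using sets_eq_imp_space_eq[OF sets_lindley] by simp

lemma max_plus_measurable [measurable]:
  "(\<lambda>(y, w). max 0 (y + w) :: real) \<in> borel_measurable (\<nu> \<Otimes>\<^sub>M lindley \<nu> k)"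
  by (simp add: split_beta) measurable

lemma prob_lindley: "prob_space (lindley \<nu> k)"
proof (induction k)
  case 0
  show ?case by (auto intro: prob_space_return)
next
  case (Suc k)
  interpret W: prob_space "lindley \<nu> k" by (rule Suc)
  interpret P: pair_prob_space \<nu> "lindley \<nu> k" ..
  show ?case by (auto intro!: P.prob_space_distr)
qed

lemma AE_lindley_nonneg: "AE w in lindley \<nu> k. 0 \<le> w"
proof (cases k)
  case 0
  have "AE w in return borel (0::real). 0 \<le> w" by (subst AE_return) auto
  then show ?thesis by (simp only: 0 lindley.simps)
next
  case (Suc j)
  have "AE w in distr (\<nu> \<Otimes>\<^sub>M lindley \<nu> j) borel (\<lambda>(y, w). max 0 (y + w)). 0 \<le> w"
    by (subst AE_distr_iff) (auto simp: split_beta)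
  then show ?thesis by (simp only: Suc lindley.simps)
qed

abbreviation step_pair :: "nat \<Rightarrow> (real \<times> real) measure" where
  "step_pair k \<equiv> \<nu> \<Otimes>\<^sub>M lindley \<nu> k"

lemma integrable_pair_fst:
  fixes g :: "real \<Rightarrow> 'b :: {banach, second_countable_topology}"
  assumes "integrable \<nu> g"
  shows "integrable (step_pair k) (\<lambda>p. g (fst p))"
proof -
  interpret W: prob_space "lindley \<nu> k" by (rule prob_lindley)
  have "distr (step_pair k) \<nu> fst = \<nu>" by (rule W.distr_pair_fst)
  with assms show ?thesis
    by (metis integrable_distr measurable_fst)
qed

lemma integral_pair_fst:
  fixes g :: "real \<Rightarrow> 'b :: {banach, second_countable_topology}"
  assumes g: "integrable \<nu> g"
  shows "(\<integral>p. g (fst p) \<partial>step_pair k) = (\<integral>y. g y \<partial>\<nu>)"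
proof -
  interpret W: prob_space "lindley \<nu> k" by (rule prob_lindley)
  have "distr (step_pair k) \<nu> fst = \<nu>" by (rule W.distr_pair_fst)
  then show ?thesis
    using integral_distr[of fst "step_pair k" \<nu> g] g by (metis borel_measurable_integrable measurable_fst)
qed

lemma distr_pair_snd_lindley: "distr (step_pair k) (lindley \<nu> k) snd = lindley \<nu> k"
proof -
  interpret W: prob_space "lindley \<nu> k" by (rule prob_lindley)
  interpret P: pair_prob_space \<nu> "lindley \<nu> k" ..
  show ?thesis
  proof (rule measure_eqI)
    fix A assume "A \<in> sets (distr (step_pair k) (lindley \<nu> k) snd)"
    then have A: "A \<in> sets (lindley \<nu> k)" by simp
    then have "emeasure (distr (step_pair k) (lindley \<nu> k) snd) A = emeasure (step_pair k) (UNIV \<times> A)"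
      by (auto simp: emeasure_distr space_pair_measure intro!: arg_cong2[where f=emeasure])
    also have "\<dots> = emeasure \<nu> UNIV * emeasure (lindley \<nu> k) A"
      using A W.emeasure_pair_measure_Times[of UNIV \<nu> A] by simp
    finally show "emeasure (distr (step_pair k) (lindley \<nu> k) snd) A = emeasure (lindley \<nu> k) A"
      using \<nu>.emeasure_space_1 by simp
  qed simp
qed

lemma
  fixes g :: "real \<Rightarrow> 'b :: {banach, second_countable_topology}"
  assumes g: "integrable (lindley \<nu> k) g"
  shows integrable_pair_snd: "integrable (step_pair k) (\<lambda>p. g (snd p))"
    and integral_pair_snd: "(\<integral>p. g (snd p) \<partial>step_pair k) = (\<integral>w. g w \<partial>lindley \<nu> k)"
  using integral_distr[of snd "step_pair k" "lindley \<nu> k" g]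
    integrable_distr[of snd "step_pair k" "lindley \<nu> k" g] g distr_pair_snd_lindley[of k]
  by auto

lemma AE_pair_snd_nonneg: "AE p in step_pair k. 0 \<le> snd p"
proof -
  have "AE w in distr (step_pair k) (lindley \<nu> k) snd. 0 \<le> w"
    unfolding distr_pair_snd_lindley by (rule AE_lindley_nonneg)
  then show ?thesis by (subst (asm) AE_distr_iff) auto
qed

lemma integrable_lindley: "integrable (lindley \<nu> k) (\<lambda>w. w)"
proof (induction k)
  case 0
  interpret W: prob_space "lindley \<nu> 0" by (rule prob_lindley)
  show ?case
    by (rule W.integrable_const_bound[where B=0], unfold lindley.simps, subst AE_return) auto
next
  case (Suc k)
  have "integrable (step_pair k) (\<lambda>p. max 0 (fst p + snd p))"
    using integrable_pair_fst[OF integrable_step] integrable_pair_snd[OF Suc] by auto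
  then show ?case by (simp add: integrable_distr_eq split_beta)
qed

definition lindley_mean :: "nat \<Rightarrow> real" where
  "lindley_mean k = (\<integral>w. w \<partial>lindley \<nu> k)"

definition lindley_transform :: "nat \<Rightarrow> complex \<Rightarrow> complex" where
  "lindley_transform k z = (\<integral>w. exp (- (z * of_real w)) \<partial>lindley \<nu> k)"

text \<open>Since \<open>a^2 / 2 \<le> exp a\<close>, this bounds \<open>E a^2 exp a\<close> for any random variable \<open>a\<close> lying between
  \<open>0\<close> and the negative part of a step.\<close>

definition remainder_const :: real where
  "remainder_const = (\<integral>y. 2 * (1 + exp (- 2 * y)) \<partial>\<nu>)"

lemma remainder_const_nonneg: "0 \<le> remainder_const"
  unfolding remainder_const_def by (intro integral_nonneg_AE) auto

lemma lindley_mean_0 [simp]: "lindley_mean 0 = 0"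
  by (simp add: lindley_mean_def integral_return)

lemma lindley_transform_0 [simp]: "lindley_transform 0 z = 1"
  by (simp add: lindley_transform_def integral_return)

lemma exp_pos_le:
  assumes "0 \<le> r" "r \<le> 1"
  shows "exp (- (r * y)) \<le> 1 + exp (- 2 * (y::real))"
proof (cases "0 \<le> y")
  case True
  then have "exp (- (r * y)) \<le> 1" using assms by simp
  then show ?thesis by (smt (verit) exp_gt_zero)
next
  case False
  then have "r * y \<ge> 2 * y" using assms by (intro mult_right_mono_neg) auto
  then have "exp (- (r * y)) \<le> exp (- 2 * y)" by simp
  then show ?thesis by linarith
qed

lemma exp_second_order:
  fixes z :: complex
  assumes "norm z \<le> 1" "0 \<le> (a::real)"
  shows "norm (exp (z * of_real a) - 1 - z * of_real a) \<le> (norm z)\<^sup>2 * (2 * exp (2 * a))"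
proof -
  have "norm (exp (z * of_real a) - (\<Sum>k\<le>1. (z * of_real a) ^ k / fact k))
      \<le> exp \<bar>Re (z * of_real a)\<bar> * norm (z * of_real a) ^ Suc 1 / fact 1"
    by (rule Taylor_exp)
  also have "(\<Sum>k\<le>1. (z * of_real a) ^ k / fact k) = 1 + z * of_real a"
    by simp
  also have "exp \<bar>Re (z * of_real a)\<bar> * norm (z * of_real a) ^ Suc 1 / fact 1
      \<le> exp a * ((norm z)\<^sup>2 * a\<^sup>2)"
  proof -
    have "\<bar>Re (z * of_real a)\<bar> \<le> 1 * a"
      using assms abs_Re_le_cmod[of z] by (simp only: Re_complex_of_real Im_complex_of_real mult_zero_right diff_zero times_complex.sel abs_mult abs_of_nonneg)
        (intro mult_right_mono, auto)
    then have "exp \<bar>Re (z * of_real a)\<bar> \<le> exp a" by simp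
    then have "exp \<bar>Re (z * of_real a)\<bar> * (norm z * a)\<^sup>2 \<le> exp a * (norm z * a)\<^sup>2"
      by (rule mult_right_mono) simp
    then show ?thesis using assms
      by (simp add: norm_mult power2_eq_square mult_ac)
  qed
  also have "\<dots> \<le> (norm z)\<^sup>2 * (2 * exp (2 * a))"
  proof -
    have "a\<^sup>2 / 2 \<le> exp a" using exp_lower_Taylor_quadratic[of a] assms by simp
    then have "exp a * a\<^sup>2 \<le> exp a * (2 * exp a)" by (intro mult_left_mono) auto
    also have "\<dots> = 2 * exp (2 * a)" by (simp add: exp_add[symmetric])
    finally have "(norm z)\<^sup>2 * (exp a * a\<^sup>2) \<le> (norm z)\<^sup>2 * (2 * exp (2 * a))"
      by (rule mult_left_mono) simp
    then show ?thesis by (simp add: mult_ac)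
  qed
  finally show ?thesis by (simp add: algebra_simps)
qed

lemma integrable_transform_step:
  assumes "0 \<le> Re z" "norm z \<le> 1"
  shows "integrable \<nu> (\<lambda>y. exp (- (z * of_real y)))"
proof (rule Bochner_Integration.integrable_bound)
  show "integrable \<nu> (\<lambda>y. 1 + exp (- 2 * y))" using exp_moment_step by auto
  have "Re z \<le> 1" using assms abs_Re_le_cmod[of z] by linarith
  then show "AE y in \<nu>. norm (exp (- (z * of_real y))) \<le> norm (1 + exp (- 2 * y))"
    using exp_pos_le[of "Re z"] assms by (auto simp: add_nonneg_nonneg)
qed measurable

lemma integrable_transform_pair:
  assumes "0 \<le> Re z" "norm z \<le> 1"
  shows "integrable (step_pair k) (\<lambda>p. exp (- (z * of_real (fst p))) * exp (- (z * of_real (snd p))))"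
proof (rule Bochner_Integration.integrable_bound)
  show "integrable (step_pair k) (\<lambda>p. exp (- (z * of_real (fst p))))"
    by (intro integrable_pair_fst integrable_transform_step assms)
  show "AE p in step_pair k. norm (exp (- (z * of_real (fst p))) * exp (- (z * of_real (snd p))))
      \<le> norm (exp (- (z * of_real (fst p))))"
    using AE_pair_snd_nonneg[of k]
    by eventually_elim (use assms in \<open>simp add: norm_mult\<close>)
qed measurable

lemma integral_transform_pair:
  assumes "0 \<le> Re z" "norm z \<le> 1"
  shows "(\<integral>p. exp (- (z * of_real (fst p))) * exp (- (z * of_real (snd p))) \<partial>step_pair k)
    = (\<integral>y. exp (- (z * of_real y)) \<partial>\<nu>) * lindley_transform k z"
proof -
  interpret W: prob_space "lindley \<nu> k" by (rule prob_lindley)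
  interpret P: pair_prob_space \<nu> "lindley \<nu> k" ..
  have "(\<integral>p. exp (- (z * of_real (fst p))) * exp (- (z * of_real (snd p))) \<partial>step_pair k)
    = (\<integral>y. (\<integral>w. exp (- (z * of_real y)) * exp (- (z * of_real w)) \<partial>lindley \<nu> k) \<partial>\<nu>)"
    using P.integral_fst'[OF integrable_transform_pair[OF assms], symmetric] by simp
  then show ?thesis
    by (simp add: lindley_transform_def)
qed

lemma lindley_mean_mono: "lindley_mean k \<le> lindley_mean (Suc k)"
proof -
  have s: "integrable (step_pair k) (\<lambda>p. fst p + snd p)"
    using integrable_pair_fst[OF integrable_step] integrable_pair_snd[OF integrable_lindley] by auto
  have "lindley_mean k = (\<integral>p. fst p + snd p \<partial>step_pair k)"
    using integrable_pair_fst[OF integrable_step] integrable_pair_snd[OF integrable_lindley]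
      integral_pair_fst[OF integrable_step] integral_pair_snd[OF integrable_lindley] mean_step
    by (simp add: lindley_mean_def)
  also have "\<dots> \<le> (\<integral>p. max 0 (fst p + snd p) \<partial>step_pair k)"
    by (rule integral_mono) (use s in auto)
  also have "\<dots> = lindley_mean (Suc k)"
    by (simp add: lindley_mean_def integral_distr split_beta)
  finally show ?thesis .
qed

text \<open>One step of the recursion multiplies the transform by that of the step, except for the mass that
  the reflection at \<open>0\<close> moves.  To first order in \<open>z\<close> the reflection contributes \<open>z\<close> times the mean
  of the reflected amount, and this mean is exactly the growth of the mean of the maximum because
  the steps are centred.\<close>

lemma lindley_transform_step:
  assumes z: "0 \<le> Re z" "norm z \<le> 1"
  shows "norm (lindley_transform (Suc k) z
      - (\<integral>y. exp (- (z * of_real y)) \<partial>\<nu>) * lindley_transform k z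
      + z * of_real (lindley_mean (Suc k) - lindley_mean k)) \<le> (norm z)\<^sup>2 * remainder_const"
proof -
  let ?P = "step_pair k"
  define s where "s p = fst p + snd p" for p :: "real \<times> real"
  define a where "a p = max 0 (- s p)" for p
  have [measurable]: "s \<in> borel_measurable ?P" "a \<in> borel_measurable ?P"
    unfolding s_def a_def by measurable
  have int_s: "integrable ?P s"
    unfolding s_def using integrable_pair_fst[OF integrable_step] integrable_pair_snd[OF integrable_lindley]
    by auto
  have int_a: "integrable ?P a" unfolding a_def using int_s by auto
  have mean: "lindley_mean (Suc k) - lindley_mean k = (\<integral>p. a p \<partial>?P)"
  proof -
    have "lindley_mean (Suc k) = (\<integral>p. s p + a p \<partial>?P)"
      unfolding lindley_mean_def
      by (auto simp: integral_distr split_beta s_def a_def max_def intro!: Bochner_Integration.integral_cong)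
    also have "\<dots> = (\<integral>p. s p \<partial>?P) + (\<integral>p. a p \<partial>?P)" using int_s int_a by simp
    also have "(\<integral>p. s p \<partial>?P) = lindley_mean k"
      unfolding s_def lindley_mean_def
      using integrable_pair_fst[OF integrable_step] integrable_pair_snd[OF integrable_lindley]
        integral_pair_fst[OF integrable_step] integral_pair_snd[OF integrable_lindley] mean_step
      by simp
    finally show ?thesis by simp
  qed
  define E where "E p = exp (- (z * of_real (fst p))) * exp (- (z * of_real (snd p)))" for p :: "real \<times> real"
  have iE: "integrable ?P E" unfolding E_def by (rule integrable_transform_pair[OF z])
  have EI: "(\<integral>p. E p \<partial>?P) = (\<integral>y. exp (- (z * of_real y)) \<partial>\<nu>) * lindley_transform k z"
    unfolding E_def by (rule integral_transform_pair[OF z])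
  define r where "r p = exp (z * of_real (a p)) - 1 - z * of_real (a p)" for p
  have [measurable]: "r \<in> borel_measurable ?P" unfolding r_def by measurable
  \<comment> \<open>As \<open>snd p \<ge> 0\<close>, the reflected amount never exceeds the negative part of the step \<open>fst p\<close>.\<close>
  have bnd: "AE p in ?P. norm (r p) \<le> (norm z)\<^sup>2 * (2 * (1 + exp (- 2 * fst p)))"
    using AE_pair_snd_nonneg[of k]
  proof eventually_elim
    case (elim p)
    have "norm (r p) \<le> (norm z)\<^sup>2 * (2 * exp (2 * a p))"
      unfolding r_def by (rule exp_second_order) (auto simp: z a_def)
    also have "exp (2 * a p) \<le> 1 + exp (- 2 * fst p)"
    proof (cases "a p = 0")
      case False
      then have "2 * a p \<le> - 2 * fst p" using elim by (auto simp: a_def s_def max_def split: if_splits)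
      then have "exp (2 * a p) \<le> exp (- 2 * fst p)" by simp
      then show ?thesis by linarith
    qed simp
    finally show ?case by (simp add: mult_left_mono)
  qed
  have ib: "integrable \<nu> (\<lambda>y. 2 * (1 + exp (- 2 * y)))"
    using exp_moment_step by auto
  have ibP: "integrable ?P (\<lambda>p. (norm z)\<^sup>2 * (2 * (1 + exp (- 2 * fst p))))"
    using integrable_pair_fst[OF ib, of k] by simp
  have ir: "integrable ?P r"
    by (rule Bochner_Integration.integrable_bound[OF ibP])
       (use bnd in \<open>auto elim!: eventually_mono simp: abs_mult add_nonneg_nonneg\<close>)
  have "lindley_transform (Suc k) z = (\<integral>p. exp (- (z * of_real (max 0 (s p)))) \<partial>?P)"
    unfolding lindley_transform_def by (simp add: integral_distr split_beta s_def)
  also have "\<dots> = (\<integral>p. E p - (r p + z * of_real (a p)) \<partial>?P)"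
  proof (rule Bochner_Integration.integral_cong)
    fix p
    show "exp (- (z * of_real (max 0 (s p)))) = E p - (r p + z * of_real (a p))"
    proof (cases "s p \<ge> 0")
      case True
      then have "a p = 0" "max 0 (s p) = s p" by (auto simp: a_def)
      then show ?thesis by (simp add: E_def r_def s_def algebra_simps exp_add[symmetric] exp_diff exp_minus divide_inverse)
    next
      case False
      then have "a p = - s p" "max 0 (s p) = 0" by (auto simp: a_def)
      then have "E p = exp (z * of_real (a p))" "exp (- (z * of_real (max 0 (s p)))) = 1"
        by (simp_all only: E_def exp_add[symmetric]) (simp_all add: s_def algebra_simps)
      then show ?thesis by (simp add: r_def)
    qed
  qed simp
  also have "\<dots> = (\<integral>p. E p \<partial>?P) - ((\<integral>p. r p \<partial>?P) + z * of_real (\<integral>p. a p \<partial>?P))"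
    using iE ir int_a by simp
  finally have "lindley_transform (Suc k) z
      - (\<integral>y. exp (- (z * of_real y)) \<partial>\<nu>) * lindley_transform k z
      + z * of_real (lindley_mean (Suc k) - lindley_mean k) = - (\<integral>p. r p \<partial>?P)"
    using EI mean by simp
  moreover have "norm (\<integral>p. r p \<partial>?P) \<le> (\<integral>p. (norm z)\<^sup>2 * (2 * (1 + exp (- 2 * fst p))) \<partial>?P)"
    by (rule order_trans[OF integral_norm_bound integral_mono_AE[OF integrable_norm[OF ir] ibP bnd]])
  moreover have "\<dots> = (norm z)\<^sup>2 * remainder_const"
    unfolding remainder_const_def using integral_pair_fst[OF ib, of k] by simp
  ultimately show ?thesis by (simp only: norm_minus_cancel)
qed

text \<open>The factor \<open>Q\<close> only has to dominate \<open>norm q\<close>; in the application both \<open>q ^ n\<close> and \<open>Q ^ n\<close> do not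
  depend on \<open>n\<close>, so that the error is \<open>n\<close> times the one-step error up to a constant.\<close>

lemma lindley_transform_unrolled:
  assumes z: "0 \<le> Re z" "norm z \<le> 1"
    and q: "(\<integral>y. exp (- (z * of_real y)) \<partial>\<nu>) = q" "norm q \<le> Q" "1 \<le> Q"
  shows "norm (lindley_transform n z - q ^ n
      + z * (\<Sum>k<n. q ^ (n - Suc k) * of_real (lindley_mean (Suc k) - lindley_mean k)))
    \<le> real n * (norm z)\<^sup>2 * remainder_const * Q ^ n"
proof (induction n)
  case 0
  show ?case by simp
next
  case (Suc n)
  let ?d = "\<lambda>k. of_real (lindley_mean (Suc k) - lindley_mean k) :: complex"
  let ?e = "\<lambda>n. lindley_transform n z - q ^ n + z * (\<Sum>k<n. q ^ (n - Suc k) * ?d k)"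
  let ?B = "(norm z)\<^sup>2 * remainder_const"
  have B: "0 \<le> ?B" using remainder_const_nonneg by simp
  have "(\<Sum>k<Suc n. q ^ (Suc n - Suc k) * ?d k) = q * (\<Sum>k<n. q ^ (n - Suc k) * ?d k) + ?d n"
  proof -
    have "q ^ (n - k) = q * q ^ (n - Suc k)" if "k < n" for k
      using that by (metis Suc_diff_Suc power_Suc)
    then show ?thesis by (simp add: sum_distrib_left mult.assoc)
  qed
  then have "?e (Suc n) = q * ?e n + (lindley_transform (Suc n) z - q * lindley_transform n z + z * ?d n)"
    by (simp add: algebra_simps)
  then have "norm (?e (Suc n)) \<le> norm q * norm (?e n) + ?B"
    using lindley_transform_step[OF z, of n] norm_triangle_ineq[of "q * ?e n"] q(1)
    by (smt (verit) norm_mult)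
  also have "\<dots> \<le> Q * (real n * ?B * Q ^ n) + ?B * Q ^ Suc n"
  proof (rule add_mono[OF mult_mono])
    show "?B \<le> ?B * Q ^ Suc n"
      using mult_left_mono[OF one_le_power[OF q(3), of "Suc n"] B] by simp
    show "norm (?e n) \<le> real n * ?B * Q ^ n"
      using Suc by (simp only: mult.assoc)
  qed (use q in auto)
  also have "\<dots> = real (Suc n) * (norm z)\<^sup>2 * remainder_const * Q ^ Suc n"
    by (simp add: algebra_simps)
  finally show ?case .
qed

end

section \<open>Scaling limits of discounted sums\<close>

text \<open>The antiderivative may be singular at the endpoints, as \<open>s powr a\<close> is at \<open>0\<close>.\<close>

lemma set_integral_FTC:
  fixes F f :: "real \<Rightarrow> 'b :: euclidean_space"
  assumes "a \<le> b" "continuous_on {a..b} F"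
    "\<And>x. a < x \<Longrightarrow> x < b \<Longrightarrow> (F has_vector_derivative f x) (at x)"
    "set_integrable lborel {a..b} f"
  shows "(LBINT x:{a..b}. f x) = F b - F a"
proof -
  have "(f has_integral (F b - F a)) {a..b}"
    using assms by (intro fundamental_theorem_of_calculus_interior) auto
  with set_borel_integral_eq_integral(2)[OF assms(4)] show ?thesis
    by (simp add: integral_unique)
qed

lemma set_integrable_powr_01:
  fixes a :: real
  assumes "0 < a"
  shows "set_integrable lborel {0..1} (\<lambda>s. s powr (a - 1))"
proof -
  have "set_integrable lborel {0..1} (\<lambda>t. t powr (a - 1) * (1 - t) powr (1 - 1))"
    by (rule integrable_Beta) (use assms in auto)
  then show ?thesis
    unfolding set_integrable_def
    by (rule integrable_discrete_difference[where X="{1}", THEN iffD1, rotated -1])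
       (auto simp: indicator_def)
qed

lemma set_integrable_bounded_mult:
  fixes g :: "real \<Rightarrow> real" and h :: "real \<Rightarrow> complex"
  assumes "set_integrable lborel A g" "h \<in> borel_measurable borel" "A \<in> sets borel"
    and B: "\<And>s. s \<in> A \<Longrightarrow> norm (h s) \<le> B"
  shows "set_integrable lborel A (\<lambda>s. of_real (g s) * h s)"
proof -
  have [measurable]: "(\<lambda>s. indicator A s *\<^sub>R g s) \<in> borel_measurable lborel"
    using assms(1) unfolding set_integrable_def by auto
  have [measurable]: "h \<in> borel_measurable borel" by fact
  have "integrable lborel (\<lambda>s. B * (indicator A s *\<^sub>R g s))"
    using assms(1) unfolding set_integrable_def by auto
  then have "integrable lborel (\<lambda>s. of_real (indicator A s *\<^sub>R g s) * h s)"
  proof (rule Bochner_Integration.integrable_bound)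
    show "AE s in lborel. norm (of_real (indicator A s *\<^sub>R g s) * h s) \<le> norm (B * (indicator A s *\<^sub>R g s))"
    proof (rule AE_I2)
      fix s
      have "\<bar>g s\<bar> * norm (h s) \<le> \<bar>g s\<bar> * \<bar>B\<bar>" if "s \<in> A"
        using B[OF that] by (intro mult_left_mono) auto
      then show "norm (of_real (indicator A s *\<^sub>R g s) * h s) \<le> norm (B * (indicator A s *\<^sub>R g s))"
        by (auto simp: norm_mult indicator_def mult.commute abs_mult)
    qed
  qed measurable
  then show ?thesis
    unfolding set_integrable_def by (simp add: scaleR_conv_of_real mult.assoc)
qed

text \<open>The integral in the transform of the supremum: an incomplete Gamma function of \<open>\<Psi>\<close> multiplied
  by \<open>exp \<Psi>\<close> and a power of \<open>\<Psi>\<close>.\<close>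

definition stable_kernel :: "real \<Rightarrow> complex \<Rightarrow> complex" where
  "stable_kernel a \<Psi> = (LBINT s:{0..1}. of_real (s powr (a - 1)) * exp (of_real (1 - s) * \<Psi>))"

lemma exp_norm_01:
  fixes \<Psi> :: complex
  assumes "0 \<le> s" "s \<le> 1"
  shows "norm (exp (of_real (1 - s) * \<Psi>)) \<le> exp \<bar>Re \<Psi>\<bar>"
proof -
  have "(1 - s) * Re \<Psi> \<le> \<bar>(1 - s) * Re \<Psi>\<bar>" by simp
  also have "\<dots> \<le> 1 * \<bar>Re \<Psi>\<bar>" using assms unfolding abs_mult by (intro mult_right_mono) auto
  finally show ?thesis by simp
qed

lemma set_integrable_stable_kernel:
  assumes "0 < a"
  shows "set_integrable lborel {0..1} (\<lambda>s. complex_of_real (s powr (a - 1)) * exp (of_real (1 - s) * \<Psi>))"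
  by (rule set_integrable_bounded_mult[OF set_integrable_powr_01[OF assms] _ _ exp_norm_01]) auto

text \<open>The left side is what summation by parts produces in the limit; the right side is an integral
  against the derivative of \<open>s powr a\<close>, the growth rate of the mean maximum.\<close>

lemma power_exp_by_parts:
  fixes \<Psi> :: complex and a :: real
  assumes "0 < a"
  shows "1 + \<Psi> * (LBINT s:{0..1}. of_real (s powr a) * exp (of_real (1 - s) * \<Psi>))
    = of_real a * stable_kernel a \<Psi>"
proof -
  let ?e = "\<lambda>s::real. exp (of_real (1 - s) * \<Psi>)"
  have [measurable]: "?e \<in> borel_measurable borel"
    by measurable
  have int: "set_integrable lborel {0..1} (\<lambda>s. of_real (s powr (b - 1)) * ?e s)" if "0 < b" for b
    by (rule set_integrable_bounded_mult[OF set_integrable_powr_01[OF that] _ _ exp_norm_01]) auto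
  have i1: "set_integrable lborel {0..1} (\<lambda>s. of_real a * (of_real (s powr (a - 1)) * ?e s))"
    using int[OF assms] by (rule set_integrable_mult_right)
  have i2: "set_integrable lborel {0..1} (\<lambda>s. \<Psi> * (of_real (s powr a) * ?e s))"
    using int[of "a + 1"] assms by (intro set_integrable_mult_right) auto
  have "(LBINT s:{0..1}. of_real a * (of_real (s powr (a - 1)) * ?e s) - \<Psi> * (of_real (s powr a) * ?e s))
    = of_real (1 powr a) * ?e 1 - of_real (0 powr a) * ?e 0"
  proof (rule set_integral_FTC)
    show "continuous_on {0..1} (\<lambda>s. of_real (s powr a) * ?e s)"
      using assms by (intro continuous_intros continuous_on_powr') auto
    show "set_integrable lborel {0..1}
      (\<lambda>s. of_real a * (of_real (s powr (a - 1)) * ?e s) - \<Psi> * (of_real (s powr a) * ?e s))"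
      by (rule set_integral_diff(1)[OF i1 i2])
    fix s :: real assume "0 < s" "s < 1"
    have "((\<lambda>z. exp ((1 - z) * \<Psi>)) has_field_derivative - \<Psi> * ?e s) (at (of_real s))"
      by (auto intro!: derivative_eq_intros)
    from has_vector_derivative_real_field[OF this]
    have e: "(?e has_vector_derivative - \<Psi> * ?e s) (at s)" by simp
    have "((\<lambda>s. s powr a) has_real_derivative a * s powr (a - 1)) (at s)"
      using \<open>0 < s\<close> by (auto intro!: derivative_eq_intros)
    then have "((\<lambda>s. of_real (s powr a)) has_vector_derivative (of_real (a * s powr (a - 1)) :: complex)) (at s)"
      by (intro has_vector_derivative_of_real) (simp add: has_real_derivative_iff_has_vector_derivative)
    from has_vector_derivative_mult[OF this e]
    show "((\<lambda>s. of_real (s powr a) * ?e s) has_vector_derivative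
      of_real a * (of_real (s powr (a - 1)) * ?e s) - \<Psi> * (of_real (s powr a) * ?e s)) (at s)"
      by (simp add: algebra_simps)
  qed simp
  then show ?thesis
    unfolding stable_kernel_def using set_integral_diff(2)[OF i1 i2] by (simp add: algebra_simps)
qed

lemma summation_by_parts:
  fixes w m :: "nat \<Rightarrow> 'b :: comm_ring"
  shows "(\<Sum>k<n. w (Suc k) * (m (Suc k) - m k)) = w n * m n - w 0 * m 0 + (\<Sum>k<n. m k * (w k - w (Suc k)))"
  by (induction n) (auto simp: algebra_simps)

lemma regularly_varying_step_limit:
  fixes m :: "nat \<Rightarrow> real" and a s c :: real
  assumes a: "0 < a" and lim: "(\<lambda>n. m n / real n powr a) \<longlonglongrightarrow> c" and s: "0 < s"
  shows "(\<lambda>n. m (nat \<lfloor>real n * s\<rfloor>) / real n powr a) \<longlonglongrightarrow> c * s powr a"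
proof -
  let ?k = "\<lambda>n. nat \<lfloor>real n * s\<rfloor>"
  have k: "filterlim ?k at_top sequentially"
    using s by real_asymp
  have r: "(\<lambda>n. real (?k n) / real n) \<longlonglongrightarrow> s"
  proof -
    have "(\<lambda>n. real_of_int \<lfloor>real n * s\<rfloor> / real n) \<longlonglongrightarrow> s" using s by real_asymp
    then show ?thesis using s by (simp add: of_nat_nat)
  qed
  have "(\<lambda>n. m (?k n) / real (?k n) powr a * (real (?k n) / real n) powr a) \<longlonglongrightarrow> c * s powr a"
    using a s by (intro tendsto_intros filterlim_compose[OF lim k] r) auto
  moreover have "\<forall>\<^sub>F n in sequentially. m (?k n) / real (?k n) powr a * (real (?k n) / real n) powr a
     = m (?k n) / real n powr a"
    using filterlim_at_top[THEN iffD1, OF k, rule_format, of 1]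
    by eventually_elim (auto simp: powr_divide)
  ultimately show ?thesis by (rule Lim_transform_eventually)
qed


lemma regularly_varying_bound:
  fixes m :: "nat \<Rightarrow> real" and a c :: real
  assumes a: "0 < a" and lim: "(\<lambda>n. m n / real n powr a) \<longlonglongrightarrow> c" and m0: "m 0 = 0"
  obtains B where "0 \<le> B" "\<And>k n. k \<le> n \<Longrightarrow> \<bar>m k / real n powr a\<bar> \<le> B"
proof -
  have "Bseq (\<lambda>n. m n / real n powr a)" using lim by (rule convergentI[THEN convergent_imp_Bseq])
  then obtain B where B: "0 < B" "\<And>n. \<bar>m n / real n powr a\<bar> \<le> B"
    by (auto simp: Bseq_def)
  have "\<bar>m k / real n powr a\<bar> \<le> B" if "k \<le> n" for k n
  proof (cases "k = 0")
    case True
    then show ?thesis using m0 B by simp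
  next
    case False
    then have "\<bar>m k\<bar> \<le> B * real k powr a" using B(2)[of k] by (simp add: field_simps)
    also have "\<dots> \<le> B * real n powr a" using that B a by (intro mult_left_mono powr_mono2) auto
    finally show ?thesis using False that by (simp add: field_simps)
  qed
  with B that show ?thesis by (metis less_imp_le)
qed

text \<open>Expresses the differences of the discount factors as integrals, so that a sum weighted with them
  becomes an integral of a step function.\<close>

lemma exp_increment_integral:
  fixes \<Psi> :: complex
  assumes "u \<le> v"
  shows "set_integrable lborel {u..<v} (\<lambda>s. \<Psi> * exp (of_real (1 - s) * \<Psi>))"
    and "(LBINT s:{u..<v}. \<Psi> * exp (of_real (1 - s) * \<Psi>))
      = exp (of_real (1 - u) * \<Psi>) - exp (of_real (1 - v) * \<Psi>)"
proof -
  let ?f = "\<lambda>s. \<Psi> * exp (of_real (1 - s) * \<Psi>)"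
  have i: "set_integrable lborel {u..v} ?f"
    unfolding set_integrable_def
    by (rule borel_integrable_compact) (auto intro!: continuous_intros)
  then show "set_integrable lborel {u..<v} ?f"
    by (rule set_integrable_subset) auto
  have "(LBINT s:{u..<v}. ?f s) = (LBINT s:{u..v}. ?f s)"
  proof (rule set_integral_cong_set)
    show "AE s in lborel. (s \<in> {u..v}) = (s \<in> {u..<v})"
      using AE_lborel_singleton[of v] by eventually_elim auto
  qed (auto simp: set_borel_measurable_def)
  also have "\<dots> = - exp (of_real (1 - v) * \<Psi>) - (- exp (of_real (1 - u) * \<Psi>))"
  proof (rule set_integral_FTC[OF assms _ _ i])
    fix s :: real
    have "((\<lambda>z. - exp ((1 - z) * \<Psi>)) has_field_derivative ?f s) (at (of_real s))"
      by (auto intro!: derivative_eq_intros)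
    from has_vector_derivative_real_field[OF this]
    show "((\<lambda>s. - exp (of_real (1 - s) * \<Psi>)) has_vector_derivative ?f s) (at s)" by simp
  qed (auto intro!: continuous_intros)
  finally show "(LBINT s:{u..<v}. ?f s) = exp (of_real (1 - u) * \<Psi>) - exp (of_real (1 - v) * \<Psi>)"
    by simp
qed

text \<open>After summation by parts the increments of \<open>m\<close> are replaced by its values, about which a growth
  rate gives direct information; increments could not be controlled individually.\<close>

lemma discounted_sum_as_integral:
  fixes m :: "nat \<Rightarrow> real" and \<Psi> :: complex
  assumes n: "0 < n" and m0: "m 0 = 0"
  shows "(\<Sum>k<n. exp (\<Psi> / of_nat n) ^ (n - Suc k) * of_real (m (Suc k) - m k))
    = of_real (m n) + (LBINT s:{0..<1}. of_real (m (nat \<lfloor>real n * s\<rfloor>)) * (\<Psi> * exp (of_real (1 - s) * \<Psi>)))"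
proof -
  define w where "w k = exp (of_real (1 - real k / real n) * \<Psi>)" for k
  have w: "exp (\<Psi> / of_nat n) ^ (n - k) = w k" if "k \<le> n" for k
  proof -
    have "exp (\<Psi> / of_nat n) ^ (n - k) = exp (of_nat (n - k) * (\<Psi> / of_nat n))"
      by (rule exp_of_nat_mult[symmetric])
    also have "of_nat (n - k) * (\<Psi> / of_nat n) = of_real (1 - real k / real n) * \<Psi>"
      using n that by (simp add: of_nat_diff field_simps)
    finally show ?thesis by (simp add: w_def)
  qed
  let ?I = "\<lambda>k. {real k / real n..<real (Suc k) / real n}"
  let ?f = "\<lambda>s. \<Psi> * exp (of_real (1 - s) * \<Psi>)"
  have le: "real k / real n \<le> real (Suc k) / real n" for k by (simp add: divide_right_mono)
  \<comment> \<open>For \<open>s\<close> in the \<open>k\<close>-th cell of the grid the step function has the value \<open>m k\<close>.\<close>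
  have split: "indicator {0..<1} s *\<^sub>R (of_real (m (nat \<lfloor>real n * s\<rfloor>)) * ?f s)
    = (\<Sum>k<n. of_real (m k) * (indicator (?I k) s *\<^sub>R ?f s))" for s
  proof -
    have eq: "s \<in> ?I k \<longleftrightarrow> k = nat \<lfloor>real n * s\<rfloor>" if "0 \<le> s" for k
    proof -
      have "s \<in> ?I k \<longleftrightarrow> real k \<le> real n * s \<and> real n * s < real k + 1"
        using n by (auto simp: field_simps)
      also have "\<dots> \<longleftrightarrow> \<lfloor>real n * s\<rfloor> = int k" by (simp add: floor_eq_iff)
      also have "\<dots> \<longleftrightarrow> k = nat \<lfloor>real n * s\<rfloor>" using that by (auto simp: nat_eq_iff)
      finally show ?thesis .
    qed
    have neg: "s \<notin> ?I k" if "s < 0" for k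
    proof -
      have "0 \<le> real k / real n" by simp
      with that show ?thesis by (simp only: atLeastLessThan_iff) linarith
    qed
    show ?thesis
    proof (cases "s \<in> {0..<1}")
      case True
      then have "nat \<lfloor>real n * s\<rfloor> < n"
        using n by (simp add: nat_less_iff floor_less_iff)
      moreover have "(\<Sum>k<n. of_real (m k) * (indicator (?I k) s *\<^sub>R ?f s))
        = (\<Sum>k<n. if k = nat \<lfloor>real n * s\<rfloor> then of_real (m k) * ?f s else 0)"
      proof (intro sum.cong refl)
        fix k
        have "indicator (?I k) s = (if k = nat \<lfloor>real n * s\<rfloor> then 1 else 0 :: real)"
          using eq[of k] True by (simp only: indicator_def of_bool_def) simp
        then show "of_real (m k) * (indicator (?I k) s *\<^sub>R ?f s)
          = (if k = nat \<lfloor>real n * s\<rfloor> then of_real (m k) * ?f s else 0)"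
          by (cases "k = nat \<lfloor>real n * s\<rfloor>") (simp_all only: if_True if_False refl scaleR_one scaleR_zero_left mult_zero_right)
      qed
      ultimately show ?thesis using True by simp
    next
      case False
      then consider "s < 0" | "1 \<le> s" by force
      then have "(\<Sum>k<n. of_real (m k) * (indicator (?I k) s *\<^sub>R ?f s)) = 0"
      proof cases
        case 1
        then show ?thesis
          using neg by (intro sum.neutral ballI) (simp only: indicator_simps scaleR_zero_left mult_zero_right not_False_eq_True)
      next
        case 2
        have "s \<notin> ?I k" if "k < n" for k
        proof -
          have "real (Suc k) / real n \<le> 1" using that by simp
          with 2 show ?thesis by auto
        qed
        then show ?thesis by (intro sum.neutral) (auto simp del: atLeastLessThan_iff)
      qed
      with False show ?thesis by simp
    qed
  qed
  have "(LBINT s:{0..<1}. of_real (m (nat \<lfloor>real n * s\<rfloor>)) * ?f s)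
    = (\<Sum>k<n. of_real (m k) * (LBINT s:?I k. ?f s))"
  proof -
    have "integrable lborel (\<lambda>s. of_real (m k) * (indicator (?I k) s *\<^sub>R ?f s))" for k
      using exp_increment_integral(1)[OF le, of k \<Psi>, unfolded set_integrable_def]
      by (rule integrable_mult_right)
    then show ?thesis
      unfolding set_lebesgue_integral_def split
      by (simp only: Bochner_Integration.integral_sum integral_mult_right_zero)
  qed
  also have "\<dots> = (\<Sum>k<n. of_real (m k) * (w k - w (Suc k)))"
    by (intro sum.cong refl, subst exp_increment_integral(2)[OF le]) (simp add: w_def)
  finally have I: "(LBINT s:{0..<1}. of_real (m (nat \<lfloor>real n * s\<rfloor>)) * ?f s)
    = (\<Sum>k<n. of_real (m k) * (w k - w (Suc k)))" .
  have "(\<Sum>k<n. exp (\<Psi> / of_nat n) ^ (n - Suc k) * of_real (m (Suc k) - m k))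
    = (\<Sum>k<n. w (Suc k) * (of_real (m (Suc k)) - of_real (m k)))"
    by (intro sum.cong refl) (simp add: w)
  also have "\<dots> = w n * of_real (m n) - w 0 * of_real (m 0) + (\<Sum>k<n. of_real (m k) * (w k - w (Suc k)))"
    by (rule summation_by_parts)
  also have "w n = 1" using n by (simp add: w_def)
  finally show ?thesis using I m0 by simp
qed

text \<open>If \<open>m n\<close> grows like \<open>c * n powr a\<close>, the step function of the previous lemma tends to
  \<open>c * s powr a\<close> after scaling and is bounded, so dominated convergence applies.\<close>

lemma discounted_sum_limit:
  fixes m :: "nat \<Rightarrow> real" and \<Psi> :: complex and a c :: real
  assumes a: "0 < a" and lim: "(\<lambda>n. m n / real n powr a) \<longlonglongrightarrow> c" and m0: "m 0 = 0"
  shows "(\<lambda>n. (\<Sum>k<n. exp (\<Psi> / of_nat n) ^ (n - Suc k) * of_real (m (Suc k) - m k)) / of_real (real n powr a))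
    \<longlonglongrightarrow> of_real (c * a) * stable_kernel a \<Psi>"
proof -
  let ?f = "\<lambda>s. \<Psi> * exp (of_real (1 - s) * \<Psi>)"
  let ?g = "\<lambda>n s. of_real (m (nat \<lfloor>real n * s\<rfloor>) / real n powr a) * ?f s"
  obtain B where B: "0 \<le> B" "\<And>k n. k \<le> n \<Longrightarrow> \<bar>m k / real n powr a\<bar> \<le> B"
    using regularly_varying_bound[OF assms] by blast
  have "(\<lambda>n. LBINT s. indicator {0..<1} s *\<^sub>R ?g n s)
    \<longlonglongrightarrow> (LBINT s. indicator {0..<1} s *\<^sub>R (of_real (c * s powr a) * ?f s))"
  proof (rule integral_dominated_convergence)
    show "integrable lborel (\<lambda>s. indicator {0..1::real} s *\<^sub>R (B * (norm \<Psi> * exp \<bar>Re \<Psi>\<bar>)))"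
      by (rule borel_integrable_compact) auto
    show "AE s in lborel. (\<lambda>n. indicator {0..<1} s *\<^sub>R ?g n s)
      \<longlonglongrightarrow> indicator {0..<1} s *\<^sub>R (of_real (c * s powr a) * ?f s)"
      using AE_lborel_singleton[of 0]
    proof eventually_elim
      case (elim s)
      show ?case
      proof (cases "s \<in> {0..<1}")
        case True
        with elim have "0 < s" by auto
        show ?thesis
          by (intro tendsto_intros tendsto_of_real regularly_varying_step_limit[OF a lim \<open>0 < s\<close>])
      qed simp
    qed
    fix n
    show "AE s in lborel. norm (indicator {0..<1} s *\<^sub>R ?g n s)
       \<le> indicator {0..1::real} s *\<^sub>R (B * (norm \<Psi> * exp \<bar>Re \<Psi>\<bar>))"
    proof (rule AE_I2)
      fix s :: real
      show "norm (indicator {0..<1} s *\<^sub>R ?g n s)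
       \<le> indicator {0..1::real} s *\<^sub>R (B * (norm \<Psi> * exp \<bar>Re \<Psi>\<bar>))"
      proof (cases "s \<in> {0..<1}")
        case True
        then have "real n * s \<le> real n * 1" by (intro mult_left_mono) auto
        then have "nat \<lfloor>real n * s\<rfloor> \<le> n" by (simp add: floor_le_iff nat_le_iff)
        from B(2)[OF this] True exp_norm_01[of s \<Psi>] B(1)
        have "\<bar>m (nat \<lfloor>real n * s\<rfloor>) / real n powr a\<bar> * (norm \<Psi> * norm (exp (of_real (1 - s) * \<Psi>)))
          \<le> B * (norm \<Psi> * exp \<bar>Re \<Psi>\<bar>)"
          by (intro mult_mono) auto
        then show ?thesis using True by (simp add: norm_mult norm_divide)
      qed (use B(1) in auto)
    qed
  qed measurable
  then have I: "(\<lambda>n. LBINT s:{0..<1}. ?g n s) \<longlonglongrightarrow> (LBINT s:{0..<1}. of_real (c * s powr a) * ?f s)"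
    by (simp only: set_lebesgue_integral_def)
  have L1: "(\<lambda>n. of_real (m n / real n powr a) + (LBINT s:{0..<1}. ?g n s))
    \<longlonglongrightarrow> of_real c + (LBINT s:{0..<1}. of_real (c * s powr a) * ?f s)"
    by (intro tendsto_intros I tendsto_of_real lim)
  have L2: "\<forall>\<^sub>F n in sequentially. of_real (m n / real n powr a) + (LBINT s:{0..<1}. ?g n s)
    = (\<Sum>k<n. exp (\<Psi> / of_nat n) ^ (n - Suc k) * of_real (m (Suc k) - m k)) / of_real (real n powr a)"
    using eventually_gt_at_top[of 0]
  proof eventually_elim
    case (elim n)
    have "(LBINT s:{0..<1}. ?g n s)
      = (LBINT s:{0..<1}. of_real (m (nat \<lfloor>real n * s\<rfloor>)) * ?f s / of_real (real n powr a))"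
      by (intro arg_cong[where f="set_lebesgue_integral lborel {0..<1}"]) (simp add: fun_eq_iff)
    then show ?case
      using discounted_sum_as_integral[where m=m, OF elim m0, of \<Psi>]
      by (simp add: add_divide_distrib)
  qed
  have L3: "of_real c + (LBINT s:{0..<1}. of_real (c * s powr a) * ?f s)
    = of_real (c * a) * stable_kernel a \<Psi>"
  proof -
    have "(LBINT s:{0..<1}. of_real (c * s powr a) * ?f s)
      = (LBINT s:{0..1}. of_real (c * s powr a) * ?f s)"
    proof (rule set_integral_cong_set)
      show "AE s in lborel. (s \<in> {0..1::real}) = (s \<in> {0..<1})"
        using AE_lborel_singleton[of 1] by eventually_elim auto
    qed (auto simp: set_borel_measurable_def)
    also have "\<dots> = (LBINT s:{0..1}. (of_real c * \<Psi>) * (of_real (s powr a) * exp (of_real (1 - s) * \<Psi>)))"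
      by (simp add: mult_ac)
    also have "\<dots> = of_real c * (\<Psi> * (LBINT s:{0..1}. of_real (s powr a) * exp (of_real (1 - s) * \<Psi>)))"
      by (simp only: set_integral_mult_right mult.assoc)
    finally have J: "(LBINT s:{0..<1}. of_real (c * s powr a) * ?f s)
      = of_real c * (\<Psi> * (LBINT s:{0..1}. of_real (s powr a) * exp (of_real (1 - s) * \<Psi>)))" .
    show ?thesis
      unfolding J
      by (simp only: of_real_mult mult.assoc power_exp_by_parts[OF a, symmetric] distrib_left mult_1_right)
  qed
  show ?thesis using Lim_transform_eventually[OF L1 L2] unfolding L3 .
qed

section \<open>Suprema of cadlag paths and maxima of walks\<close>

lemma cadlag_locally_bounded:
  assumes "cadlag p" "0 \<le> t"
  shows "\<exists>d>0. \<exists>B. \<forall>s\<ge>0. \<bar>s - t\<bar> < d \<longrightarrow> p s \<le> B"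
proof -
  have "(p \<longlongrightarrow> p t) (at_right t)" using assms by (auto simp: cadlag_def)
  then have "\<forall>\<^sub>F s in at_right t. p s < p t + 1" by (rule order_tendstoD) simp
  then obtain b where b: "b > t" "\<And>s. t < s \<Longrightarrow> s < b \<Longrightarrow> p s < p t + 1"
    by (auto simp: eventually_at_right_field)
  have "\<exists>e<t. \<exists>l. \<forall>s\<ge>0. e < s \<longrightarrow> s < t \<longrightarrow> p s \<le> l"
  proof (cases "t = 0")
    case True
    then show ?thesis by (intro exI[of _ "- 1"]) auto
  next
    case False
    with assms(2) have "0 < t" by simp
    then obtain l where "(p \<longlongrightarrow> l) (at_left t)" using assms(1) unfolding cadlag_def by blast
    then have "\<forall>\<^sub>F s in at_left t. p s < l + 1" by (rule order_tendstoD) simp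
    then obtain e where "e < t" "\<And>s. e < s \<Longrightarrow> s < t \<Longrightarrow> p s < l + 1"
      by (auto simp: eventually_at_left_field)
    then show ?thesis by (intro exI[of _ e] conjI exI[of _ "l + 1"]) (auto intro: less_imp_le)
  qed
  then obtain e l where e: "e < t" "\<And>s. 0 \<le> s \<Longrightarrow> e < s \<Longrightarrow> s < t \<Longrightarrow> p s \<le> l" by blast
  show ?thesis
  proof (intro exI conjI allI impI)
    show "0 < min (b - t) (t - e)" using b e by simp
    fix s :: real assume s: "0 \<le> s" "\<bar>s - t\<bar> < min (b - t) (t - e)"
    consider "s < t" | "s = t" | "t < s" by linarith
    then show "p s \<le> max (max (p t) (p t + 1)) l"
    proof cases
      case 1
      then have "p s \<le> l" using e(2)[of s] s by auto
      then show ?thesis by simp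
    next
      case 3
      then have "p s < p t + 1" using b(2)[of s] s by auto
      then show ?thesis by simp
    qed simp
  qed
qed

text \<open>A finite subcover of the neighbourhoods on which the path is bounded.\<close>

lemma cadlag_bdd_above:
  assumes "cadlag p"
  shows "bdd_above (p ` {0..T})"
proof -
  obtain d B where dB: "\<And>t. 0 \<le> t \<Longrightarrow> 0 < d t" "\<And>t s. 0 \<le> t \<Longrightarrow> 0 \<le> s \<Longrightarrow> \<bar>s - t\<bar> < d t \<Longrightarrow> p s \<le> B t"
    using cadlag_locally_bounded[OF assms] by metis
  obtain C where C: "C \<subseteq> {0..T}" "finite C" "{0..T} \<subseteq> (\<Union>t\<in>C. ball t (d t))"
  proof (rule compactE_image[of "{0..T}" "{0..T}" "\<lambda>t. ball t (d t)"])
    show "{0..T} \<subseteq> (\<Union>t\<in>{0..T}. ball t (d t))" using dB(1) by auto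
  qed auto
  show ?thesis
  proof (rule bdd_aboveI2)
    fix s assume s: "s \<in> {0..T}"
    then obtain t where t: "t \<in> C" "s \<in> ball t (d t)" using C by blast
    then have "p s \<le> B t" using dB(2)[of t s] C(1) s by (auto simp: dist_real_def)
    also have "\<dots> \<le> Max (B ` C)" using t C by auto
    finally show "p s \<le> Max (B ` C)" .
  qed
qed

text \<open>The grid point \<open>\<lceil>n s\<rceil> / n\<close> approaches \<open>s\<close> from the right, so right continuity alone lets the grid
  maximum see values close to \<open>p s\<close>.  The point \<open>s = 1\<close> belongs to every grid.\<close>

lemma grid_max_tendsto_sup:
  assumes p: "cadlag p"
  shows "(\<lambda>n. Max ((\<lambda>j. p (real j / real n)) ` {..n})) \<longlonglongrightarrow> (SUP s\<in>{0..1}. p s)"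
proof (rule order_tendstoI)
  have bdd: "bdd_above (p ` {0..1})" by (rule cadlag_bdd_above[OF p])
  {
    fix a assume "a < (SUP s\<in>{0..1}. p s)"
    then obtain s where s: "0 \<le> s" "s \<le> 1" "a < p s"
      using less_cSUP_iff[OF _ bdd, of a] by auto
    have "(p \<longlongrightarrow> p s) (at_right s)" using p s by (auto simp: cadlag_def)
    then have "\<forall>\<^sub>F y in at_right s. a < p y" using s by (auto intro: order_tendstoD)
    then obtain b where b: "b > s" "\<And>y. s < y \<Longrightarrow> y < b \<Longrightarrow> a < p y"
      by (auto simp: eventually_at_right_field)
    let ?j = "\<lambda>n. nat \<lceil>real n * s\<rceil>"
    have "(\<lambda>n. real_of_int \<lceil>real n * s\<rceil> / real n) \<longlonglongrightarrow> s"
    proof (cases "s = 0")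
      case False
      then have "0 < s" using s by simp
      then show ?thesis by real_asymp
    qed simp
    then have "\<forall>\<^sub>F n in sequentially. real_of_int \<lceil>real n * s\<rceil> / real n < b"
      using b(1) by (rule order_tendstoD)
    then show "\<forall>\<^sub>F n in sequentially. a < Max ((\<lambda>j. p (real j / real n)) ` {..n})"
      using eventually_gt_at_top[of 0]
    proof eventually_elim
      case (elim n)
      have j: "real (?j n) = real_of_int \<lceil>real n * s\<rceil>" using s by simp
      have "real n * s \<le> real n * 1" using s by (intro mult_left_mono) auto
      then have jn: "?j n \<le> n" by (simp add: ceiling_le_iff nat_le_iff)
      have "s \<le> real (?j n) / real n"
        using elim le_of_int_ceiling[of "real n * s"] unfolding j by (simp add: field_simps)
      moreover have "real (?j n) / real n < b" using elim j by simp
      ultimately have "a < p (real (?j n) / real n)"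
        using b(2)[of "real (?j n) / real n"] s(3) by (cases "s = real (?j n) / real n") auto
      also have "\<dots> \<le> Max ((\<lambda>j. p (real j / real n)) ` {..n})" using jn by auto
      finally show ?case .
    qed
  }
  fix a assume a: "(SUP s\<in>{0..1}. p s) < a"
  have "Max ((\<lambda>j. p (real j / real n)) ` {..n}) \<le> (SUP s\<in>{0..1}. p s)" for n
    by (subst Max_le_iff) (auto intro!: cSUP_upper bdd simp: divide_le_eq)
  with a show "\<forall>\<^sub>F n in sequentially. Max ((\<lambda>j. p (real j / real n)) ` {..n}) < a"
    by (intro always_eventually) (auto intro: le_less_trans)
qed

lemma grid_max_le_sup:
  assumes p: "cadlag p"
  shows "Max ((\<lambda>j. p (real j / real n)) ` {..n}) \<le> (SUP s\<in>{0..1}. p s)"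
  by (subst Max_le_iff) (auto intro!: cSUP_upper cadlag_bdd_above[OF p] simp: divide_le_eq)

text \<open>The maximum of the partial sums of \<open>x i, x (i + 1), \<dots>\<close>, computed by splitting off the first
  increment instead of the last.  Splitting in this direction is what matches Lindley's recursion
  path by path.\<close>

primrec forward_max :: "nat \<Rightarrow> nat \<Rightarrow> (nat \<Rightarrow> real) \<Rightarrow> real" where
  "forward_max 0 i x = 0"
| "forward_max (Suc k) i x = max 0 (x i + forward_max k (Suc i) x)"

lemma forward_max_eq_Max:
  fixes P :: "nat \<Rightarrow> real"
  shows "forward_max k i (\<lambda>j. P (Suc j) - P j) = Max ((\<lambda>j. P (i + j) - P i) ` {..k})"
proof (induction k arbitrary: i)
  case 0
  show ?case by simp
next
  case (Suc k)
  let ?A = "(\<lambda>j. P (Suc i + j) - P (Suc i)) ` {..k}"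
  have "Max ((\<lambda>j. P (i + j) - P i) ` {..Suc k}) = max 0 (Max ((\<lambda>j. P (Suc i + j) - P i) ` {..k}))"
    by (simp add: atMost_Suc_eq_insert_0 image_image)
  also have "Max ((\<lambda>j. P (Suc i + j) - P i) ` {..k})
      = Max ((\<lambda>j. (P (Suc i + j) - P (Suc i)) + (P (Suc i) - P i)) ` {..k})"
    by simp
  also have "\<dots> = Max ?A + (P (Suc i) - P i)"
    by (rule Max_add_commute) auto
  finally show ?case using Suc[of "Suc i"] by (simp add: algebra_simps)
qed

lemma forward_max_cong:
  assumes "\<And>j. i \<le> j \<Longrightarrow> j < i + k \<Longrightarrow> x j = y j"
  shows "forward_max k i x = forward_max k i y"
  using assms
proof (induction k arbitrary: i)
  case (Suc k)
  have "forward_max k (Suc i) x = forward_max k (Suc i) y" by (rule Suc.IH) (use Suc.prems in auto)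
  then show ?case using Suc.prems[of i] by simp
qed simp

lemma measurable_forward_max:
  assumes "{i..<i + k} \<subseteq> I"
  shows "forward_max k i \<in> borel_measurable (Pi\<^sub>M I (\<lambda>_. borel))"
  using assms
proof (induction k arbitrary: i)
  case (Suc k)
  have [measurable]: "forward_max k (Suc i) \<in> borel_measurable (Pi\<^sub>M I (\<lambda>_. borel))"
    by (rule Suc.IH) (use Suc.prems in auto)
  have [measurable]: "(\<lambda>x. x i) \<in> borel_measurable (Pi\<^sub>M I (\<lambda>_. borel))"
    by (rule measurable_component_singleton) (use Suc.prems in auto)
  show ?case by simp
next
  case 0
  have "forward_max 0 i = (\<lambda>_. 0)" by (simp add: fun_eq_iff)
  then show ?case by simp
qed

text \<open>The first increment is independent of the maximum built from the later ones, and that maximum has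
  the same law for every starting index.\<close>

lemma (in prob_space) distr_forward_max:
  fixes \<xi> :: "nat \<Rightarrow> 'a \<Rightarrow> real"
  assumes indep: "\<And>n. indep_vars (\<lambda>_. borel) \<xi> {..<n}"
    and law: "\<And>i. distr M borel (\<xi> i) = \<nu>"
  shows "distr M borel (\<lambda>\<omega>. forward_max k i (\<lambda>j. \<xi> j \<omega>)) = lindley \<nu> k"
proof (induction k arbitrary: i)
  case 0
  show ?case by (simp add: distr_const)
next
  case (Suc k)
  let ?B = "{Suc i..<Suc i + k}"
  let ?W = "\<lambda>\<omega>. forward_max k (Suc i) (\<lambda>j. \<xi> j \<omega>)"
  have "indep_var (Pi\<^sub>M {i} (\<lambda>_. borel)) (\<lambda>\<omega>. restrict (\<lambda>j. \<xi> j \<omega>) {i})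
      (Pi\<^sub>M ?B (\<lambda>_. borel)) (\<lambda>\<omega>. restrict (\<lambda>j. \<xi> j \<omega>) ?B)"
    by (rule indep_var_restrict[OF indep[of "Suc i + k"]]) auto
  then have "indep_var borel ((\<lambda>x. x i) \<circ> (\<lambda>\<omega>. restrict (\<lambda>j. \<xi> j \<omega>) {i}))
      borel (forward_max k (Suc i) \<circ> (\<lambda>\<omega>. restrict (\<lambda>j. \<xi> j \<omega>) ?B))"
    by (rule indep_var_compose) (auto intro!: measurable_forward_max)
  moreover have "forward_max k (Suc i) \<circ> (\<lambda>\<omega>. restrict (\<lambda>j. \<xi> j \<omega>) ?B) = ?W"
    by (auto simp: fun_eq_iff intro!: forward_max_cong)
  moreover have "(\<lambda>x. x i) \<circ> (\<lambda>\<omega>. restrict (\<lambda>j. \<xi> j \<omega>) {i}) = \<xi> i"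
    by (auto simp: fun_eq_iff)
  ultimately have "indep_var borel (\<xi> i) borel ?W" by simp
  then have rv [measurable]: "\<xi> i \<in> borel_measurable M" "?W \<in> borel_measurable M"
    and eq: "distr M borel (\<xi> i) \<Otimes>\<^sub>M distr M borel ?W
      = distr M (borel \<Otimes>\<^sub>M borel) (\<lambda>\<omega>. (\<xi> i \<omega>, ?W \<omega>))"
    by (auto simp: indep_var_distribution_eq)
  have "lindley \<nu> (Suc k) = distr (distr M (borel \<Otimes>\<^sub>M borel) (\<lambda>\<omega>. (\<xi> i \<omega>, ?W \<omega>))) borel
     (\<lambda>(y, w). max 0 (y + w))"
    using eq Suc[of "Suc i"] law[of i] by simp
  also have "\<dots> = distr M borel (\<lambda>\<omega>. max 0 (\<xi> i \<omega> + ?W \<omega>))"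
    by (subst distr_distr) (auto simp: comp_def split_beta)
  finally show ?case by simp
qed

text \<open>The difference quotients \<open>(1 - exp (- l y)) / l\<close> converge to \<open>y\<close> as \<open>l\<close> decreases to \<open>0\<close>, and their
  means \<open>(1 - exp (l powr \<alpha>)) / l\<close> converge to \<open>0\<close> because \<open>\<alpha> > 1\<close>.  Fatou's lemma first gives
  integrability of the positive part, whose size is not known in advance; the negative part is
  dominated by \<open>exp (- 2 y)\<close>.\<close>

lemma (in prob_space) mean_zero_from_laplace:
  fixes Y :: "'a \<Rightarrow> real"
  assumes [measurable]: "Y \<in> borel_measurable M" and \<alpha>: "1 < \<alpha>"
    and L: "\<And>l. 0 \<le> l \<Longrightarrow> (\<integral>\<omega>. exp (- l * Y \<omega>) \<partial>M) = exp (l powr \<alpha>)"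
  shows "integrable M Y" "(\<integral>\<omega>. Y \<omega> \<partial>M) = 0"
proof -
  have iE: "integrable M (\<lambda>\<omega>. exp (- l * Y \<omega>))" if "0 \<le> l" for l
    using L[OF that] by (metis exp_not_eq_zero not_integrable_integral_eq)
  define l where "l n = 1 / real (Suc n)" for n
  have l: "0 < l n" "l n \<le> 1" for n by (auto simp: l_def)
  have l0: "l \<longlonglongrightarrow> 0" unfolding l_def by real_asymp
  have elem: "(exp (l * y) - 1) / l \<le> exp (2 * y)" if "0 < l" "l \<le> 1" "0 \<le> y" for l y :: real
  proof -
    have "1 + - (l * y) \<le> exp (- (l * y))" using exp_ge_add_one_self[of "- (l * y)"] by simp
    then have "exp (l * y) * (1 - l * y) \<le> exp (l * y) * exp (- (l * y))"
      by (intro mult_left_mono) auto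
    then have "exp (l * y) - 1 \<le> l * (y * exp (l * y))"
      by (simp add: exp_minus algebra_simps)
    then have "(exp (l * y) - 1) / l \<le> y * exp (l * y)"
      using that by (simp add: field_simps)
    also have "\<dots> \<le> exp y * exp y"
    proof (intro mult_mono)
      show "y \<le> exp y" using exp_ge_add_one_self[of y] by linarith
      show "exp (l * y) \<le> exp y" using that by (simp add: mult_left_le_one_le)
    qed (use that in auto)
    finally show ?thesis by (simp add: exp_add[symmetric])
  qed
  have lim: "(\<lambda>n. (1 - exp (- l n * y)) / l n) \<longlonglongrightarrow> y" for y :: real
    unfolding l_def by real_asymp
  let ?K = "\<integral>\<omega>. 1 + exp (- 2 * Y \<omega>) \<partial>M"
  have iK: "integrable M (\<lambda>\<omega>. 1 + exp (- 2 * Y \<omega>))" using iE[of 2] by simp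
  have neg: "exp (2 * max 0 (- y)) \<le> 1 + exp (- 2 * y)" for y :: real
    by (cases "0 \<le> y") (auto simp: max_def)
  let ?f = "\<lambda>n \<omega>. (1 - exp (- l n * max 0 (Y \<omega>))) / l n"
  have f0: "0 \<le> ?f n \<omega>" for n \<omega> using l[of n] by auto
  have fle: "?f n \<omega> \<le> (1 - exp (- l n * Y \<omega>)) / l n + (1 + exp (- 2 * Y \<omega>))" for n \<omega>
  proof (cases "0 \<le> Y \<omega>")
    case True
    then show ?thesis by (simp add: max_def add_nonneg_nonneg)
  next
    case False
    have "(exp (l n * (- Y \<omega>)) - 1) / l n \<le> exp (2 * (- Y \<omega>))"
      by (rule elem) (use l False in auto)
    then show ?thesis using False by (simp add: max_def diff_divide_distrib)
  qed
  have "(\<integral>\<^sup>+\<omega>. ennreal (max 0 (Y \<omega>)) \<partial>M) = (\<integral>\<^sup>+\<omega>. liminf (\<lambda>n. ennreal (?f n \<omega>)) \<partial>M)"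
  proof (intro nn_integral_cong)
    fix \<omega>
    have "(\<lambda>n. ennreal (?f n \<omega>)) \<longlonglongrightarrow> ennreal (max 0 (Y \<omega>))"
      by (intro tendsto_ennrealI lim)
    from lim_imp_Liminf[OF sequentially_bot this]
    show "ennreal (max 0 (Y \<omega>)) = liminf (\<lambda>n. ennreal (?f n \<omega>))" by (rule sym)
  qed
  also have "\<dots> \<le> liminf (\<lambda>n. \<integral>\<^sup>+\<omega>. ennreal (?f n \<omega>) \<partial>M)"
    by (rule nn_integral_liminf) measurable
  also have "\<dots> \<le> ennreal ?K"
  proof (rule Liminf_le[OF _ always_eventually, rule_format])
    fix n
    have iG: "integrable M (\<lambda>\<omega>. (1 - exp (- l n * Y \<omega>)) / l n + (1 + exp (- 2 * Y \<omega>)))"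
      using iE[of "l n"] l[of n] by (intro Bochner_Integration.integrable_add[OF _ iK]) auto
    have if': "integrable M (?f n)"
      by (rule Bochner_Integration.integrable_bound[OF iG])
        (measurable, intro AE_I2, unfold real_norm_def abs_of_nonneg[OF f0], rule order_trans[OF fle abs_ge_self])
    have "(\<integral>\<^sup>+\<omega>. ennreal (?f n \<omega>) \<partial>M) = ennreal (\<integral>\<omega>. ?f n \<omega> \<partial>M)"
      by (rule nn_integral_eq_integral[OF if']) (use f0 in auto)
    also have "(\<integral>\<omega>. ?f n \<omega> \<partial>M) \<le> (\<integral>\<omega>. (1 - exp (- l n * Y \<omega>)) / l n + (1 + exp (- 2 * Y \<omega>)) \<partial>M)"
      by (rule integral_mono[OF if' iG]) (use fle in auto)
    also have "\<dots> = (1 - exp (l n powr \<alpha>)) / l n + ?K"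
      using iE[of "l n"] l[of n] iK L[of "l n"] prob_space
      by (subst Bochner_Integration.integral_add) auto
    also have "\<dots> \<le> ?K" using l[of n] by (simp add: divide_le_0_iff)
    finally show "(\<integral>\<^sup>+\<omega>. ennreal (?f n \<omega>) \<partial>M) \<le> ennreal ?K" by (simp add: ennreal_leI)
  qed simp
  finally have "(\<integral>\<^sup>+\<omega>. ennreal (max 0 (Y \<omega>)) \<partial>M) < \<infinity>"
    using ennreal_less_top le_less_trans by (metis infinity_ennreal_def)
  then have ipos: "integrable M (\<lambda>\<omega>. max 0 (Y \<omega>))"
    by (intro integrableI_nonneg) auto
  have bnd: "\<bar>Y \<omega>\<bar> \<le> max 0 (Y \<omega>) + (1 + exp (- 2 * Y \<omega>))" for \<omega>
  proof (cases "0 \<le> Y \<omega>")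
    case False
    have "- 2 * Y \<omega> \<le> exp (- 2 * Y \<omega>)" using exp_ge_add_one_self[of "- 2 * Y \<omega>"] by linarith
    then show ?thesis using False by (simp add: max_def)
  qed (auto simp: add_nonneg_nonneg)
  have iB: "integrable M (\<lambda>\<omega>. max 0 (Y \<omega>) + (1 + exp (- 2 * Y \<omega>)))" using ipos iK by auto
  show iY: "integrable M Y"
  proof (rule Bochner_Integration.integrable_bound[OF iB])
    show "AE \<omega> in M. norm (Y \<omega>) \<le> norm (max 0 (Y \<omega>) + (1 + exp (- 2 * Y \<omega>)))"
      by (intro AE_I2) (simp only: real_norm_def order_trans[OF bnd abs_ge_self])
  qed measurable
  have "(\<lambda>n. \<integral>\<omega>. (1 - exp (- l n * Y \<omega>)) / l n \<partial>M) \<longlonglongrightarrow> (\<integral>\<omega>. Y \<omega> \<partial>M)"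
  proof (rule integral_dominated_convergence[OF _ _ iB])
    show "AE \<omega> in M. norm ((1 - exp (- l n * Y \<omega>)) / l n) \<le> max 0 (Y \<omega>) + (1 + exp (- 2 * Y \<omega>))" for n
    proof (rule AE_I2)
      fix \<omega>
      show "norm ((1 - exp (- l n * Y \<omega>)) / l n) \<le> max 0 (Y \<omega>) + (1 + exp (- 2 * Y \<omega>))"
      proof (cases "0 \<le> Y \<omega>")
        case True
        have "1 + - (l n * Y \<omega>) \<le> exp (- (l n * Y \<omega>))" using exp_ge_add_one_self[of "- (l n * Y \<omega>)"] by simp
        then have "(1 - exp (- l n * Y \<omega>)) / l n \<le> Y \<omega>"
          using l[of n] by (simp add: field_simps)
        moreover have "0 \<le> (1 - exp (- l n * Y \<omega>)) / l n" using True l[of n] by auto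
        ultimately have "norm ((1 - exp (- l n * Y \<omega>)) / l n) \<le> Y \<omega>"
          by (simp only: real_norm_def abs_of_nonneg)
        then show ?thesis using exp_gt_zero[of "- 2 * Y \<omega>"] unfolding max_absorb2[OF True] by linarith
      next
        case False
        have "(exp (l n * (- Y \<omega>)) - 1) / l n \<le> exp (2 * (- Y \<omega>))"
          by (rule elem) (use l False in auto)
        moreover have "0 \<le> (exp (l n * (- Y \<omega>)) - 1) / l n"
          using False l[of n] by (auto simp: mult_nonneg_nonpos)
        moreover have "(1 - exp (- l n * Y \<omega>)) / l n = - ((exp (l n * (- Y \<omega>)) - 1) / l n)"
          by (simp add: diff_divide_distrib)
        ultimately have "norm ((1 - exp (- l n * Y \<omega>)) / l n) \<le> exp (2 * (- Y \<omega>))"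
          by (simp only: real_norm_def abs_minus_cancel abs_of_nonneg)
        then show ?thesis using False by (simp add: max_def)
      qed
    qed
  qed (use lim in auto)
  moreover have "(\<lambda>n. \<integral>\<omega>. (1 - exp (- l n * Y \<omega>)) / l n \<partial>M) = (\<lambda>n. (1 - exp (l n powr \<alpha>)) / l n)"
    using iE L l prob_space by (auto simp: fun_eq_iff less_imp_le)
  moreover have "(\<lambda>n. (1 - exp (l n powr \<alpha>)) / l n) \<longlonglongrightarrow> 0"
    unfolding l_def using \<alpha> by real_asymp
  ultimately show "(\<integral>\<omega>. Y \<omega> \<partial>M) = 0" using LIMSEQ_unique by metis
qed

section \<open>The stable process sampled on a grid\<close>

text \<open>The finite Laplace transform expresses the absence of negative jumps: it gives the negative part of
  an increment exponential moments.\<close>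

locale spectrally_positive_stable =
  fixes \<alpha> :: real and M :: "'a measure" and X :: "real \<Rightarrow> 'a \<Rightarrow> real"
  assumes alpha: "1 < \<alpha>" "\<alpha> < 2"
    and stable: "stable_levy_process \<alpha> M X"
    and laplace: "0 \<le> l \<Longrightarrow> (LINT \<omega>|M. exp (- l * X 1 \<omega>)) = exp (l powr \<alpha>)"
    and sup_measurable [measurable]: "running_sup X 1 \<in> borel_measurable M"
begin

lemma levy: "levy_process M X"
  using stable by (simp add: stable_levy_process_def)

sublocale prob_space M
  using levy by (simp add: levy_process_def)

lemma X_measurable [measurable]: "0 \<le> t \<Longrightarrow> X t \<in> borel_measurable M"
  using levy by (simp add: levy_process_def)

lemma X_measurable_of_nat [measurable]: "X (real j) \<in> borel_measurable M" "X 0 \<in> borel_measurable M"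
  "X 1 \<in> borel_measurable M" "X (real j / real n) \<in> borel_measurable M"
  by (auto intro: X_measurable)

lemma AE_X0: "AE \<omega> in M. X 0 \<omega> = 0"
  using levy by (simp add: levy_process_def)

lemma cadlag_paths: "\<omega> \<in> space M \<Longrightarrow> cadlag (\<lambda>t. X t \<omega>)"
  using levy by (simp add: levy_process_def)

definition step_law :: "real measure" where
  "step_law = distr M borel (\<lambda>\<omega>. X 1 \<omega> - X 0 \<omega>)"

lemma step_law_eq: "step_law = distr M borel (X 1)"
  unfolding step_law_def
  by (rule distr_cong_AE) (use AE_X0 in auto)

lemma integrable_exp_X: "0 \<le> l \<Longrightarrow> integrable M (\<lambda>\<omega>. exp (- l * X 1 \<omega>))"
  using laplace by (metis exp_not_eq_zero not_integrable_integral_eq)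

sublocale step: centred_step step_law
proof (rule centred_step.intro)
  show "prob_space step_law" unfolding step_law_def by (rule prob_space_distr) auto
  show "sets step_law = sets (borel :: real measure)" by (simp add: step_law_def)
  have "integrable M (X 1)" "(\<integral>\<omega>. X 1 \<omega> \<partial>M) = 0"
    using mean_zero_from_laplace[of "X 1" \<alpha>] alpha laplace by auto
  then show "integrable step_law (\<lambda>y. y)" "(\<integral>y. y \<partial>step_law) = 0"
    unfolding step_law_eq by (simp_all add: integrable_distr_eq integral_distr)
  show "integrable step_law (\<lambda>y. exp (- 2 * y))"
    unfolding step_law_eq using integrable_exp_X[of 2] by (simp add: integrable_distr_eq)
qed

definition walk_max :: "nat \<Rightarrow> 'a \<Rightarrow> real" where
  "walk_max n \<omega> = Max ((\<lambda>j. X (real j) \<omega> - X 0 \<omega>) ` {..n})"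

definition grid_max :: "nat \<Rightarrow> 'a \<Rightarrow> real" where
  "grid_max n \<omega> = Max ((\<lambda>j. X (real j / real n) \<omega> - X 0 \<omega>) ` {..n})"

lemma walk_max_measurable [measurable]: "walk_max n \<in> borel_measurable M"
  unfolding walk_max_def by (intro borel_measurable_Max) auto

lemma grid_max_measurable [measurable]: "grid_max n \<in> borel_measurable M"
  unfolding grid_max_def by (intro borel_measurable_Max) auto

lemma distr_walk_max: "distr M borel (walk_max n) = lindley step_law n"
proof -
  let ?\<xi> = "\<lambda>i \<omega>. X (real (Suc i)) \<omega> - X (real i) \<omega>"
  have "distr M borel (\<lambda>\<omega>. forward_max n 0 (\<lambda>j. ?\<xi> j \<omega>)) = lindley step_law n"
  proof (rule distr_forward_max)
    show "indep_vars (\<lambda>_. borel) ?\<xi> {..<n}" for n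
      using levy unfolding levy_process_def independent_increments_def
      by (elim conjE allE[of _ n] allE[of _ real]) auto
    fix i
    have st: "stationary_increments M X" using levy by (simp add: levy_process_def)
    show "distr M borel (?\<xi> i) = step_law"
      using st[unfolded stationary_increments_def, rule_format, of "real i" 0 1]
      by (simp add: step_law_def add.commute)
  qed
  also have "(\<lambda>\<omega>. forward_max n 0 (\<lambda>j. ?\<xi> j \<omega>)) = walk_max n"
    using forward_max_eq_Max[of n 0 "\<lambda>j. X (real j) _"] by (simp add: walk_max_def fun_eq_iff)
  finally show ?thesis .
qed

lemma Max_divide:
  fixes f :: "nat \<Rightarrow> real"
  assumes "0 \<le> c"
  shows "Max ((\<lambda>j. c * f j) ` {..n}) = c * Max (f ` {..n})"
  using mono_Max_commute[of "\<lambda>x. c * x" "f ` {..n}"] assms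
  by (simp add: image_image mono_def mult_left_mono)

text \<open>Stability with \<open>c = 1 / n\<close> compares the process at the times \<open>j / n\<close> with the rescaled process at
  integer times.\<close>

lemma distr_grid_max:
  assumes n: "0 < n"
  shows "distr M borel (grid_max n) = distr M borel (\<lambda>\<omega>. walk_max n \<omega> / real n powr (1 / \<alpha>))"
proof -
  let ?I = "real ` {..n}"
  let ?g = "\<lambda>x :: real \<Rightarrow> real. Max ((\<lambda>j. x (real j) - x 0) ` {..n})"
  let ?c = "(1 / real n) powr (1 / \<alpha>)"
  have g [measurable]: "?g \<in> borel_measurable (Pi\<^sub>M ?I (\<lambda>_. borel))"
  proof (rule borel_measurable_Max[where f="\<lambda>j x. x (real j) - x 0"])
    fix j assume "j \<in> {..n}"
    have [measurable]: "(\<lambda>x. x (real j)) \<in> borel_measurable (Pi\<^sub>M ?I (\<lambda>_. borel))"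
      by (rule measurable_component_singleton) (use \<open>j \<in> {..n}\<close> in auto)
    have [measurable]: "(\<lambda>x. x 0) \<in> borel_measurable (Pi\<^sub>M ?I (\<lambda>_. borel))"
      by (rule measurable_component_singleton) (auto intro!: image_eqI[of _ _ 0])
    show "(\<lambda>x. x (real j) - x 0 :: real) \<in> borel_measurable (Pi\<^sub>M ?I (\<lambda>_. borel))" by measurable
  qed simp
  have "distr M (Pi\<^sub>M ?I (\<lambda>_. borel)) (\<lambda>\<omega>. \<lambda>t\<in>?I. X (1 / real n * t) \<omega>)
    = distr M (Pi\<^sub>M ?I (\<lambda>_. borel)) (\<lambda>\<omega>. \<lambda>t\<in>?I. ?c * X t \<omega>)"
    using stable n unfolding stable_levy_process_def
    by (elim conjE allE[of _ "1 / real n"]) (auto elim!: allE[of _ ?I])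
  then have "distr (distr M (Pi\<^sub>M ?I (\<lambda>_. borel)) (\<lambda>\<omega>. \<lambda>t\<in>?I. X (1 / real n * t) \<omega>)) borel ?g
    = distr (distr M (Pi\<^sub>M ?I (\<lambda>_. borel)) (\<lambda>\<omega>. \<lambda>t\<in>?I. ?c * X t \<omega>)) borel ?g"
    by (rule arg_cong[where f="\<lambda>N. distr N borel ?g"])
  moreover have "(\<lambda>\<omega>. \<lambda>t\<in>?I. X (1 / real n * t) \<omega>) \<in> measurable M (Pi\<^sub>M ?I (\<lambda>_. borel))"
    by (rule measurable_restrict, rule X_measurable) auto
  moreover have "(\<lambda>\<omega>. \<lambda>t\<in>?I. ?c * X t \<omega>) \<in> measurable M (Pi\<^sub>M ?I (\<lambda>_. borel))"
    by (rule measurable_restrict, rule borel_measurable_times, simp, rule X_measurable) auto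
  ultimately have "distr M borel (?g \<circ> (\<lambda>\<omega>. \<lambda>t\<in>?I. X (1 / real n * t) \<omega>))
    = distr M borel (?g \<circ> (\<lambda>\<omega>. \<lambda>t\<in>?I. ?c * X t \<omega>))"
    by (simp only: distr_distr[OF g])
  moreover have "?g \<circ> (\<lambda>\<omega>. \<lambda>t\<in>?I. X (1 / real n * t) \<omega>) = grid_max n"
  proof
    fix \<omega>
    have "(0::real) \<in> ?I" by (auto intro!: image_eqI[of _ _ 0])
    then show "(?g \<circ> (\<lambda>\<omega>. \<lambda>t\<in>?I. X (1 / real n * t) \<omega>)) \<omega> = grid_max n \<omega>"
      by (auto simp: grid_max_def intro!: arg_cong[where f=Max] image_cong)
  qed
  moreover have "?g \<circ> (\<lambda>\<omega>. \<lambda>t\<in>?I. ?c * X t \<omega>) = (\<lambda>\<omega>. walk_max n \<omega> / real n powr (1 / \<alpha>))"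
  proof
    fix \<omega>
    have 0: "(0::real) \<in> ?I" by (auto intro!: image_eqI[of _ _ 0])
    have c: "?c = 1 / real n powr (1 / \<alpha>)" by (simp add: powr_divide)
    have "(?g \<circ> (\<lambda>\<omega>. \<lambda>t\<in>?I. ?c * X t \<omega>)) \<omega> = Max ((\<lambda>j. ?c * (X (real j) \<omega> - X 0 \<omega>)) ` {..n})"
      using 0 by (auto simp: right_diff_distrib intro!: arg_cong[where f=Max] image_cong)
    also have "\<dots> = ?c * walk_max n \<omega>" unfolding walk_max_def by (rule Max_divide) simp
    finally show "(?g \<circ> (\<lambda>\<omega>. \<lambda>t\<in>?I. ?c * X t \<omega>)) \<omega> = walk_max n \<omega> / real n powr (1 / \<alpha>)"
      unfolding c by simp
  qed
  ultimately show ?thesis by simp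
qed

lemma integral_grid_max:
  fixes h :: "real \<Rightarrow> 'b :: {banach, second_countable_topology}"
  assumes n: "0 < n" and [measurable]: "h \<in> borel_measurable borel"
  shows "(\<integral>\<omega>. h (grid_max n \<omega>) \<partial>M) = (\<integral>w. h (w / real n powr (1 / \<alpha>)) \<partial>lindley step_law n)"
proof -
  have "(\<integral>\<omega>. h (grid_max n \<omega>) \<partial>M) = (\<integral>w. h w \<partial>distr M borel (grid_max n))"
    by (simp add: integral_distr)
  also have "\<dots> = (\<integral>\<omega>. h (walk_max n \<omega> / real n powr (1 / \<alpha>)) \<partial>M)"
    unfolding distr_grid_max[OF n] by (simp add: integral_distr)
  also have "\<dots> = (\<integral>w. h (w / real n powr (1 / \<alpha>)) \<partial>distr M borel (walk_max n))"
    by (simp add: integral_distr)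
  finally show ?thesis unfolding distr_walk_max .
qed

abbreviation S :: "'a \<Rightarrow> real" where "S \<equiv> running_sup X 1"

lemma AE_grid_max:
  "AE \<omega> in M. (\<lambda>n. grid_max n \<omega>) \<longlonglongrightarrow> S \<omega> \<and> (\<forall>n. 0 \<le> grid_max n \<omega> \<and> grid_max n \<omega> \<le> S \<omega>)"
  using AE_X0 AE_space
proof eventually_elim
  case (elim \<omega>)
  have eq: "grid_max n \<omega> = Max ((\<lambda>j. X (real j / real n) \<omega>) ` {..n})" for n
    using elim by (simp add: grid_max_def)
  have "0 \<le> grid_max n \<omega>" for n
    unfolding grid_max_def by (subst Max_ge_iff) (auto intro!: bexI[of _ 0])
  with grid_max_tendsto_sup[OF cadlag_paths[OF elim(2)]] grid_max_le_sup[OF cadlag_paths[OF elim(2)]]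
  show ?case by (auto simp: eq running_sup_def)
qed

lemma AE_S_nonneg: "AE \<omega> in M. 0 \<le> S \<omega>"
  using AE_grid_max by eventually_elim (meson order_trans)

lemma transform_grid_max:
  assumes "0 < n"
  shows "(\<integral>\<omega>. exp (- (\<zeta> * of_real (grid_max n \<omega>))) \<partial>M)
    = step.lindley_transform n (\<zeta> / of_real (real n powr (1 / \<alpha>)))"
  unfolding step.lindley_transform_def
  by (subst integral_grid_max[OF assms, where h="\<lambda>w. exp (- (\<zeta> * of_real w))"]) (simp_all add: mult.commute)

lemma mean_grid_max:
  assumes "0 < n"
  shows "(\<integral>\<omega>. grid_max n \<omega> \<partial>M) = step.lindley_mean n / real n powr (1 / \<alpha>)"
  unfolding step.lindley_mean_def
  by (subst integral_grid_max[OF assms, where h="\<lambda>w. w"]) simp_all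

lemma transform_grid_max_tendsto:
  assumes "0 \<le> Re \<zeta>"
  shows "(\<lambda>n. \<integral>\<omega>. exp (- (\<zeta> * of_real (grid_max n \<omega>))) \<partial>M) \<longlonglongrightarrow> (\<integral>\<omega>. exp (- (\<zeta> * of_real (S \<omega>))) \<partial>M)"
proof (rule integral_dominated_convergence[where w="\<lambda>_. 1"])
  show "AE \<omega> in M. (\<lambda>n. exp (- (\<zeta> * of_real (grid_max n \<omega>)))) \<longlonglongrightarrow> exp (- (\<zeta> * of_real (S \<omega>)))"
    using AE_grid_max by eventually_elim (intro tendsto_intros, auto)
  show "AE \<omega> in M. norm (exp (- (\<zeta> * of_real (grid_max n \<omega>)))) \<le> 1" for n
    using AE_grid_max by eventually_elim (use assms in auto)
qed auto

text \<open>At the scale \<open>n powr (1 / \<alpha>)\<close> each of the \<open>n\<close> steps makes an error of order \<open>n powr (- 2 / \<alpha>)\<close>.\<close>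

lemma scaled_recursion_error:
  assumes z: "0 \<le> Re \<zeta>"
    and char: "\<And>n. 0 < n \<Longrightarrow>
      (\<integral>y. exp (- (\<zeta> / of_real (real n powr (1 / \<alpha>)) * of_real y)) \<partial>step_law) = exp (\<Psi> / of_nat n)"
    and n: "0 < n" "norm \<zeta> \<le> real n powr (1 / \<alpha>)"
  shows "norm ((\<integral>\<omega>. exp (- (\<zeta> * of_real (grid_max n \<omega>))) \<partial>M) - exp \<Psi>
      + \<zeta> * ((\<Sum>k<n. exp (\<Psi> / of_nat n) ^ (n - Suc k)
          * of_real (step.lindley_mean (Suc k) - step.lindley_mean k)) / of_real (real n powr (1 / \<alpha>))))
    \<le> (norm \<zeta>)\<^sup>2 * step.remainder_const * exp (norm \<Psi>) * (real n powr (1 - 2 / \<alpha>))"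
proof -
  let ?a = "real n powr (1 / \<alpha>)"
  let ?z = "\<zeta> / of_real ?a"
  have a: "0 < ?a" using n by simp
  have "norm (step.lindley_transform n ?z - exp (\<Psi> / of_nat n) ^ n
      + ?z * (\<Sum>k<n. exp (\<Psi> / of_nat n) ^ (n - Suc k)
          * of_real (step.lindley_mean (Suc k) - step.lindley_mean k)))
    \<le> real n * (norm ?z)\<^sup>2 * step.remainder_const * exp (norm \<Psi> / real n) ^ n"
  proof (rule step.lindley_transform_unrolled)
    show "0 \<le> Re ?z" using z a by simp
    show "norm ?z \<le> 1" using n a by (simp add: norm_divide)
    show "(\<integral>y. exp (- (?z * of_real y)) \<partial>step_law) = exp (\<Psi> / of_nat n)" by (rule char[OF n(1)])
    have "Re \<Psi> / real n \<le> norm \<Psi> / real n" by (intro divide_right_mono complex_Re_le_cmod) auto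
    then show "norm (exp (\<Psi> / of_nat n)) \<le> exp (norm \<Psi> / real n)" by simp
  qed simp
  also have "exp (\<Psi> / of_nat n) ^ n = exp \<Psi>"
    using n(1) exp_of_nat_mult[of n "\<Psi> / of_nat n"] by simp
  also have "exp (norm \<Psi> / real n) ^ n = exp (norm \<Psi>)"
    using n(1) exp_of_nat_mult[of n "norm \<Psi> / real n"] by simp
  also have "real n * (norm ?z)\<^sup>2 = (norm \<zeta>)\<^sup>2 * real n powr (1 - 2 / \<alpha>)"
  proof -
    have "real n powr (1 - 2 / \<alpha>) = real n / (?a * ?a)"
      using n(1) by (simp add: powr_diff powr_add[symmetric])
    then show ?thesis using a by (simp add: norm_divide power2_eq_square)
  qed
  finally show ?thesis
    unfolding transform_grid_max[OF n(1)] by (simp add: mult_ac)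
qed

text \<open>The hypothesis on \<open>\<zeta>\<close> in the previous lemma holds for real \<open>\<zeta> = l \<ge> 0\<close> with \<open>\<Psi> = l powr \<alpha>\<close>.\<close>

lemma transform_step_real:
  assumes "0 < n" "0 \<le> l"
  shows "(\<integral>y. exp (- (of_real l / of_real (real n powr (1 / \<alpha>)) * of_real y)) \<partial>step_law)
    = exp (of_real (l powr \<alpha>) / of_nat n :: complex)"
proof -
  let ?r = "l / real n powr (1 / \<alpha>)"
  have r: "0 \<le> ?r" using assms by simp
  have "(\<integral>y. exp (- (of_real l / of_real (real n powr (1 / \<alpha>)) * of_real y)) \<partial>step_law)
    = (\<integral>\<omega>. of_real (exp (- ?r * X 1 \<omega>)) \<partial>M :: complex)"
    unfolding step_law_eq by (subst integral_distr) (auto simp: exp_of_real[symmetric])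
  also have "\<dots> = of_real (exp (?r powr \<alpha>))"
    using laplace[OF r] by (subst integral_complex_of_real) simp
  also have "?r powr \<alpha> = l powr \<alpha> / real n"
    using assms alpha by (simp add: powr_divide powr_powr)
  finally show ?thesis by (simp add: exp_of_real[symmetric])
qed

lemma integrable_grid_max: "0 < n \<Longrightarrow> integrable M (grid_max n)"
proof -
  assume n: "0 < n"
  have "integrable (distr M borel (walk_max n)) (\<lambda>w. w)"
    unfolding distr_walk_max by (rule step.integrable_lindley)
  then have "integrable M (walk_max n)" by (simp add: integrable_distr_eq)
  then have "integrable (distr M borel (grid_max n)) (\<lambda>w. w)"
    unfolding distr_grid_max[OF n] by (simp add: integrable_distr_eq)
  then show ?thesis by (simp add: integrable_distr_eq)
qed

end

section \<open>The transform of the supremum\<close>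

lemma ii_powr:
  assumes "0 < t"
  shows "(\<i> * complex_of_real t) powr complex_of_real \<alpha> = of_real (t powr \<alpha>) * cis (\<alpha> * pi / 2)"
proof -
  have L: "Ln (complex_of_real t * \<i>) = of_real (ln t) + \<i> * of_real (pi / 2)"
    using Ln_times_of_real[of t \<i>] Ln_of_real[OF assms] assms by simp
  have "(\<i> * complex_of_real t) powr complex_of_real \<alpha> = exp (of_real \<alpha> * Ln (complex_of_real t * \<i>))"
    using assms by (simp add: powr_def mult.commute)
  also have "of_real \<alpha> * Ln (complex_of_real t * \<i>) = of_real (\<alpha> * ln t) + \<i> * of_real (\<alpha> * pi / 2)"
    unfolding L by (simp add: distrib_left)
  also have "exp \<dots> = exp (of_real (\<alpha> * ln t)) * cis (\<alpha> * pi / 2)"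
    by (simp only: exp_add cis_conv_exp)
  also have "exp (complex_of_real (\<alpha> * ln t)) = of_real (exp (\<alpha> * ln t))"
    by (rule exp_of_real)
  also have "exp (\<alpha> * ln t) = t powr \<alpha>" using assms by (simp add: powr_def)
  finally show ?thesis .
qed

lemma Gamma_truncated_limit:
  fixes a :: real
  assumes a: "0 < a"
  shows "(\<lambda>n. LBINT v:{0..real n}. v powr (a - 1) * exp (- v)) \<longlonglongrightarrow> Gamma a"
proof -
  let ?g = "\<lambda>v :: real. indicator {0..} v * v powr (a - 1) / exp v"
  have nn: "(\<integral>\<^sup>+v. ennreal (?g v) \<partial>lborel) = ennreal (Gamma a)"
    using Gamma_conv_nn_integral_real[OF a] by simp
  have hb: "has_bochner_integral lborel ?g (Gamma a)"
    by (rule has_bochner_integral_nn_integral[OF _ _ _ nn]) (use a in \<open>auto simp: less_imp_le\<close>)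
  then have i: "integrable lborel ?g" and v: "(\<integral>v. ?g v \<partial>lborel) = Gamma a"
    by (auto simp: has_bochner_integral_iff)
  have "(\<lambda>n. \<integral>v. indicator {0..real n} v *\<^sub>R (v powr (a - 1) * exp (- v)) \<partial>lborel) \<longlonglongrightarrow> (\<integral>v. ?g v \<partial>lborel)"
  proof (rule integral_dominated_convergence[OF _ _ i])
    show "AE v in lborel. (\<lambda>n. indicator {0..real n} v *\<^sub>R (v powr (a - 1) * exp (- v))) \<longlonglongrightarrow> ?g v"
    proof (rule AE_I2)
      fix v :: real
      have "\<forall>\<^sub>F n in sequentially. v \<le> real n" by real_asymp
      then have "\<forall>\<^sub>F n in sequentially. indicator {0..real n} v *\<^sub>R (v powr (a - 1) * exp (- v)) = ?g v"
        by eventually_elim (auto simp: indicator_def exp_minus divide_inverse)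
      then show "(\<lambda>n. indicator {0..real n} v *\<^sub>R (v powr (a - 1) * exp (- v))) \<longlonglongrightarrow> ?g v"
        by (rule tendsto_eventually)
    qed
    show "AE v in lborel. norm (indicator {0..real n} v *\<^sub>R (v powr (a - 1) * exp (- v))) \<le> ?g v" for n
      by (rule AE_I2) (auto simp: indicator_def exp_minus divide_inverse)
  qed measurable
  then show ?thesis unfolding v set_lebesgue_integral_def .
qed

lemma scaled_exp_integral:
  fixes a :: real
  assumes n: "0 < n"
  shows "n powr a * (LBINT s:{0..1}. s powr (a - 1) * exp (- (n * s)))
    = (LBINT v:{0..n}. v powr (a - 1) * exp (- v))"
proof -
  let ?f = "\<lambda>v. indicator {0..n} v *\<^sub>R (v powr (a - 1) * exp (- v))"
  have "(LBINT v:{0..n}. v powr (a - 1) * exp (- v)) = (\<integral>v. ?f v \<partial>lborel)"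
    by (simp add: set_lebesgue_integral_def)
  also have "\<dots> = \<bar>n\<bar> *\<^sub>R (\<integral>s. ?f (0 + n * s) \<partial>lborel)"
    by (rule lborel_integral_real_affine) (use n in simp)
  also have "(\<lambda>s. ?f (0 + n * s)) = (\<lambda>s. n powr (a - 1) * (indicator {0..1} s *\<^sub>R (s powr (a - 1) * exp (- (n * s)))))"
  proof
    fix s
    show "?f (0 + n * s) = n powr (a - 1) * (indicator {0..1} s *\<^sub>R (s powr (a - 1) * exp (- (n * s))))"
      using n by (auto simp: indicator_def powr_mult zero_le_mult_iff)
  qed
  also have "\<bar>n\<bar> *\<^sub>R (\<integral>s. n powr (a - 1) * (indicator {0..1} s *\<^sub>R (s powr (a - 1) * exp (- (n * s)))) \<partial>lborel)
    = n powr a * (LBINT s:{0..1}. s powr (a - 1) * exp (- (n * s)))"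
  proof -
    have "n * n powr (a - 1) = n powr a" using n by (simp add: powr_diff)
    moreover have "(\<integral>s. n powr (a - 1) * (indicator {0..1} s *\<^sub>R (s powr (a - 1) * exp (- (n * s)))) \<partial>lborel)
      = n powr (a - 1) * (LBINT s:{0..1}. s powr (a - 1) * exp (- (n * s)))"
      unfolding set_lebesgue_integral_def by (rule integral_mult_right_zero)
    ultimately have "\<bar>n\<bar> *\<^sub>R (\<integral>s. n powr (a - 1) * (indicator {0..1} s *\<^sub>R (s powr (a - 1) * exp (- (n * s)))) \<partial>lborel)
      = n * (n powr (a - 1) * (LBINT s:{0..1}. s powr (a - 1) * exp (- (n * s))))"
      using n by (simp only: real_scaleR_def abs_of_pos)
    then show ?thesis using \<open>n * n powr (a - 1) = n powr a\<close> by (simp only: mult.assoc[symmetric])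
  qed
  finally show ?thesis by simp
qed

context spectrally_positive_stable begin

lemma AE_grid_max_bounds: "AE \<omega> in M. 0 \<le> grid_max n \<omega>" "AE \<omega> in M. norm (grid_max n \<omega>) \<le> S \<omega>"
proof -
  show "AE \<omega> in M. 0 \<le> grid_max n \<omega>" using AE_grid_max by (rule eventually_mono) blast
  show "AE \<omega> in M. norm (grid_max n \<omega>) \<le> S \<omega>"
    using AE_grid_max
  proof (rule eventually_mono)
    fix \<omega>
    assume "(\<lambda>n. grid_max n \<omega>) \<longlonglongrightarrow> S \<omega> \<and> (\<forall>n. 0 \<le> grid_max n \<omega> \<and> grid_max n \<omega> \<le> S \<omega>)"
    then have "0 \<le> grid_max n \<omega>" "grid_max n \<omega> \<le> S \<omega>" by blast+
    then show "norm (grid_max n \<omega>) \<le> S \<omega>" by simp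
  qed
qed

lemma AE_grid_max_tendsto: "AE \<omega> in M. (\<lambda>n. grid_max n \<omega>) \<longlonglongrightarrow> S \<omega>"
  using AE_grid_max by (rule eventually_mono) blast

text \<open>The recursion itself bounds the mean: for \<open>\<zeta> = 1\<close> the discount factors are at least \<open>1\<close>, so the
  discounted sum dominates the mean of the grid maximum, while the transform is nonnegative.\<close>

lemma mean_grid_max_bounded:
  obtains B where "0 \<le> B" "\<And>n. 0 < n \<Longrightarrow> (\<integral>\<omega>. grid_max n \<omega> \<partial>M) \<le> B"
proof -
  let ?B = "exp 1 + step.remainder_const * exp 1"
  have "(\<integral>\<omega>. grid_max n \<omega> \<partial>M) \<le> ?B" if n: "0 < n" for n
  proof -
    let ?a = "real n powr (1 / \<alpha>)"
    let ?d = "\<lambda>k. step.lindley_mean (Suc k) - step.lindley_mean k"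
    let ?q = "exp (1 / real n)"
    let ?sum = "(\<Sum>k<n. ?q ^ (n - Suc k) * ?d k) / ?a"
    let ?E = "\<integral>\<omega>. exp (- grid_max n \<omega>) \<partial>M"
    have a1: "1 \<le> ?a" using n alpha by (simp add: ge_one_powr_ge_zero)
    have char: "(\<integral>y. exp (- (1 / complex_of_real (real n powr (1 / \<alpha>)) * of_real y)) \<partial>step_law) = exp (1 / of_nat n)"
      if "0 < n" for n
      using transform_step_real[OF that, of 1] by simp
    have E: "(\<integral>\<omega>. exp (- (1 * of_real (grid_max n \<omega>))) \<partial>M) = complex_of_real ?E"
      by (subst integral_complex_of_real[symmetric]) (simp add: exp_of_real[symmetric])
    have q: "exp (1 / of_nat n) = complex_of_real ?q"
      by (simp add: exp_of_real[symmetric])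
    have sum: "(\<Sum>k<n. exp (1 / of_nat n) ^ (n - Suc k) * complex_of_real (?d k)) / complex_of_real ?a
      = complex_of_real ?sum" unfolding q by simp
    have "norm ((\<integral>\<omega>. exp (- (1 * of_real (grid_max n \<omega>))) \<partial>M) - exp 1
      + 1 * ((\<Sum>k<n. exp (1 / of_nat n) ^ (n - Suc k) * complex_of_real (?d k)) / complex_of_real ?a))
      \<le> (norm (1::complex))\<^sup>2 * step.remainder_const * exp (norm (1::complex)) * real n powr (1 - 2 / \<alpha>)"
      by (rule scaled_recursion_error) (use char n a1 in auto)
    also have "(\<integral>\<omega>. exp (- (1 * of_real (grid_max n \<omega>))) \<partial>M) - exp 1
      + 1 * ((\<Sum>k<n. exp (1 / of_nat n) ^ (n - Suc k) * complex_of_real (?d k)) / complex_of_real ?a)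
      = of_real (?E - exp 1 + ?sum)"
      unfolding E sum by (simp add: exp_of_real[symmetric])
    also have "(norm (1::complex))\<^sup>2 * step.remainder_const * exp (norm (1::complex)) * real n powr (1 - 2 / \<alpha>)
      \<le> step.remainder_const * exp 1"
    proof -
      have "real n powr (1 - 2 / \<alpha>) \<le> real n powr 0"
        using n alpha by (intro powr_mono) (auto simp: field_simps)
      then have "real n powr (1 - 2 / \<alpha>) \<le> 1" using n by simp
      then show ?thesis using step.remainder_const_nonneg
        by (simp add: mult_left_le)
    qed
    finally have "\<bar>?E - exp 1 + ?sum\<bar> \<le> step.remainder_const * exp 1"
      by (simp only: norm_of_real)
    moreover have "0 \<le> ?E" by (intro integral_nonneg_AE) auto
    ultimately have "?sum \<le> ?B" by linarith
    moreover have "step.lindley_mean n / ?a \<le> ?sum"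
    proof (rule divide_right_mono)
      have "step.lindley_mean n = (\<Sum>k<n. ?d k)"
        by (simp add: sum_lessThan_telescope)
      also have "\<dots> \<le> (\<Sum>k<n. ?q ^ (n - Suc k) * ?d k)"
      proof (rule sum_mono)
        fix k
        have "1 \<le> ?q ^ (n - Suc k)" by (rule one_le_power) simp
        then show "?d k \<le> ?q ^ (n - Suc k) * ?d k"
          using step.lindley_mean_mono[of k] by (simp add: mult_le_cancel_right1)
      qed
      finally show "step.lindley_mean n \<le> (\<Sum>k<n. ?q ^ (n - Suc k) * ?d k)" .
    qed simp
    ultimately show ?thesis unfolding mean_grid_max[OF n] by linarith
  qed
  moreover have "0 \<le> ?B" using step.remainder_const_nonneg by simp
  ultimately show ?thesis using that by blast
qed

lemma integrable_S: "integrable M S"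
proof -
  obtain B where B: "0 \<le> B" "\<And>n. 0 < n \<Longrightarrow> (\<integral>\<omega>. grid_max n \<omega> \<partial>M) \<le> B"
    by (rule mean_grid_max_bounded) blast
  have "(\<integral>\<^sup>+\<omega>. ennreal (S \<omega>) \<partial>M) = (\<integral>\<^sup>+\<omega>. liminf (\<lambda>n. ennreal (grid_max (Suc n) \<omega>)) \<partial>M)"
  proof (rule nn_integral_cong_AE)
    show "AE \<omega> in M. ennreal (S \<omega>) = liminf (\<lambda>n. ennreal (grid_max (Suc n) \<omega>))"
      using AE_grid_max
    proof eventually_elim
      case (elim \<omega>)
      then have "(\<lambda>n. ennreal (grid_max (Suc n) \<omega>)) \<longlonglongrightarrow> ennreal (S \<omega>)"
        by (intro tendsto_ennrealI LIMSEQ_Suc) auto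
      from lim_imp_Liminf[OF sequentially_bot this] show ?case by (rule sym)
    qed
  qed
  also have "\<dots> \<le> liminf (\<lambda>n. \<integral>\<^sup>+\<omega>. ennreal (grid_max (Suc n) \<omega>) \<partial>M)"
    by (rule nn_integral_liminf) measurable
  also have "\<dots> \<le> ennreal B"
  proof (rule Liminf_le[OF _ always_eventually, rule_format])
    fix n
    have "(\<integral>\<^sup>+\<omega>. ennreal (grid_max (Suc n) \<omega>) \<partial>M) = ennreal (\<integral>\<omega>. grid_max (Suc n) \<omega> \<partial>M)"
      by (rule nn_integral_eq_integral[OF integrable_grid_max])
        (simp, rule AE_grid_max_bounds)
    then show "(\<integral>\<^sup>+\<omega>. ennreal (grid_max (Suc n) \<omega>) \<partial>M) \<le> ennreal B"
      using B(2)[of "Suc n"] by (simp add: ennreal_leI)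
  qed simp
  finally have "(\<integral>\<^sup>+\<omega>. ennreal (S \<omega>) \<partial>M) < \<infinity>"
    using ennreal_less_top le_less_trans by (metis infinity_ennreal_def)
  then show ?thesis
    by (intro integrableI_nonneg AE_S_nonneg sup_measurable)
qed

lemma mean_scaling: "(\<lambda>n. step.lindley_mean n / real n powr (1 / \<alpha>)) \<longlonglongrightarrow> (\<integral>\<omega>. S \<omega> \<partial>M)"
proof -
  have "(\<lambda>n. \<integral>\<omega>. grid_max n \<omega> \<partial>M) \<longlonglongrightarrow> (\<integral>\<omega>. S \<omega> \<partial>M)"
    by (rule integral_dominated_convergence[OF _ _ integrable_S AE_grid_max_tendsto AE_grid_max_bounds(2)])
      measurable
  moreover have "\<forall>\<^sub>F n in sequentially. (\<integral>\<omega>. grid_max n \<omega> \<partial>M) = step.lindley_mean n / real n powr (1 / \<alpha>)"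
    using eventually_gt_at_top[of 0] by eventually_elim (rule mean_grid_max)
  ultimately show ?thesis by (rule Lim_transform_eventually)
qed

text \<open>The limit of the unrolled recursion.  It covers all arguments \<open>\<zeta>\<close> of the closed right half plane
  for which the step transform is known, so it yields the Laplace transform and the characteristic
  function alike.\<close>

lemma transform_S_mean:
  assumes z: "0 \<le> Re \<zeta>"
    and char: "\<And>n. 0 < n \<Longrightarrow>
      (\<integral>y. exp (- (\<zeta> / of_real (real n powr (1 / \<alpha>)) * of_real y)) \<partial>step_law) = exp (\<Psi> / of_nat n)"
  shows "(\<integral>\<omega>. exp (- (\<zeta> * of_real (S \<omega>))) \<partial>M)
    = exp \<Psi> - \<zeta> * of_real ((\<integral>\<omega>. S \<omega> \<partial>M) * (1 / \<alpha>)) * stable_kernel (1 / \<alpha>) \<Psi>"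
proof -
  let ?e = "\<lambda>n. (\<integral>\<omega>. exp (- (\<zeta> * of_real (grid_max n \<omega>))) \<partial>M) - exp \<Psi>
      + \<zeta> * ((\<Sum>k<n. exp (\<Psi> / of_nat n) ^ (n - Suc k)
          * of_real (step.lindley_mean (Suc k) - step.lindley_mean k)) / of_real (real n powr (1 / \<alpha>)))"
  have a: "0 < 1 / \<alpha>" using alpha by simp
  let ?sum = "\<lambda>n. (\<Sum>k<n. exp (\<Psi> / of_nat n) ^ (n - Suc k)
          * of_real (step.lindley_mean (Suc k) - step.lindley_mean k)) / complex_of_real (real n powr (1 / \<alpha>))"
  have sum: "?sum \<longlonglongrightarrow> of_real ((\<integral>\<omega>. S \<omega> \<partial>M) * (1 / \<alpha>)) * stable_kernel (1 / \<alpha>) \<Psi>"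
    by (rule discounted_sum_limit[OF a mean_scaling step.lindley_mean_0])
  have "?e \<longlonglongrightarrow> (\<integral>\<omega>. exp (- (\<zeta> * of_real (S \<omega>))) \<partial>M) - exp \<Psi>
      + \<zeta> * (of_real ((\<integral>\<omega>. S \<omega> \<partial>M) * (1 / \<alpha>)) * stable_kernel (1 / \<alpha>) \<Psi>)"
    using tendsto_mult_left[OF sum, of \<zeta>] transform_grid_max_tendsto[OF z]
    by (intro tendsto_add tendsto_diff tendsto_const)
  moreover have "?e \<longlonglongrightarrow> 0"
  proof (rule Lim_null_comparison)
    have "\<forall>\<^sub>F n in sequentially. norm \<zeta> \<le> real n powr (1 / \<alpha>)"
      using a by real_asymp
    then show "\<forall>\<^sub>F n in sequentially. norm (?e n)
      \<le> (norm \<zeta>)\<^sup>2 * step.remainder_const * exp (norm \<Psi>) * real n powr (1 - 2 / \<alpha>)"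
      using eventually_gt_at_top[of 0]
      by eventually_elim (intro scaled_recursion_error[OF z char])
    have "1 - 2 / \<alpha> < 0" using alpha by (simp add: field_simps)
    then have "(\<lambda>n. real n powr (1 - 2 / \<alpha>)) \<longlonglongrightarrow> 0" by real_asymp
    then show "(\<lambda>n. (norm \<zeta>)\<^sup>2 * step.remainder_const * exp (norm \<Psi>) * real n powr (1 - 2 / \<alpha>)) \<longlonglongrightarrow> 0"
      by (rule tendsto_mult_right_zero)
  qed
  ultimately have "(\<integral>\<omega>. exp (- (\<zeta> * of_real (S \<omega>))) \<partial>M) - exp \<Psi>
      + \<zeta> * (of_real ((\<integral>\<omega>. S \<omega> \<partial>M) * (1 / \<alpha>)) * stable_kernel (1 / \<alpha>) \<Psi>) = 0"
    by (rule LIMSEQ_unique)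
  then show ?thesis by (simp add: algebra_simps)
qed

text \<open>For \<open>\<zeta> = n powr (1 / \<alpha>)\<close> the exponent is \<open>\<Psi> = n\<close>, and multiplying the transform by \<open>exp (- n)\<close>
  leaves an incomplete Gamma integral; the transform itself is at most \<open>1\<close>.  For imaginary \<open>\<zeta>\<close> the
  formula stays bounded whatever the constant is, which is why real arguments are required here.\<close>

lemma mean_S: "(\<integral>\<omega>. S \<omega> \<partial>M) * (1 / \<alpha>) = 1 / Gamma (1 / \<alpha>)"
proof -
  let ?c = "(\<integral>\<omega>. S \<omega> \<partial>M) * (1 / \<alpha>)"
  let ?a = "1 / \<alpha>"
  let ?L = "\<lambda>n. \<integral>\<omega>. exp (- (real n powr ?a * S \<omega>)) \<partial>M"
  let ?I = "\<lambda>n. LBINT v:{0..real n}. v powr (?a - 1) * exp (- v)"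
  have a: "0 < ?a" using alpha by simp
  have eq: "?c * ?I n = 1 - exp (- real n) * ?L n" if n: "0 < n" for n
  proof -
    let ?l = "real n powr ?a"
    have ln: "?l powr \<alpha> = real n" using alpha n by (simp add: powr_powr)
    have k: "stable_kernel ?a (of_real (real n))
      = of_real (exp (real n) * (LBINT s:{0..1}. s powr (?a - 1) * exp (- (real n * s))))"
    proof -
      have "(LBINT s:{0..1}. complex_of_real (s powr (?a - 1)) * exp (of_real (1 - s) * of_real (real n)))
        = (LBINT s:{0..1}. complex_of_real (exp (real n) * (s powr (?a - 1) * exp (- (real n * s)))))"
      proof (intro arg_cong[where f="set_lebesgue_integral lborel {0..1}"] ext)
        fix s
        have "exp (of_real (1 - s) * of_real (real n)) = complex_of_real (exp ((1 - s) * real n))"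
          by (simp only: of_real_mult[symmetric] exp_of_real)
        also have "exp ((1 - s) * real n) = exp (real n) * exp (- (real n * s))"
          by (simp add: exp_add[symmetric] algebra_simps)
        finally show "complex_of_real (s powr (?a - 1)) * exp (of_real (1 - s) * of_real (real n))
          = complex_of_real (exp (real n) * (s powr (?a - 1) * exp (- (real n * s))))"
          by simp
      qed
      then show ?thesis
        unfolding stable_kernel_def by (simp only: set_integral_complex_of_real set_integral_mult_right)
    qed
    have "(\<integral>\<omega>. exp (- (complex_of_real ?l * of_real (S \<omega>))) \<partial>M)
      = exp (of_real (real n)) - of_real ?l * of_real ?c * stable_kernel ?a (of_real (real n))"
    proof (rule transform_S_mean)
      show "0 \<le> Re (complex_of_real ?l)" by simp
      show "(\<integral>y. exp (- (complex_of_real ?l / of_real (real m powr (1 / \<alpha>)) * of_real y)) \<partial>step_law)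
        = exp (of_real (real n) / of_nat m)" if "0 < m" for m
        using transform_step_real[OF that, of ?l] unfolding ln by simp
    qed
    also have "(\<integral>\<omega>. exp (- (complex_of_real ?l * of_real (S \<omega>))) \<partial>M) = of_real (?L n)"
      by (subst integral_complex_of_real[symmetric]) (simp add: exp_of_real[symmetric])
    also have "exp (of_real (real n)) - of_real ?l * of_real ?c * stable_kernel ?a (of_real (real n))
      = complex_of_real (exp (real n) - ?l * ?c * (exp (real n) * (LBINT s:{0..1}. s powr (?a - 1) * exp (- (real n * s)))))"
      unfolding k by (simp only: exp_of_real of_real_mult of_real_diff)
    also have "?l * ?c * (exp (real n) * (LBINT s:{0..1}. s powr (?a - 1) * exp (- (real n * s))))
      = exp (real n) * (?c * ?I n)"
      using scaled_exp_integral[of "real n" ?a] n by (simp add: mult_ac)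
    finally have "?L n = exp (real n) - exp (real n) * (?c * ?I n)"
      by (simp only: of_real_eq_iff)
    then have "exp (- real n) * ?L n = exp (- real n) * exp (real n) * (1 - ?c * ?I n)"
      by (simp only: right_diff_distrib mult_1_right mult.assoc)
    then show ?thesis by (simp add: exp_minus)
  qed
  have lim: "(\<lambda>n. ?c * ?I n) \<longlonglongrightarrow> ?c * Gamma ?a"
    by (intro tendsto_intros Gamma_truncated_limit a)
  have "(\<lambda>n. exp (- real n) * ?L n) \<longlonglongrightarrow> 0"
  proof (rule Lim_null_comparison)
    have "norm (exp (- real n) * ?L n) \<le> exp (- real n)" for n
    proof -
      have b: "AE \<omega> in M. norm (exp (- (real n powr ?a * S \<omega>))) \<le> 1"
        using AE_S_nonneg by eventually_elim simp
      then have "integrable M (\<lambda>\<omega>. exp (- (real n powr ?a * S \<omega>)))"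
        by (rule integrable_const_bound) measurable
      then have "?L n \<le> (\<integral>\<omega>. 1 \<partial>M)"
        by (rule integral_mono_AE) (use b in auto)
      moreover have "0 \<le> ?L n" by (intro integral_nonneg_AE) auto
      ultimately show ?thesis by (simp add: prob_space)
    qed
    then show "\<forall>\<^sub>F n in sequentially. norm (exp (- real n) * ?L n) \<le> exp (- real n)" by simp
    show "(\<lambda>n. exp (- real n)) \<longlonglongrightarrow> 0" by real_asymp
  qed
  then have "(\<lambda>n. 1 - exp (- real n) * ?L n) \<longlonglongrightarrow> 1 - 0"
    by (intro tendsto_diff tendsto_const)
  then have "(\<lambda>n. ?c * ?I n) \<longlonglongrightarrow> 1 - 0"
    by (rule Lim_transform_eventually)
      (use eventually_gt_at_top[of 0] in \<open>eventually_elim, simp only: eq\<close>)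
  from LIMSEQ_unique[OF lim this] have "?c * Gamma ?a = 1" by simp
  then show ?thesis using Gamma_real_pos[OF a] by (simp add: field_simps)
qed

end

locale spectrally_positive_stable_char = spectrally_positive_stable +
  assumes charfun: "(LINT \<omega>|M. exp (\<i> * complex_of_real (l * X 1 \<omega>)))
    = exp ((- \<i> * complex_of_real l) powr complex_of_real \<alpha>)"
begin

text \<open>Here \<open>\<Psi> = (\<i> t)^\<alpha>\<close> on the principal branch.\<close>

lemma charfun_S:
  assumes t: "0 < t"
  defines "\<Psi> \<equiv> of_real (t powr \<alpha>) * cis (\<alpha> * pi / 2)"
  shows "(\<integral>\<omega>. exp (- (\<i> * of_real t * of_real (S \<omega>))) \<partial>M)
    = exp \<Psi> - \<i> * of_real t * of_real (1 / Gamma (1 / \<alpha>)) * stable_kernel (1 / \<alpha>) \<Psi>"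
  unfolding mean_S[symmetric]
proof (rule transform_S_mean)
  fix n :: nat assume n: "0 < n"
  let ?r = "t / real n powr (1 / \<alpha>)"
  have r: "0 < ?r" using t n by simp
  have "(\<integral>y. exp (- (\<i> * of_real t / of_real (real n powr (1 / \<alpha>)) * of_real y)) \<partial>step_law)
    = (\<integral>\<omega>. exp (\<i> * complex_of_real (- ?r * X 1 \<omega>)) \<partial>M)"
  proof -
    have e: "- (\<i> * of_real t / of_real (real n powr (1 / \<alpha>)) * of_real y) = \<i> * complex_of_real (- ?r * y)" for y
      by simp
    show ?thesis
      unfolding step_law_eq e by (rule integral_distr) auto
  qed
  also have "\<dots> = exp ((\<i> * complex_of_real ?r) powr complex_of_real \<alpha>)"
    unfolding charfun by simp
  also have "(\<i> * complex_of_real ?r) powr complex_of_real \<alpha> = of_real (?r powr \<alpha>) * cis (\<alpha> * pi / 2)"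
    by (rule ii_powr[OF r])
  also have "?r powr \<alpha> = t powr \<alpha> / real n"
    using t n alpha by (simp add: powr_divide powr_powr)
  finally show "(\<integral>y. exp (- (\<i> * of_real t / of_real (real n powr (1 / \<alpha>)) * of_real y)) \<partial>step_law) = exp (\<Psi> / of_nat n)"
    by (simp add: \<Psi>_def)
qed simp

end

section \<open>The integrand as a real part, and its decay\<close>

lemma set_integral_Im:
  assumes "set_integrable lborel A h"
  shows "(LBINT s:A. Im (h s)) = Im (LBINT s:A. h s)"
  using assms unfolding set_lebesgue_integral_def set_integrable_def
  by (subst integral_Im[symmetric]) auto

definition stable_exponent :: "real \<Rightarrow> real \<Rightarrow> complex" where
  "stable_exponent \<alpha> t = of_real (t powr \<alpha>) * cis (\<alpha> * pi / 2)"

definition sup_charfun :: "real \<Rightarrow> real \<Rightarrow> complex" where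
  "sup_charfun \<alpha> t = exp (stable_exponent \<alpha> t)
    - \<i> * of_real t * of_real (1 / Gamma (1 / \<alpha>)) * stable_kernel (1 / \<alpha>) (stable_exponent \<alpha> t)"

lemma stable_exponent_Re: "Re (stable_exponent \<alpha> t) = - (t powr \<alpha> * (- cos (\<alpha> * pi / 2)))"
  by (simp add: stable_exponent_def)

lemma norm_stable_exponent: "norm (stable_exponent \<alpha> t) = t powr \<alpha>"
  by (simp add: stable_exponent_def norm_mult)

context
  fixes \<alpha> :: real
  assumes alpha: "1 < \<alpha>" "\<alpha> < 2"
begin

text \<open>The substitution \<open>y = t powr \<alpha> * (1 - s)\<close>.  Both sides vanish at \<open>s = 0\<close> by the conventions for
  \<open>powr\<close> and division at \<open>0\<close>.\<close>

lemma inner_integrand_affine: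
  assumes t: "0 < t"
  shows "indicator {0..t powr \<alpha>} (t powr \<alpha> + - (t powr \<alpha>) * s) *\<^sub>R inner_integrand \<alpha> x t (t powr \<alpha> + - (t powr \<alpha>) * s)
    = t powr (1 - \<alpha>) * (indicator {0..1} s *\<^sub>R
        Im (exp (\<i> * of_real (t * x)) * (of_real (s powr (1 / \<alpha> - 1)) * exp (of_real (1 - s) * stable_exponent \<alpha> t))))"
proof (cases "s \<in> {0..1}")
  case False
  have "0 < t powr \<alpha>" using t by simp
  then have "t powr \<alpha> + - (t powr \<alpha>) * s \<notin> {0..t powr \<alpha>}"
  proof -
    assume T: "0 < t powr \<alpha>"
    have "t powr \<alpha> + - (t powr \<alpha>) * s = t powr \<alpha> * (1 - s)" by (simp add: algebra_simps)
    moreover have "t powr \<alpha> * (1 - s) \<in> {0..t powr \<alpha>} \<longleftrightarrow> s \<in> {0..1}"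
      using T by (auto simp: zero_le_mult_iff mult_le_cancel_left1)
    ultimately show ?thesis using False by simp
  qed
  with False show ?thesis by simp
next
  case True
  let ?T = "t powr \<alpha>" and ?\<theta> = "\<alpha> * pi / 2"
  have T: "0 < ?T" using t by simp
  have y: "?T + - ?T * s = ?T * (1 - s)" by (simp add: algebra_simps)
  have mem: "?T * (1 - s) \<in> {0..?T}"
    using T True by (auto simp: mult_le_cancel_left1)
  have E: "exp (of_real (1 - s) * stable_exponent \<alpha> t) = of_real (exp (?T * (1 - s) * cos ?\<theta>)) * cis (?T * (1 - s) * sin ?\<theta>)"
  proof -
    have "of_real (1 - s) * stable_exponent \<alpha> t = of_real (?T * (1 - s) * cos ?\<theta>) + \<i> * of_real (?T * (1 - s) * sin ?\<theta>)"
      by (simp add: stable_exponent_def complex_eq_iff)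
    then show ?thesis by (simp only: exp_add exp_of_real cis_conv_exp)
  qed
  have "exp (\<i> * of_real (t * x)) * (of_real (s powr (1 / \<alpha> - 1)) * exp (of_real (1 - s) * stable_exponent \<alpha> t))
    = of_real (s powr (1 / \<alpha> - 1) * exp (?T * (1 - s) * cos ?\<theta>)) * (cis (t * x) * cis (?T * (1 - s) * sin ?\<theta>))"
    unfolding E cis_conv_exp[of "t * x"] by simp
  also have "\<dots> = of_real (s powr (1 / \<alpha> - 1) * exp (?T * (1 - s) * cos ?\<theta>)) * cis (?T * (1 - s) * sin ?\<theta> + t * x)"
    by (simp only: cis_mult add.commute)
  finally have F: "exp (\<i> * of_real (t * x)) * (of_real (s powr (1 / \<alpha> - 1)) * exp (of_real (1 - s) * stable_exponent \<alpha> t))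
    = of_real (s powr (1 / \<alpha> - 1) * exp (?T * (1 - s) * cos ?\<theta>)) * cis (?T * (1 - s) * sin ?\<theta> + t * x)" .
  have I: "Im (exp (\<i> * of_real (t * x)) * (of_real (s powr (1 / \<alpha> - 1)) * exp (of_real (1 - s) * stable_exponent \<alpha> t)))
    = s powr (1 / \<alpha> - 1) * exp (?T * (1 - s) * cos ?\<theta>) * sin (?T * (1 - s) * sin ?\<theta> + t * x)"
    unfolding F by simp
  have p: "1 / (?T - ?T * (1 - s)) powr (1 - 1 / \<alpha>) = t powr (1 - \<alpha>) * s powr (1 / \<alpha> - 1)"
  proof -
    have "?T - ?T * (1 - s) = ?T * s" by (simp add: algebra_simps)
    moreover have "(?T * s) powr (1 - 1 / \<alpha>) = t powr (\<alpha> - 1) * s powr (1 - 1 / \<alpha>)"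
      using True t alpha by (simp add: powr_mult powr_powr right_diff_distrib)
    moreover have "1 / t powr (\<alpha> - 1) = t powr (1 - \<alpha>)"
      using powr_minus_divide[of t "\<alpha> - 1"] by simp
    moreover have "1 / s powr (1 - 1 / \<alpha>) = s powr (1 / \<alpha> - 1)"
      using powr_minus_divide[of s "1 - 1 / \<alpha>"] by simp
    ultimately show ?thesis by (metis divide_divide_eq_left mult.commute mult_1 times_divide_eq_right)
  qed
  have "inner_integrand \<alpha> x t (?T * (1 - s)) = exp (?T * (1 - s) * cos ?\<theta>) *
      (1 / (?T - ?T * (1 - s)) powr (1 - 1 / \<alpha>)) * sin (?T * (1 - s) * sin ?\<theta> + t * x)"
    unfolding inner_integrand_def by simp
  then show ?thesis unfolding I p y using True mem by simp
qed

lemma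
  assumes t: "0 < t"
  shows set_integrable_inner_integrand_pos: "set_integrable lborel {0..t powr \<alpha>} (inner_integrand \<alpha> x t)" (is ?A)
    and set_integral_inner_integrand: "(LBINT y:{0..t powr \<alpha>}. inner_integrand \<alpha> x t y)
      = t * Im (exp (\<i> * of_real (t * x)) * stable_kernel (1 / \<alpha>) (stable_exponent \<alpha> t))" (is ?B)
proof -
  let ?T = "t powr \<alpha>"
  have T: "0 < ?T" using t by simp
  let ?h = "\<lambda>s. exp (\<i> * of_real (t * x)) * (of_real (s powr (1 / \<alpha> - 1)) * exp (of_real (1 - s) * stable_exponent \<alpha> t))"
  have k: "set_integrable lborel {0..1} ?h"
    using alpha by (intro set_integrable_mult_right set_integrable_stable_kernel) simp
  have kI: "integrable lborel (\<lambda>s. indicator {0..1} s *\<^sub>R Im (?h s))"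
    using integrable_Im[OF k[unfolded set_integrable_def]] by simp
  have "integrable lborel (\<lambda>s. indicator {0..?T} (?T + - ?T * s) *\<^sub>R inner_integrand \<alpha> x t (?T + - ?T * s))"
    unfolding inner_integrand_affine[OF t] using kI by simp
  then show ?A
    unfolding set_integrable_def using T
    by (subst (asm) lborel_integrable_real_affine_iff) auto
  have "(LBINT y:{0..?T}. inner_integrand \<alpha> x t y)
    = \<bar>- ?T\<bar> *\<^sub>R (LBINT s. indicator {0..?T} (?T + - ?T * s) *\<^sub>R inner_integrand \<alpha> x t (?T + - ?T * s))"
    unfolding set_lebesgue_integral_def
    by (rule lborel_integral_real_affine) (use T in simp)
  also have "\<dots> = ?T * (t powr (1 - \<alpha>) * (LBINT s:{0..1}. Im (?h s)))"
    unfolding inner_integrand_affine[OF t] set_lebesgue_integral_def using T by simp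
  also have "(LBINT s:{0..1}. Im (?h s)) = Im (LBINT s:{0..1}. ?h s)"
    by (rule set_integral_Im[OF k])
  also have "(LBINT s:{0..1}. ?h s) = exp (\<i> * of_real (t * x)) * stable_kernel (1 / \<alpha>) (stable_exponent \<alpha> t)"
    unfolding stable_kernel_def by (rule set_integral_mult_right)
  also have "?T * (t powr (1 - \<alpha>) * Im (exp (\<i> * of_real (t * x)) * stable_kernel (1 / \<alpha>) (stable_exponent \<alpha> t)))
    = (?T * t powr (1 - \<alpha>)) * Im (exp (\<i> * of_real (t * x)) * stable_kernel (1 / \<alpha>) (stable_exponent \<alpha> t))"
    by (simp only: mult.assoc)
  also have "?T * t powr (1 - \<alpha>) = t"
    using t by (simp add: powr_add[symmetric])
  finally show ?B .
qed

lemma set_integrable_inner_integrand: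
  assumes "0 \<le> t"
  shows "set_integrable lborel {0..t powr \<alpha>} (inner_integrand \<alpha> x t)"
proof (cases "t = 0")
  case True
  have "integrable lborel (\<lambda>y. indicator {0::real} y *\<^sub>R inner_integrand \<alpha> x t 0)"
    by (rule integrable_scaleR_left) simp
  moreover have "(\<lambda>y. indicator {0::real} y *\<^sub>R inner_integrand \<alpha> x t 0)
    = (\<lambda>y. indicator {0..t powr \<alpha>} y *\<^sub>R inner_integrand \<alpha> x t y)"
    using True by (auto simp: fun_eq_iff indicator_def)
  ultimately show ?thesis unfolding set_integrable_def by (simp only:)
qed (use assms set_integrable_inner_integrand_pos in simp)

lemma outer_integrand_eq_Re:
  assumes "0 < t"
  shows "outer_integrand \<alpha> x t = Re (exp (\<i> * of_real (t * x)) * sup_charfun \<alpha> t)"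
proof -
  let ?\<theta> = "\<alpha> * pi / 2"
  let ?e = "exp (\<i> * of_real (t * x))"
  have "?e * exp (stable_exponent \<alpha> t) = of_real (exp (t powr \<alpha> * cos ?\<theta>)) * cis (t powr \<alpha> * sin ?\<theta> + t * x)"
  proof -
    have "stable_exponent \<alpha> t = of_real (t powr \<alpha> * cos ?\<theta>) + \<i> * of_real (t powr \<alpha> * sin ?\<theta>)"
      by (simp add: stable_exponent_def complex_eq_iff)
    then have "exp (stable_exponent \<alpha> t) = of_real (exp (t powr \<alpha> * cos ?\<theta>)) * cis (t powr \<alpha> * sin ?\<theta>)"
      by (simp only: exp_add exp_of_real cis_conv_exp)
    moreover have "?e = cis (t * x)" by (simp add: cis_conv_exp)
    ultimately show ?thesis by (simp add: cis_mult mult_ac add_ac)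
  qed
  then have "Re (?e * exp (stable_exponent \<alpha> t)) = exp (t powr \<alpha> * cos ?\<theta>) * cos (t powr \<alpha> * sin ?\<theta> + t * x)"
    by simp
  moreover have "?e * sup_charfun \<alpha> t = ?e * exp (stable_exponent \<alpha> t)
     - \<i> * (of_real (t / Gamma (1 / \<alpha>)) * (?e * stable_kernel (1 / \<alpha>) (stable_exponent \<alpha> t)))"
    by (simp add: sup_charfun_def algebra_simps)
  moreover have "Re (\<i> * (of_real (t / Gamma (1 / \<alpha>)) * (?e * stable_kernel (1 / \<alpha>) (stable_exponent \<alpha> t))))
    = - (t / Gamma (1 / \<alpha>) * Im (?e * stable_kernel (1 / \<alpha>) (stable_exponent \<alpha> t)))"
  proof -
    have "Re (\<i> * (of_real r * w)) = - (r * Im w)" for r :: real and w :: complex by simp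
    then show ?thesis .
  qed
  ultimately show ?thesis
    unfolding outer_integrand_def set_integral_inner_integrand[OF assms] by (simp only: minus_complex.sel) simp
qed

lemma neg_cos_pos: "0 < - cos (\<alpha> * pi / 2)"
proof -
  have "pi / 2 < \<alpha> * pi / 2" "\<alpha> * pi / 2 < pi"
    using alpha by (auto simp: field_simps)
  then have "cos (\<alpha> * pi / 2) < cos (pi / 2)"
    by (intro cos_monotone_0_pi) auto
  then show ?thesis by simp
qed

end

lemma power_times_exp_bound:
  assumes "0 \<le> (y::real)" "1 \<le> p" "p \<le> 2"
  shows "y powr p * exp (- y) \<le> 3"
proof -
  have "y powr p \<le> 1 + y\<^sup>2"
  proof (cases "y \<le> 1")
    case True
    then have "y powr p \<le> 1" using assms by (simp add: powr_le1)
    then show ?thesis by (smt (verit) zero_le_power2)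
  next
    case False
    then have "y powr p \<le> y powr 2" using assms by (intro powr_mono) auto
    also have "\<dots> = y\<^sup>2" using False by (simp add: powr_numeral)
    finally show ?thesis by simp
  qed
  also have "1 + y\<^sup>2 \<le> 3 * exp y"
    using exp_lower_Taylor_quadratic[OF assms(1)] assms(1) exp_gt_zero[of y] by linarith
  finally show ?thesis by (simp add: exp_minus field_simps)
qed

text \<open>Replacing \<open>s powr (a - 1)\<close> by its value \<open>1\<close> at \<open>s = 1\<close>, where the exponential concentrates, gives
  \<open>(exp \<Psi> - 1) / \<Psi>\<close>.  The error made is at most \<open>(1 - s) * s powr (a - 1)\<close>, and a power
  \<open>q powr (- 1 - a)\<close> is gained by bounding \<open>y powr (1 + a) * exp (- y)\<close> for \<open>y = q * (1 - s)\<close>; what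
  remains is a Beta integral.\<close>

lemma stable_kernel_asymptotics:
  fixes a :: real
  assumes a: "0 < a" "a < 1"
  obtains C where "0 \<le> C"
    "\<And>\<Psi> q. 0 < q \<Longrightarrow> Re \<Psi> = - q \<Longrightarrow> norm (stable_kernel a \<Psi> + 1 / \<Psi>) \<le> C * q powr (- 1 - a) + exp (- q) / norm \<Psi>"
proof -
  define C where "C = 3 * (LBINT s:{0..1}. s powr (a - 1) * (1 - s) powr (1 - a - 1))"
  have beta: "set_integrable lborel {0..1} (\<lambda>s. s powr (a - 1) * (1 - s) powr (1 - a - 1))"
    using a by (intro integrable_Beta) auto
  have "0 \<le> C" unfolding C_def set_lebesgue_integral_def by (auto intro!: integral_nonneg_AE)
  moreover have "norm (stable_kernel a \<Psi> + 1 / \<Psi>) \<le> C * q powr (- 1 - a) + exp (- q) / norm \<Psi>"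
    if q: "0 < q" "Re \<Psi> = - q" for \<Psi> q
  proof -
    have \<Psi>0: "\<Psi> \<noteq> 0" using q by auto
    let ?e = "\<lambda>s. exp (of_real (1 - s) * \<Psi>)"
    have ie: "set_integrable lborel {0..1} ?e"
      unfolding set_integrable_def by (rule borel_integrable_compact) (auto intro!: continuous_intros)
    have ik: "set_integrable lborel {0..1} (\<lambda>s. of_real (s powr (a - 1)) * ?e s)"
      by (rule set_integrable_stable_kernel[OF a(1)])
    have Ie: "(LBINT s:{0..1}. ?e s) = (exp \<Psi> - 1) / \<Psi>"
    proof -
      have "(LBINT s:{0..1}. ?e s) = - ?e 1 / \<Psi> - (- ?e 0 / \<Psi>)"
      proof (rule set_integral_FTC[OF _ _ _ ie])
        fix s :: real
        have "((\<lambda>z. - exp ((1 - z) * \<Psi>) / \<Psi>) has_field_derivative ?e s) (at (of_real s))"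
          using \<Psi>0 by (auto intro!: derivative_eq_intros)
        from has_vector_derivative_real_field[OF this]
        show "((\<lambda>s. - ?e s / \<Psi>) has_vector_derivative ?e s) (at s)" by simp
      qed (use \<Psi>0 in \<open>auto intro!: continuous_intros\<close>)
      then show ?thesis by (simp add: diff_divide_distrib)
    qed
    let ?d = "\<lambda>s. of_real (s powr (a - 1)) * ?e s - ?e s"
    have "stable_kernel a \<Psi> + 1 / \<Psi> = (LBINT s:{0..1}. ?d s) + exp \<Psi> / \<Psi>"
      unfolding stable_kernel_def set_integral_diff(2)[OF ik ie] Ie by (simp add: diff_divide_distrib)
    then have "norm (stable_kernel a \<Psi> + 1 / \<Psi>) \<le> norm (LBINT s:{0..1}. ?d s) + norm (exp \<Psi> / \<Psi>)"
      by (simp only: norm_triangle_ineq)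
    also have "norm (exp \<Psi> / \<Psi>) = exp (- q) / norm \<Psi>" using q by (simp add: norm_divide)
    also have "norm (LBINT s:{0..1}. ?d s) \<le> C * q powr (- 1 - a)"
    proof -
      have b: "norm (indicator {0..1} s *\<^sub>R ?d s)
        \<le> 3 * q powr (- 1 - a) * (indicator {0..1} s *\<^sub>R (s powr (a - 1) * (1 - s) powr (1 - a - 1)))"
        if s: "s \<noteq> 0" "s \<noteq> 1" for s :: real
      proof (cases "s \<in> {0..1}")
        case True
        with s have s01: "0 < s" "s < 1" by auto
        have ge: "1 \<le> s powr (a - 1)" using s01 a powr_le_one_le[of s "1 - a"] powr_minus_divide[of s "1 - a"]
          by (smt (verit) powr_mono' powr_zero_eq_one)
        have le: "s powr (a - 1) - 1 \<le> (1 - s) * s powr (a - 1)"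
        proof -
          have "s * s powr (a - 1) = s powr a" using s01 by (simp add: powr_diff)
          moreover have "s powr a \<le> 1" using s01 a by (simp add: powr_le1)
          ultimately show ?thesis by (simp add: algebra_simps)
        qed
        have "norm (?d s) = norm ((of_real (s powr (a - 1) - 1) :: complex) * ?e s)"
          by (simp add: algebra_simps)
        also have "\<dots> = (s powr (a - 1) - 1) * exp (- (q * (1 - s)))"
          using ge q unfolding norm_mult norm_of_real by (simp add: mult.commute)
        also have "\<dots> \<le> (1 - s) * s powr (a - 1) * exp (- (q * (1 - s)))"
          using le by (intro mult_right_mono) auto
        also have "\<dots> = q powr (- 1 - a) * ((q * (1 - s)) powr (1 + a) * exp (- (q * (1 - s)))) * (s powr (a - 1) * (1 - s) powr (- a))"
        proof -
          have "q powr (- 1 - a) * (q * (1 - s)) powr (1 + a) * (1 - s) powr (- a) = 1 - s"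
            using q s01 by (simp add: powr_mult mult_ac powr_add[symmetric])
          then show ?thesis by (simp add: mult_ac)
        qed
        also have "\<dots> \<le> q powr (- 1 - a) * 3 * (s powr (a - 1) * (1 - s) powr (- a))"
          using a q s01 by (intro mult_right_mono mult_left_mono power_times_exp_bound) auto
        finally show ?thesis using True by (simp add: mult_ac)
      qed simp
      have "norm (LBINT s:{0..1}. ?d s)
        \<le> (LBINT s. 3 * q powr (- 1 - a) * (indicator {0..1} s *\<^sub>R (s powr (a - 1) * (1 - s) powr (1 - a - 1))))"
        unfolding set_lebesgue_integral_def
      proof (rule order_trans[OF integral_norm_bound integral_mono_AE])
        show "integrable lborel (\<lambda>s. norm (indicator {0..1} s *\<^sub>R ?d s))"
          using set_integral_diff(1)[OF ik ie] unfolding set_integrable_def by (rule integrable_norm)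
        show "integrable lborel (\<lambda>s. 3 * q powr (- 1 - a) * (indicator {0..1} s *\<^sub>R (s powr (a - 1) * (1 - s) powr (1 - a - 1))))"
          using beta unfolding set_integrable_def by (rule integrable_mult_right)
        show "AE s in lborel. norm (indicator {0..1} s *\<^sub>R ?d s)
          \<le> 3 * q powr (- 1 - a) * (indicator {0..1} s *\<^sub>R (s powr (a - 1) * (1 - s) powr (1 - a - 1)))"
          using AE_lborel_singleton[of 0] AE_lborel_singleton[of 1] by eventually_elim (rule b)
      qed
      also have "\<dots> = C * q powr (- 1 - a)"
        unfolding C_def set_lebesgue_integral_def integral_mult_right_zero by (simp only: mult_ac)
      finally show ?thesis .
    qed
    finally show ?thesis by simp
  qed
  ultimately show ?thesis using that by blast
qed


lemma set_integral_FTC_atLeast: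
  fixes F f :: "real \<Rightarrow> 'b :: euclidean_space"
  assumes "continuous_on {a..} F" "\<And>x. a < x \<Longrightarrow> (F has_vector_derivative f x) (at x)"
    and i: "set_integrable lborel {a..} f" and lim: "(F \<longlongrightarrow> l) at_top"
  shows "(LBINT x:{a..}. f x) = l - F a"
proof -
  have "((\<lambda>T. LBINT x:{a..T}. f x) \<longlongrightarrow> (LBINT x:{a..}. f x)) at_top"
    by (rule tendsto_set_lebesgue_integral_at_top[OF _ i]) simp
  then have lim1: "((\<lambda>T. LBINT x:{a..T}. f x) \<longlongrightarrow> (LBINT x:{a..}. f x)) at_top" .
  have ev: "\<forall>\<^sub>F T in at_top. F T - F a = (LBINT x:{a..T}. f x)"
    using eventually_ge_at_top[of a]
  proof eventually_elim
    case (elim T)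
    show ?case
      by (rule set_integral_FTC[symmetric])
        (use elim assms in \<open>auto intro: continuous_on_subset set_integrable_subset\<close>)
  qed
  have "((\<lambda>T. F T - F a) \<longlongrightarrow> l - F a) at_top" by (rule tendsto_diff[OF lim tendsto_const])
  from Lim_transform_eventually[OF this ev]
  show ?thesis by (rule tendsto_unique[OF trivial_limit_at_top_linorder lim1])
qed

lemma set_integrable_powr_atLeast_1:
  fixes b :: real
  assumes "1 < b"
  shows "set_integrable lborel {1..} (\<lambda>t. t powr (- b))"
proof -
  let ?F = "\<lambda>t::real. t powr (1 - b) / (1 - b)"
  have "(\<integral>\<^sup>+t. ennreal (t powr (- b)) * indicator {1..} t \<partial>lborel) = ennreal (0 - ?F 1)"
  proof (rule nn_integral_FTC_atLeast[where F="?F" and f="\<lambda>t. t powr (- b)"])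
    show "(?F \<longlongrightarrow> 0) at_top" using assms by real_asymp
    fix t :: real assume "1 \<le> t"
    then have "((\<lambda>t. t powr (1 - b)) has_real_derivative (1 - b) * t powr (- b)) (at t)"
      by (auto intro!: derivative_eq_intros)
    from DERIV_cdivide[OF this, of "1 - b"]
    show "(?F has_real_derivative t powr (- b)) (at t)" using assms by simp
  qed auto
  also have "(\<lambda>t. ennreal (t powr (- b)) * indicator {1..} t) = (\<lambda>t. ennreal (indicator {1..} t *\<^sub>R t powr (- b)))"
    by (auto simp: fun_eq_iff indicator_def)
  finally have fin: "(\<integral>\<^sup>+t. ennreal (indicator {1..} t *\<^sub>R t powr (- b)) \<partial>lborel) < \<infinity>" by simp
  show ?thesis
    unfolding set_integrable_def
    by (rule integrableI_nonneg[OF _ _ fin]) auto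
qed

text \<open>\<open>H\<close> is the boundary term of an integration by parts of \<open>exp (\<i> t x) * t powr (1 - \<alpha>)\<close>.
  Subtracting its derivative from the integrand leaves a remainder \<open>\<rho>\<close> of order \<open>t powr (- \<alpha>)\<close>,
  which is absolutely integrable.\<close>

lemma oscillatory_integral_converges:
  fixes \<phi> :: "real \<Rightarrow> complex" and \<alpha> x :: real
  assumes \<alpha>: "1 < \<alpha>" and x: "x \<noteq> 0"
    and meas [measurable]: "\<phi> \<in> borel_measurable borel"
    and loc: "\<And>T. set_integrable lborel {0..T} (\<lambda>t. exp (\<i> * of_real (t * x)) * \<phi> t)"
    and asym: "\<And>t. 1 \<le> t \<Longrightarrow> norm (\<phi> t - k * of_real (t powr (1 - \<alpha>))) \<le> C * t powr (- \<alpha>)"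
  obtains L where "((\<lambda>T. LBINT t:{0..T}. exp (\<i> * of_real (t * x)) * \<phi> t) \<longlongrightarrow> L) at_top"
proof -
  let ?e = "\<lambda>t. exp (\<i> * of_real (t * x))"
  define H where "H t = ?e t * of_real (t powr (1 - \<alpha>)) / (\<i> * of_real x)" for t
  define h where "h t = ?e t * (of_real (t powr (1 - \<alpha>)) + of_real ((1 - \<alpha>) * t powr (- \<alpha>)) / (\<i> * of_real x))" for t
  have H': "(H has_vector_derivative h t) (at t)" if "0 < t" for t
  proof -
    have "((\<lambda>z. exp (\<i> * (z * of_real x))) has_field_derivative (\<i> * of_real x) * ?e t) (at (of_real t))"
      by (auto intro!: derivative_eq_intros)
    from has_vector_derivative_real_field[OF this]
    have e: "(?e has_vector_derivative (\<i> * of_real x) * ?e t) (at t)" by simp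
    have "((\<lambda>t. t powr (1 - \<alpha>)) has_real_derivative (1 - \<alpha>) * t powr (- \<alpha>)) (at t)"
      using that by (auto intro!: derivative_eq_intros)
    then have "((\<lambda>t. of_real (t powr (1 - \<alpha>))) has_vector_derivative (of_real ((1 - \<alpha>) * t powr (- \<alpha>)) :: complex)) (at t)"
      by (intro has_vector_derivative_of_real) (simp add: has_real_derivative_iff_has_vector_derivative)
    from has_vector_derivative_mult_left[OF has_vector_derivative_mult[OF e this], of "1 / (\<i> * of_real x)"]
    show ?thesis
      unfolding H_def h_def using x by (simp add: field_simps)
  qed
  define \<rho> where "\<rho> t = ?e t * \<phi> t - k * h t" for t
  have [measurable]: "\<rho> \<in> borel_measurable borel" unfolding \<rho>_def h_def by measurable
  define C' where "C' = C + norm k * \<bar>1 - \<alpha>\<bar> / \<bar>x\<bar>"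
  have \<rho>_le: "norm (\<rho> t) \<le> C' * t powr (- \<alpha>)" if t: "1 \<le> t" for t
  proof -
    have "\<rho> t = ?e t * (\<phi> t - k * of_real (t powr (1 - \<alpha>))) - ?e t * (k * (of_real ((1 - \<alpha>) * t powr (- \<alpha>)) / (\<i> * of_real x)))"
      by (simp add: \<rho>_def h_def algebra_simps)
    then have "norm (\<rho> t) \<le> norm (?e t * (\<phi> t - k * of_real (t powr (1 - \<alpha>))))
        + norm (?e t * (k * (of_real ((1 - \<alpha>) * t powr (- \<alpha>)) / (\<i> * of_real x))))"
      by (simp only: norm_triangle_ineq4)
    also have "norm (?e t * (\<phi> t - k * of_real (t powr (1 - \<alpha>)))) \<le> C * t powr (- \<alpha>)"
      using asym[OF t] by (simp add: norm_mult)
    also have "norm (?e t * (k * (of_real ((1 - \<alpha>) * t powr (- \<alpha>)) / (\<i> * of_real x))))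
      = norm k * \<bar>1 - \<alpha>\<bar> / \<bar>x\<bar> * t powr (- \<alpha>)"
    proof -
      have "norm (of_real ((1 - \<alpha>) * t powr (- \<alpha>)) :: complex) = \<bar>1 - \<alpha>\<bar> * t powr (- \<alpha>)"
        by (simp only: norm_of_real abs_mult) simp
      then show ?thesis by (simp add: norm_mult norm_divide del: of_real_mult of_real_diff)
    qed
    finally show ?thesis by (simp add: C'_def algebra_simps)
  qed
  have \<rho>_int: "set_integrable lborel {1..} \<rho>"
    unfolding set_integrable_def
  proof (rule Bochner_Integration.integrable_bound)
    show "integrable lborel (\<lambda>t. C' * (indicator {1..} t *\<^sub>R t powr (- \<alpha>)))"
      using set_integrable_powr_atLeast_1[OF \<alpha>] unfolding set_integrable_def by (rule integrable_mult_right)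
    show "AE t in lborel. norm (indicator {1..} t *\<^sub>R \<rho> t) \<le> norm (C' * (indicator {1..} t *\<^sub>R t powr (- \<alpha>)))"
      using \<rho>_le by (intro AE_I2) (auto simp: indicator_def intro: order_trans[OF _ abs_ge_self])
  qed measurable
  have L\<rho>: "((\<lambda>T. LBINT t:{1..T}. \<rho> t) \<longlongrightarrow> (LBINT t:{1..}. \<rho> t)) at_top"
    by (rule tendsto_set_lebesgue_integral_at_top[OF _ \<rho>_int]) simp
  have LH: "(H \<longlongrightarrow> 0) at_top"
  proof (rule Lim_null_comparison)
    have "norm (H t) = t powr (1 - \<alpha>) / \<bar>x\<bar>" for t
      by (simp add: H_def norm_mult norm_divide)
    then show "\<forall>\<^sub>F t in at_top. norm (H t) \<le> t powr (1 - \<alpha>) / \<bar>x\<bar>" by simp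
    show "((\<lambda>t. t powr (1 - \<alpha>) / \<bar>x\<bar>) \<longlongrightarrow> 0) at_top"
      using \<alpha> by (intro tendsto_divide_zero) real_asymp
  qed
  have L1: "((\<lambda>T. (LBINT t:{0..1}. ?e t * \<phi> t) + ((LBINT t:{1..T}. \<rho> t) + k * (H T - H 1)))
    \<longlongrightarrow> (LBINT t:{0..1}. ?e t * \<phi> t) + ((LBINT t:{1..}. \<rho> t) + k * (0 - H 1))) at_top"
    by (rule tendsto_add[OF tendsto_const tendsto_add[OF L\<rho> tendsto_mult_left[OF tendsto_diff[OF LH tendsto_const]]]])
  have L2: "\<forall>\<^sub>F T in at_top. (LBINT t:{0..1}. ?e t * \<phi> t) + ((LBINT t:{1..T}. \<rho> t) + k * (H T - H 1))
      = (LBINT t:{0..T}. ?e t * \<phi> t)"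
    using eventually_gt_at_top[of 1]
  proof eventually_elim
    case (elim T)
    have hc: "continuous_on {1..T} h"
      unfolding h_def using x by (auto intro!: continuous_intros)
    have hi: "set_integrable lborel {1..T} h"
      unfolding set_integrable_def by (rule borel_integrable_compact) (auto intro!: hc)
    have "(LBINT t:{1..T}. h t) = H T - H 1"
    proof (rule set_integral_FTC[OF _ _ _ hi])
      show "continuous_on {1..T} H" unfolding H_def using x by (auto intro!: continuous_intros)
    qed (use elim H' in auto)
    then have kh: "(LBINT t:{1..T}. k * h t) = k * (H T - H 1)" by simp
    have "(LBINT t:{1..T}. ?e t * \<phi> t) = (LBINT t:{1..T}. \<rho> t + k * h t)"
      by (simp add: \<rho>_def)
    also have "\<dots> = (LBINT t:{1..T}. \<rho> t) + (LBINT t:{1..T}. k * h t)"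
      by (rule set_integral_add(2)) (use \<rho>_int hi in \<open>auto intro: set_integrable_subset\<close>)
    finally have b: "(LBINT t:{1..T}. ?e t * \<phi> t) = (LBINT t:{1..T}. \<rho> t) + k * (H T - H 1)"
      unfolding kh .
    have "(LBINT t:{0..1} \<union> {1..T}. ?e t * \<phi> t) = (LBINT t:{0..1}. ?e t * \<phi> t) + (LBINT t:{1..T}. ?e t * \<phi> t)"
    proof (rule set_integral_Un_AE)
      show "AE t in lborel. \<not> (t \<in> {0..1} \<and> t \<in> {1..T})"
        using AE_lborel_singleton[of 1] by eventually_elim auto
      show "set_integrable lborel {1..T} (\<lambda>t. ?e t * \<phi> t)"
        by (rule set_integrable_subset[OF loc[of T]]) auto
      show "set_integrable lborel {0..1} (\<lambda>t. ?e t * \<phi> t)" by (rule loc)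
    qed auto
    moreover have "{0..1} \<union> {1..T} = {0..T}" using elim by auto
    ultimately show ?case using b by simp
  qed
  show ?thesis by (rule that[OF Lim_transform_eventually[OF L1 L2]])
qed

text \<open>The exponent \<open>(\<i> t)^\<alpha>\<close> has negative real part of size \<open>t powr \<alpha>\<close> because \<open>\<alpha> * pi / 2\<close> lies
  between \<open>pi / 2\<close> and \<open>pi\<close>.  With \<open>a = 1 / \<alpha>\<close> the kernel error \<open>t * (t powr \<alpha>) powr (- 1 - a)\<close> is
  exactly \<open>t powr (- \<alpha>)\<close>.\<close>

lemma sup_charfun_asymptotics:
  assumes alpha: "1 < \<alpha>" "\<alpha> < 2"
  obtains k C where "\<And>t. 1 \<le> t \<Longrightarrow> norm (sup_charfun \<alpha> t - k * of_real (t powr (1 - \<alpha>))) \<le> C * t powr (- \<alpha>)"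
proof -
  let ?a = "1 / \<alpha>"
  have a: "0 < ?a" "?a < 1" using alpha by auto
  obtain C where C: "0 \<le> C"
    "\<And>\<Psi> q. 0 < q \<Longrightarrow> Re \<Psi> = - q \<Longrightarrow> norm (stable_kernel ?a \<Psi> + 1 / \<Psi>) \<le> C * q powr (- 1 - ?a) + exp (- q) / norm \<Psi>"
    using stable_kernel_asymptotics[OF a] by blast
  define c where "c = - cos (\<alpha> * pi / 2)"
  have c: "0 < c" unfolding c_def by (rule neg_cos_pos[OF alpha])
  define g where "g = 1 / Gamma ?a"
  have g: "0 < g" unfolding g_def using Gamma_real_pos[OF a(1)] by simp
  define k where "k = \<i> * of_real g / cis (\<alpha> * pi / 2)"
  define C' where "C' = 1 / c + g * (C * c powr (- 1 - ?a) + 1 / c)"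
  have "norm (sup_charfun \<alpha> t - k * of_real (t powr (1 - \<alpha>))) \<le> C' * t powr (- \<alpha>)" if t: "1 \<le> t" for t
  proof -
    let ?\<Psi> = "stable_exponent \<alpha> t"
    let ?q = "t powr \<alpha> * c"
    have q: "0 < ?q" using t c by simp
    have R: "Re ?\<Psi> = - ?q" unfolding stable_exponent_Re c_def ..
    have \<Psi>0: "?\<Psi> \<noteq> 0" using R q by auto
    have eq: "exp (- ?q) \<le> t powr (- \<alpha>) / c"
    proof -
      have "?q * exp (- ?q) \<le> 1"
      proof -
        have "?q \<le> exp ?q" using exp_ge_add_one_self[of ?q] by linarith
        then have "?q * exp (- ?q) \<le> exp ?q * exp (- ?q)" by (rule mult_right_mono) simp
        then show ?thesis by (simp add: exp_add[symmetric])
      qed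
      then show ?thesis using q t c by (simp add: powr_minus field_simps)
    qed
    have "k * of_real (t powr (1 - \<alpha>)) = \<i> * of_real t * of_real g * (1 / ?\<Psi>)"
      using t by (simp add: k_def stable_exponent_def powr_diff mult_ac)
    then have "sup_charfun \<alpha> t - k * of_real (t powr (1 - \<alpha>))
      = exp ?\<Psi> - \<i> * of_real t * of_real g * (stable_kernel ?a ?\<Psi> + 1 / ?\<Psi>)"
      unfolding sup_charfun_def g_def[symmetric] by (simp add: algebra_simps)
    then have "norm (sup_charfun \<alpha> t - k * of_real (t powr (1 - \<alpha>)))
      \<le> norm (exp ?\<Psi>) + norm (\<i> * of_real t * of_real g * (stable_kernel ?a ?\<Psi> + 1 / ?\<Psi>))"
      by (simp only: norm_triangle_ineq4)
    also have "norm (exp ?\<Psi>) \<le> t powr (- \<alpha>) / c" using eq R by simp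
    also have "norm (\<i> * of_real t * of_real g * (stable_kernel ?a ?\<Psi> + 1 / ?\<Psi>))
      = t * g * norm (stable_kernel ?a ?\<Psi> + 1 / ?\<Psi>)"
      using t g by (simp add: norm_mult)
    also have "\<dots> \<le> t * g * (C * ?q powr (- 1 - ?a) + exp (- ?q) / norm ?\<Psi>)"
      using t g by (intro mult_left_mono C(2)[OF q R]) auto
    also have "?q powr (- 1 - ?a) = c powr (- 1 - ?a) * t powr (- \<alpha>) / t"
    proof -
      have "\<alpha> * (- 1 - ?a) = - \<alpha> - 1" using alpha by (simp add: field_simps)
      then have "(t powr \<alpha>) powr (- 1 - ?a) = t powr (- \<alpha> - 1)" by (simp only: powr_powr)
      also have "\<dots> = t powr (- \<alpha>) / t" using t powr_diff[of t "- \<alpha>" 1] by simp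
      finally have "(t powr \<alpha>) powr (- 1 - ?a) = t powr (- \<alpha>) / t" .
      moreover have "?q powr (- 1 - ?a) = (t powr \<alpha>) powr (- 1 - ?a) * c powr (- 1 - ?a)"
        by (rule powr_mult)
      ultimately show ?thesis by (simp only: mult.commute[of "c powr _"] times_divide_eq_left)
    qed
    also have "exp (- ?q) / norm ?\<Psi> \<le> (t powr (- \<alpha>) / c) / t"
      unfolding norm_stable_exponent
    proof (rule frac_le[OF _ eq])
      have "t powr 1 \<le> t powr \<alpha>" using t alpha by (intro powr_mono) auto
      then show "t \<le> t powr \<alpha>" using t by simp
    qed (use t c in auto)
    finally have "norm (sup_charfun \<alpha> t - k * of_real (t powr (1 - \<alpha>)))
      \<le> t powr (- \<alpha>) / c + t * g * (C * (c powr (- 1 - ?a) * t powr (- \<alpha>) / t) + (t powr (- \<alpha>) / c) / t)"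
      using t g by (simp add: mult_left_mono)
    also have "\<dots> = C' * t powr (- \<alpha>)"
      using t c unfolding C'_def by (simp add: field_simps)
    finally show ?thesis .
  qed
  with that show ?thesis by blast
qed

section \<open>Abel summation of the inversion integral\<close>

lemma set_integrable_exp_Ici:
  assumes "0 < (e::real)"
  shows "set_integrable lborel {0..} (\<lambda>t. exp (- (e * t)))"
proof -
  have "set_integrable lborel {0<..} (\<lambda>t. exp (- (t * e)))" by (rule integrable_I0i_exp_mscale[OF assms])
  then show ?thesis
    unfolding set_integrable_def
    by (rule integrable_discrete_difference[where X="{0}", THEN iffD1, rotated -1])
       (auto simp: indicator_def mult.commute)
qed

lemma set_integral_exp_Ici:
  assumes e: "0 < (e::real)"
  shows "(LBINT t:{0..}. exp (- (e * t))) = 1 / e"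
proof -
  have "(LBINT t:{0..}. exp (- (e * t))) = 0 - (- exp (- (e * 0)) / e)"
  proof (rule set_integral_FTC_atLeast)
    show "((\<lambda>t. - exp (- (e * t)) / e) \<longlongrightarrow> 0) at_top" using e by real_asymp
    show "set_integrable lborel {0..} (\<lambda>t. exp (- (e * t)))" by (rule set_integrable_exp_Ici[OF e])
    show "((\<lambda>t. - exp (- (e * t)) / e) has_vector_derivative exp (- (e * t))) (at t)" for t
      using e by (auto intro!: derivative_eq_intros simp: has_real_derivative_iff_has_vector_derivative[symmetric])
  qed (use e in \<open>auto intro!: continuous_intros\<close>)
  then show ?thesis by simp
qed

lemma laplace_of_cos:
  assumes e: "0 < (e::real)"
  shows "(LBINT t:{0..}. exp (- (e * t)) * cos (t * u)) = e / (e\<^sup>2 + u\<^sup>2)"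
proof -
  let ?F = "\<lambda>t. exp (- (e * t)) * (u * sin (t * u) - e * cos (t * u)) / (e\<^sup>2 + u\<^sup>2)"
  have p: "0 < e\<^sup>2 + u\<^sup>2" using e by (simp add: add_pos_nonneg)
  have i: "set_integrable lborel {0..} (\<lambda>t. exp (- (e * t)) * cos (t * u))"
    unfolding set_integrable_def
  proof (rule Bochner_Integration.integrable_bound)
    show "integrable lborel (\<lambda>t. indicator {0..} t *\<^sub>R exp (- (e * t)))"
      using set_integrable_exp_Ici[OF e] unfolding set_integrable_def .
  qed (auto simp: indicator_def abs_mult mult_left_le)
  have "(LBINT t:{0..}. exp (- (e * t)) * cos (t * u)) = 0 - ?F 0"
  proof (rule set_integral_FTC_atLeast[OF _ _ i])
    show "(?F \<longlongrightarrow> 0) at_top"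
    proof (rule Lim_null_comparison)
      have "norm (?F t) \<le> exp (- (e * t)) * ((\<bar>u\<bar> + e) / (e\<^sup>2 + u\<^sup>2))" for t
      proof -
        have "\<bar>u * sin (t * u) - e * cos (t * u)\<bar> \<le> \<bar>u * sin (t * u)\<bar> + \<bar>e * cos (t * u)\<bar>" by linarith
        also have "\<dots> \<le> \<bar>u\<bar> + e"
          using e by (intro add_mono) (auto simp: abs_mult mult_left_le)
        finally show ?thesis using p by (simp add: abs_mult divide_right_mono)
      qed
      then show "\<forall>\<^sub>F t in at_top. norm (?F t) \<le> exp (- (e * t)) * ((\<bar>u\<bar> + e) / (e\<^sup>2 + u\<^sup>2))" by simp
      have "((\<lambda>t. exp (- (e * t))) \<longlongrightarrow> 0) at_top" using e by real_asymp
      then show "((\<lambda>t. exp (- (e * t)) * ((\<bar>u\<bar> + e) / (e\<^sup>2 + u\<^sup>2))) \<longlongrightarrow> 0) at_top"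
        by (rule tendsto_mult_left_zero)
    qed
    fix t :: real
    have "((\<lambda>t. exp (- (e * t)) * (u * sin (t * u) - e * cos (t * u))) has_real_derivative
       (e\<^sup>2 + u\<^sup>2) * (exp (- (e * t)) * cos (t * u))) (at t)"
      by (auto intro!: derivative_eq_intros simp: algebra_simps power2_eq_square)
    from DERIV_cdivide[OF this, of "e\<^sup>2 + u\<^sup>2"]
    show "(?F has_vector_derivative exp (- (e * t)) * cos (t * u)) (at t)"
      using p e by (simp add: has_real_derivative_iff_has_vector_derivative)
  qed (use p in \<open>auto intro!: continuous_intros\<close>)
  then show ?thesis by (simp add: power2_eq_square)
qed

text \<open>Integrating by parts, the damped integral is the average of the partial integrals \<open>G\<close> at the points
  \<open>v / \<epsilon>\<close> with respect to the exponential law, \<open>\<epsilon> = 1 / (n + 1)\<close>; dominated convergence applies since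
  \<open>G\<close> is bounded.\<close>

lemma abel_limit:
  fixes g :: "real \<Rightarrow> real"
  assumes cont: "continuous_on {0..} g" and bnd: "\<And>t. 0 \<le> t \<Longrightarrow> \<bar>g t\<bar> \<le> 1"
    and g_meas [measurable]: "g \<in> borel_measurable borel"
    and lim: "((\<lambda>T. LBINT t:{0..T}. g t) \<longlongrightarrow> L) at_top"
  shows "(\<lambda>n. LBINT t:{0..}. exp (- (1 / real (Suc n) * t)) * g t) \<longlonglongrightarrow> L"
proof -
  define G where "G T = integral {0..T} g" for T
  have ig: "set_integrable lborel {0..T} g" for T
    unfolding set_integrable_def
    by (rule borel_integrable_compact) (auto intro: continuous_on_subset[OF cont])
  have G_eq: "G T = (LBINT t:{0..T}. g t)" for T
    unfolding G_def using set_borel_integral_eq_integral(2)[OF ig] by simp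
  have G0: "G 0 = 0" by (simp add: G_def)
  have G_der: "(G has_vector_derivative g t) (at t)" if "0 < t" for t
  proof -
    have "(G has_vector_derivative g t) (at t within {0..t + 1})"
      unfolding G_def by (rule integral_has_vector_derivative)
        (use that in \<open>auto intro: continuous_on_subset[OF cont]\<close>)
    then show ?thesis using that by (subst (asm) at_within_interior) auto
  qed
  have G_cont: "continuous_on {0..} G"
  proof -
    have cT: "continuous_on {0..T} G" for T
      unfolding G_def by (rule indefinite_integral_continuous_1)
        (auto intro!: integrable_continuous_interval continuous_on_subset[OF cont])
    have "isCont G t" if "0 < t" for t
      using G_der[OF that] by (rule has_vector_derivative_continuous)
    moreover have "continuous (at 0 within {0..}) G"
    proof -
      have "continuous (at 0 within {0..1}) G"
        using cT[of 1] by (simp add: continuous_on_eq_continuous_within)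
      moreover have "at 0 within {0..1} = at (0::real) within {0..}"
        by (rule at_within_nhd[of _ "{-1<..<1}"]) auto
      ultimately show ?thesis by simp
    qed
    ultimately show ?thesis
      unfolding continuous_on_eq_continuous_within
      by (metis atLeast_iff continuous_at_imp_continuous_at_within le_less)
  qed
  have Gneg: "G t = 0" if "t < 0" for t using that by (simp add: G_def)
  have G_meas [measurable]: "G \<in> borel_measurable borel"
  proof -
    have "(\<lambda>t. indicator {0..} t *\<^sub>R G t) \<in> borel_measurable borel"
      by (rule borel_measurable_continuous_on_indicator[OF _ G_cont]) simp
    also have "(\<lambda>t. indicator {0..} t *\<^sub>R G t) = G"
      using Gneg by (auto simp: fun_eq_iff indicator_def)
    finally show ?thesis .
  qed
  have limG: "(G \<longlongrightarrow> L) at_top" using lim by (simp add: G_eq[symmetric])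
  obtain B where B: "0 \<le> B" "\<And>t. 0 \<le> t \<Longrightarrow> \<bar>G t\<bar> \<le> B"
  proof -
    have "\<forall>\<^sub>F t in at_top. \<bar>G t\<bar> < \<bar>L\<bar> + 1"
      using tendsto_rabs[OF limG] by (rule order_tendstoD) simp
    then obtain N where N: "\<And>t. N \<le> t \<Longrightarrow> \<bar>G t\<bar> < \<bar>L\<bar> + 1"
      by (auto simp: eventually_at_top_linorder)
    have "compact (G ` {0..max 0 N})"
      by (rule compact_continuous_image[OF continuous_on_subset[OF G_cont]]) auto
    then obtain B where B: "\<And>t. t \<in> {0..max 0 N} \<Longrightarrow> \<bar>G t\<bar> \<le> B"
      using compact_imp_bounded bounded_real by (metis image_eqI)
    show ?thesis
    proof (rule that)
      show "0 \<le> max B (\<bar>L\<bar> + 1)" by simp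
      fix t :: real assume "0 \<le> t"
      then show "\<bar>G t\<bar> \<le> max B (\<bar>L\<bar> + 1)"
        using B[of t] N[of t] by (cases "t \<le> N") (auto simp: max_def intro: order_trans less_imp_le)
    qed
  qed
  have parts: "(LBINT t:{0..}. exp (- (e * t)) * g t) = (LBINT v:{0..}. exp (- v) * G (v / e))" if e: "0 < e" for e
  proof -
    have bi: "set_integrable lborel {0..} (\<lambda>t. exp (- (e * t)) * h t)"
      if "h \<in> borel_measurable borel" "\<And>t. 0 \<le> t \<Longrightarrow> \<bar>h t\<bar> \<le> K" for h K
      unfolding set_integrable_def
    proof (rule Bochner_Integration.integrable_bound)
      show "integrable lborel (\<lambda>t. K * (indicator {0..} t *\<^sub>R exp (- (e * t))))"
        using set_integrable_exp_Ici[OF e] unfolding set_integrable_def by (rule integrable_mult_right)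
      show "AE t in lborel. norm (indicator {0..} t *\<^sub>R (exp (- (e * t)) * h t))
         \<le> norm (K * (indicator {0..} t *\<^sub>R exp (- (e * t))))"
        using that(2) by (intro AE_I2) (auto simp: indicator_def abs_mult mult.commute intro: order_trans[OF _ abs_ge_self])
    qed (use that(1) in measurable)
    have i1: "set_integrable lborel {0..} (\<lambda>t. exp (- (e * t)) * g t)"
      by (rule bi[OF g_meas bnd])
    have i2: "set_integrable lborel {0..} (\<lambda>t. e * (exp (- (e * t)) * G t))"
      by (rule set_integrable_mult_right[OF bi[OF G_meas B(2)]])
    have "(LBINT t:{0..}. exp (- (e * t)) * g t - e * (exp (- (e * t)) * G t)) = 0 - exp (- (e * 0)) * G 0"
    proof (rule set_integral_FTC_atLeast)
      show "continuous_on {0..} (\<lambda>t. exp (- (e * t)) * G t)" by (intro continuous_intros G_cont)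
      show "set_integrable lborel {0..} (\<lambda>t. exp (- (e * t)) * g t - e * (exp (- (e * t)) * G t))"
        by (rule set_integral_diff(1)[OF i1 i2])
      have "((\<lambda>t. exp (- (e * t))) \<longlongrightarrow> 0) at_top" using e by real_asymp
      from tendsto_mult[OF this limG] show "((\<lambda>t. exp (- (e * t)) * G t) \<longlongrightarrow> 0) at_top" by simp
      fix t :: real assume "0 < t"
      have "((\<lambda>t. exp (- (e * t))) has_vector_derivative - e * exp (- (e * t))) (at t)"
        by (auto intro!: derivative_eq_intros simp: has_real_derivative_iff_has_vector_derivative[symmetric])
      from has_vector_derivative_mult[OF this G_der[OF \<open>0 < t\<close>]]
      show "((\<lambda>t. exp (- (e * t)) * G t) has_vector_derivative exp (- (e * t)) * g t - e * (exp (- (e * t)) * G t)) (at t)"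
        by (simp add: algebra_simps)
    qed
    then have "(LBINT t:{0..}. exp (- (e * t)) * g t) = (LBINT t:{0..}. e * (exp (- (e * t)) * G t))"
      using set_integral_diff(2)[OF i1 i2] G0 by simp
    also have "\<dots> = e * (LBINT t. indicator {0..} t *\<^sub>R (exp (- (e * t)) * G t))"
      by (simp add: set_lebesgue_integral_def)
    also have "(LBINT t. indicator {0..} t *\<^sub>R (exp (- (e * t)) * G t))
      = \<bar>1 / e\<bar> *\<^sub>R (LBINT v. indicator {0..} (0 + 1 / e * v) *\<^sub>R (exp (- (e * (0 + 1 / e * v))) * G (0 + 1 / e * v)))"
      by (rule lborel_integral_real_affine) (use e in simp)
    also have "(\<lambda>v. indicator {0..} (0 + 1 / e * v) *\<^sub>R (exp (- (e * (0 + 1 / e * v))) * G (0 + 1 / e * v)))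
      = (\<lambda>v. indicator {0..} v *\<^sub>R (exp (- v) * G (v / e)))"
      using e by (auto simp: fun_eq_iff indicator_def zero_le_divide_iff)
    finally show ?thesis using e by (simp add: set_lebesgue_integral_def)
  qed
  have "(\<lambda>n. LBINT v. indicator {0..} v *\<^sub>R (exp (- v) * G (v / (1 / real (Suc n)))))
    \<longlonglongrightarrow> (LBINT v. indicator {0..} v *\<^sub>R (exp (- v) * L))"
  proof (rule integral_dominated_convergence)
    show "integrable lborel (\<lambda>v. B * (indicator {0..} v *\<^sub>R exp (- (1 * v))))"
      using set_integrable_exp_Ici[of 1] unfolding set_integrable_def by (intro integrable_mult_right) simp
    show "AE v in lborel. (\<lambda>n. indicator {0..} v *\<^sub>R (exp (- v) * G (v / (1 / real (Suc n)))))
       \<longlonglongrightarrow> indicator {0..} v *\<^sub>R (exp (- v) * L)"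
      using AE_lborel_singleton[of 0]
    proof eventually_elim
      case (elim v)
      show ?case
      proof (cases "0 \<le> v")
        case True
        with elim have v: "0 < v" by simp
        have "filterlim (\<lambda>n. v / (1 / real (Suc n))) at_top sequentially" using v by real_asymp
        from filterlim_compose[OF limG this]
        show ?thesis by (intro tendsto_scaleR tendsto_mult tendsto_const)
      qed simp
    qed
    show "AE v in lborel. norm (indicator {0..} v *\<^sub>R (exp (- v) * G (v / (1 / real (Suc n)))))
      \<le> B * (indicator {0..} v *\<^sub>R exp (- (1 * v)))" for n
    proof (rule AE_I2)
      fix v :: real
      have "\<bar>G (v / (1 / real (Suc n)))\<bar> \<le> B" if "0 \<le> v" using that by (intro B(2)) simp
      then show "norm (indicator {0..} v *\<^sub>R (exp (- v) * G (v / (1 / real (Suc n)))))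
        \<le> B * (indicator {0..} v *\<^sub>R exp (- (1 * v)))"
        by (auto simp: indicator_def abs_mult)
    qed
  qed measurable
  moreover have "(LBINT v. indicator {0..} v *\<^sub>R (exp (- v) * L)) = L"
  proof -
    have "(LBINT v:{0..}. exp (- (1 * v)) * L) = L"
      unfolding set_integral_mult_left using set_integral_exp_Ici[of 1] by simp
    then show ?thesis unfolding set_lebesgue_integral_def mult_1_left .
  qed
  moreover have "(LBINT t:{0..}. exp (- (1 / real (Suc n) * t)) * g t)
    = (LBINT v. indicator {0..} v *\<^sub>R (exp (- v) * G (v / (1 / real (Suc n)))))" for n
    by (subst parts) (simp_all only: set_lebesgue_integral_def, simp)
  ultimately show ?thesis by (simp only:)
qed

section \<open>Fourier inversion at a continuity point of the density\<close>

lemma (in prob_space) poisson_smoothing: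
  fixes Y :: "'a \<Rightarrow> real"
  assumes Y [measurable]: "Y \<in> borel_measurable M" and e: "0 < e"
  shows "(LBINT t:{0..}. exp (- (e * t)) * (\<integral>\<omega>. cos (t * (x - Y \<omega>)) \<partial>M))
    = (\<integral>\<omega>. e / (e\<^sup>2 + (x - Y \<omega>)\<^sup>2) \<partial>M)"
proof -
  interpret P: pair_sigma_finite lborel M
    by (simp add: pair_sigma_finite_def sigma_finite_measure_axioms lborel.sigma_finite_measure_axioms)
  let ?f = "\<lambda>t \<omega>. indicator {0..} t *\<^sub>R (exp (- (e * t)) * cos (t * (x - Y \<omega>)))"
  let ?b = "\<lambda>t. indicator {0..} t *\<^sub>R exp (- (e * t))"
  have b: "integrable lborel ?b"
    using set_integrable_exp_Ici[OF e] unfolding set_integrable_def .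
  have f_le: "norm (?f t \<omega>) \<le> ?b t" for t \<omega>
    by (auto simp: indicator_def abs_mult mult_left_le)
  have fM: "integrable M (?f t)" for t
    by (rule integrable_const_bound[where B="?b t"]) (use f_le in auto)
  have int: "integrable (lborel \<Otimes>\<^sub>M M) (case_prod ?f)"
  proof (rule P.Fubini_integrable)
    show "integrable lborel (\<lambda>t. \<integral>\<omega>. norm (case_prod ?f (t, \<omega>)) \<partial>M)"
    proof (rule Bochner_Integration.integrable_bound[OF b])
      show "AE t in lborel. norm (\<integral>\<omega>. norm (case_prod ?f (t, \<omega>)) \<partial>M) \<le> norm (?b t)"
      proof (rule AE_I2)
        fix t
        have "(\<integral>\<omega>. norm (?f t \<omega>) \<partial>M) \<le> (\<integral>\<omega>. ?b t \<partial>M)"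
          using f_le by (intro integral_mono integrable_norm[OF fM]) auto
        then have "(\<integral>\<omega>. norm (?f t \<omega>) \<partial>M) \<le> ?b t" by (simp add: prob_space)
        moreover have "0 \<le> (\<integral>\<omega>. norm (?f t \<omega>) \<partial>M)" by (intro integral_nonneg_AE) auto
        ultimately show "norm (\<integral>\<omega>. norm (case_prod ?f (t, \<omega>)) \<partial>M) \<le> norm (?b t)"
          unfolding case_prod_conv real_norm_def by linarith
      qed
    qed measurable
    show "AE t in lborel. integrable M (\<lambda>\<omega>. case_prod ?f (t, \<omega>))" using fM by simp
  qed measurable
  have "(LBINT t:{0..}. exp (- (e * t)) * (\<integral>\<omega>. cos (t * (x - Y \<omega>)) \<partial>M)) = (LBINT t. \<integral>\<omega>. ?f t \<omega> \<partial>M)"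
    by (simp add: set_lebesgue_integral_def)
  also have "\<dots> = (\<integral>\<omega>. (LBINT t. ?f t \<omega>) \<partial>M)"
    by (rule P.Fubini_integral[OF int, symmetric])
  also have "(\<lambda>\<omega>. LBINT t. ?f t \<omega>) = (\<lambda>\<omega>. e / (e\<^sup>2 + (x - Y \<omega>)\<^sup>2))"
    using laplace_of_cos[OF e] by (simp add: set_lebesgue_integral_def)
  finally show ?thesis .
qed

text \<open>The hypothesis describes the law of \<open>Y\<close> on subsets of the positive half-line only, so both measures
  are cut down to \<open>A\<close> before they are compared.\<close>

lemma (in prob_space) integral_local_density:
  fixes Y :: "'a \<Rightarrow> real" and h :: "real \<Rightarrow> real"
  assumes d: "continuous_density_on_pos M Y f" and A: "A \<in> sets borel" "A \<subseteq> {0<..}"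
    and h [measurable]: "h \<in> borel_measurable borel"
  shows "(\<integral>\<omega>. indicator A (Y \<omega>) * h (Y \<omega>) \<partial>M) = (LBINT y. (indicator A y * f y) * h y)"
proof -
  have Y [measurable]: "Y \<in> borel_measurable M" using d by (simp add: continuous_density_on_pos_def)
  have [measurable]: "A \<in> sets borel" by (rule A)
  have fm [measurable]: "(\<lambda>y. indicator A y * f y) \<in> borel_measurable borel"
  proof -
    have "continuous_on {0<..} f" using d by (simp add: continuous_density_on_pos_def)
    from borel_measurable_continuous_on_indicator[OF _ this]
    have [measurable]: "(\<lambda>y. indicator {0<..} y *\<^sub>R f y) \<in> borel_measurable borel" by simp
    have "(\<lambda>y. indicator A y * (indicator {0<..} y *\<^sub>R f y)) \<in> borel_measurable borel" by measurable
    also have "(\<lambda>y. indicator A y * (indicator {0<..} y *\<^sub>R f y)) = (\<lambda>y. indicator A y * f y)"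
      using A(2) by (auto simp: fun_eq_iff indicator_def)
    finally show ?thesis .
  qed
  have f0: "0 \<le> indicator A y * f y" for y
    using d A(2) by (auto simp: continuous_density_on_pos_def indicator_def)
  let ?N = "distr M borel Y"
  have "density ?N (\<lambda>y. ennreal (indicator A y)) = density lborel (\<lambda>y. ennreal (indicator A y * f y))"
  proof (rule measure_eqI)
    fix B assume "B \<in> sets (density ?N (\<lambda>y. ennreal (indicator A y)))"
    then have B [measurable]: "B \<in> sets borel" by simp
    have "emeasure (density ?N (\<lambda>y. ennreal (indicator A y))) B = (\<integral>\<^sup>+y. ennreal (indicator A y) * indicator B y \<partial>?N)"
      by (rule emeasure_density) auto
    also have "\<dots> = (\<integral>\<^sup>+y. indicator (A \<inter> B) y \<partial>?N)"
      by (intro nn_integral_cong) (auto simp: indicator_def)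
    also have "\<dots> = emeasure ?N (A \<inter> B)" by simp
    also have "\<dots> = (\<integral>\<^sup>+y\<in>A \<inter> B. ennreal (f y) \<partial>lborel)"
    proof -
      have "A \<inter> B \<in> sets borel" "A \<inter> B \<subseteq> {0<..}" using A by auto
      then show ?thesis using d unfolding continuous_density_on_pos_def by blast
    qed
    also have "\<dots> = (\<integral>\<^sup>+y. ennreal (indicator A y * f y) * indicator B y \<partial>lborel)"
      by (intro nn_integral_cong) (auto simp: indicator_def)
    also have "\<dots> = emeasure (density lborel (\<lambda>y. ennreal (indicator A y * f y))) B"
      by (rule emeasure_density[symmetric]) auto
    finally show "emeasure (density ?N (\<lambda>y. ennreal (indicator A y))) B
      = emeasure (density lborel (\<lambda>y. ennreal (indicator A y * f y))) B" .
  qed simp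
  then have "integral\<^sup>L (density ?N (\<lambda>y. ennreal (indicator A y))) h
    = integral\<^sup>L (density lborel (\<lambda>y. ennreal (indicator A y * f y))) h" by simp
  moreover have "integral\<^sup>L (density ?N (\<lambda>y. ennreal (indicator A y))) h = (\<integral>y. indicator A y *\<^sub>R h y \<partial>?N)"
    by (rule integral_density) auto
  moreover have "(\<integral>y. indicator A y *\<^sub>R h y \<partial>?N) = (\<integral>\<omega>. indicator A (Y \<omega>) * h (Y \<omega>) \<partial>M)"
    by (subst integral_distr) auto
  moreover have "integral\<^sup>L (density lborel (\<lambda>y. ennreal (indicator A y * f y))) h
    = (LBINT y. (indicator A y * f y) *\<^sub>R h y)"
    by (rule integral_density) (use f0 in auto)
  ultimately show ?thesis by simp
qed

lemma cauchy_integral: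
  shows "integrable lborel (\<lambda>u::real. 1 / (1 + u\<^sup>2))" "(LBINT u. 1 / (1 + u\<^sup>2 :: real)) = pi"
proof -
  have e: "einterval (- \<infinity>) \<infinity> = UNIV" by (auto simp: einterval_def)
  show "integrable lborel (\<lambda>u::real. 1 / (1 + u\<^sup>2))"
    using integrable_inverse_1_plus_square unfolding e set_integrable_def by (simp add: inverse_eq_divide)
  show "(LBINT u. 1 / (1 + u\<^sup>2 :: real)) = pi"
    using LBINT_inverse_1_plus_square
    by (simp add: interval_lebesgue_integral_def e set_lebesgue_integral_def inverse_eq_divide)
qed

text \<open>The Poisson kernel is an approximate identity.  Near \<open>x\<close> the law has the continuous density \<open>f\<close>, and
  the substitution \<open>y = x + \<epsilon> u\<close> turns the integral into one against the Cauchy density; away from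
  \<open>x\<close>, where the law is arbitrary and may have an atom at \<open>0\<close>, the kernel is of order \<open>\<epsilon>\<close>.\<close>

lemma (in prob_space) poisson_kernel_limit:
  fixes Y :: "'a \<Rightarrow> real"
  assumes d: "continuous_density_on_pos M Y f" and x: "0 < x"
  shows "(\<lambda>n. \<integral>\<omega>. (1 / real (Suc n)) / ((1 / real (Suc n))\<^sup>2 + (x - Y \<omega>)\<^sup>2) \<partial>M) \<longlonglongrightarrow> pi * f x"
proof -
  have Y [measurable]: "Y \<in> borel_measurable M" using d by (simp add: continuous_density_on_pos_def)
  have fc: "continuous_on {0<..} f" using d by (simp add: continuous_density_on_pos_def)
  define e where "e n = 1 / real (Suc n)" for n
  have e: "0 < e n" for n by (simp add: e_def)
  have e0: "e \<longlonglongrightarrow> 0" unfolding e_def by real_asymp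
  define p where "p n y = e n / ((e n)\<^sup>2 + (x - y)\<^sup>2)" for n y
  have [measurable]: "p n \<in> borel_measurable borel" for n unfolding p_def by measurable
  have p0: "0 \<le> p n y" for n y using e[of n] by (simp add: p_def)
  have p_le: "p n y \<le> 1 / e n" for n y
  proof -
    have "p n y \<le> e n / (e n)\<^sup>2"
      unfolding p_def using e[of n] by (intro divide_left_mono) (auto simp: add_pos_nonneg)
    then show ?thesis using e[of n] by (simp add: power2_eq_square)
  qed
  \<comment> \<open>A neighbourhood of \<open>x\<close> with closure in the positive half-line, so that \<open>f\<close> is bounded on it.\<close>
  define A where "A = {x / 2<..<3 * x / 2}"
  have A: "A \<in> sets borel" "A \<subseteq> {0<..}" using x by (auto simp: A_def)
  note [measurable] = A(1)
  have far: "p n y \<le> e n / (x / 2)\<^sup>2" if "y \<notin> A" for n y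
  proof -
    have "(x / 2)\<^sup>2 \<le> (x - y)\<^sup>2"
      using that x by (intro abs_le_square_iff[THEN iffD1]) (auto simp: A_def)
    then show ?thesis
      unfolding p_def using e[of n] x by (intro divide_left_mono) (auto simp: add_pos_nonneg intro: add_increasing)
  qed
  obtain K where K: "\<And>y. y \<in> A \<Longrightarrow> \<bar>f y\<bar> \<le> K"
  proof -
    have "compact (f ` {x / 2..3 * x / 2})"
      by (rule compact_continuous_image[OF continuous_on_subset[OF fc]]) (use x in auto)
    then obtain K where "\<And>y. y \<in> {x / 2..3 * x / 2} \<Longrightarrow> \<bar>f y\<bar> \<le> K"
      using compact_imp_bounded bounded_real by (metis image_eqI)
    with that show ?thesis by (force simp: A_def)
  qed
  have K0: "0 \<le> K" using K[of x] x by (force simp: A_def)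
  have fm [measurable]: "(\<lambda>y. indicator A y * f y) \<in> borel_measurable borel"
  proof -
    have "(\<lambda>y. indicator A y *\<^sub>R f y) \<in> borel_measurable borel"
      by (rule borel_measurable_continuous_on_indicator[OF A(1) continuous_on_subset[OF fc A(2)]])
    then show ?thesis by simp
  qed
  have near: "(\<integral>\<omega>. indicator A (Y \<omega>) * p n (Y \<omega>) \<partial>M)
    = (LBINT u. (indicator A (x + e n * u) * f (x + e n * u)) * (1 / (1 + u\<^sup>2)))" for n
  proof -
    have "(\<integral>\<omega>. indicator A (Y \<omega>) * p n (Y \<omega>) \<partial>M) = (LBINT y. (indicator A y * f y) * p n y)"
      by (rule integral_local_density[OF d A]) measurable
    also have "\<dots> = \<bar>e n\<bar> *\<^sub>R (LBINT u. (indicator A (x + e n * u) * f (x + e n * u)) * p n (x + e n * u))"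
      by (rule lborel_integral_real_affine) (use e[of n] in simp)
    also have "\<dots> = (LBINT u. e n * ((indicator A (x + e n * u) * f (x + e n * u)) * p n (x + e n * u)))"
      using e[of n] by simp
    also have "(\<lambda>u. e n * ((indicator A (x + e n * u) * f (x + e n * u)) * p n (x + e n * u)))
      = (\<lambda>u. (indicator A (x + e n * u) * f (x + e n * u)) * (1 / (1 + u\<^sup>2)))"
    proof
      fix u
      have "e n * p n (x + e n * u) = (e n)\<^sup>2 / ((e n)\<^sup>2 * (1 + u\<^sup>2))"
        by (simp add: p_def power_mult_distrib distrib_left power2_eq_square)
      also have "\<dots> = 1 / (1 + u\<^sup>2)" using e[of n] by simp
      finally show "e n * ((indicator A (x + e n * u) * f (x + e n * u)) * p n (x + e n * u))
        = (indicator A (x + e n * u) * f (x + e n * u)) * (1 / (1 + u\<^sup>2))"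
        by (metis mult.left_commute)
    qed
    finally show ?thesis .
  qed
  have "(\<lambda>n. LBINT u. (indicator A (x + e n * u) * f (x + e n * u)) * (1 / (1 + u\<^sup>2)))
    \<longlonglongrightarrow> (LBINT u. f x * (1 / (1 + u\<^sup>2)))"
  proof (rule integral_dominated_convergence)
    show "integrable lborel (\<lambda>u. K * (1 / (1 + u\<^sup>2)))"
      by (rule integrable_mult_right[OF cauchy_integral(1)])
    show "AE u in lborel. (\<lambda>n. (indicator A (x + e n * u) * f (x + e n * u)) * (1 / (1 + u\<^sup>2)))
      \<longlonglongrightarrow> f x * (1 / (1 + u\<^sup>2))"
    proof (rule AE_I2)
      fix u :: real
      have l: "(\<lambda>n. x + e n * u) \<longlonglongrightarrow> x"
        using tendsto_add[OF tendsto_const tendsto_mult_right[OF e0, of u], of x] by simp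
      have "isCont f x" using fc x by (simp add: continuous_on_eq_continuous_at)
      from isCont_tendsto_compose[OF this l] have "(\<lambda>n. f (x + e n * u)) \<longlonglongrightarrow> f x" .
      moreover have "\<forall>\<^sub>F n in sequentially. x + e n * u \<in> A"
        using topological_tendstoD[OF l, of A] x by (auto simp: A_def)
      then have "\<forall>\<^sub>F n in sequentially. f (x + e n * u) = indicator A (x + e n * u) * f (x + e n * u)"
        by eventually_elim simp
      ultimately have "(\<lambda>n. indicator A (x + e n * u) * f (x + e n * u)) \<longlonglongrightarrow> f x"
        by (rule Lim_transform_eventually)
      then show "(\<lambda>n. (indicator A (x + e n * u) * f (x + e n * u)) * (1 / (1 + u\<^sup>2))) \<longlonglongrightarrow> f x * (1 / (1 + u\<^sup>2))"
        by (rule tendsto_mult_right)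
    qed
    show "AE u in lborel. norm ((indicator A (x + e n * u) * f (x + e n * u)) * (1 / (1 + u\<^sup>2))) \<le> K * (1 / (1 + u\<^sup>2))" for n
    proof (rule AE_I2)
      fix u :: real
      have "norm (indicator A (x + e n * u) * f (x + e n * u)) \<le> K"
        using K[of "x + e n * u"] K0 by (auto simp: indicator_def)
      moreover have "(0::real) \<le> 1 / (1 + u\<^sup>2)" by simp
      ultimately have "norm (indicator A (x + e n * u) * f (x + e n * u)) * (1 / (1 + u\<^sup>2)) \<le> K * (1 / (1 + u\<^sup>2))"
        by (rule mult_right_mono)
      then show "norm ((indicator A (x + e n * u) * f (x + e n * u)) * (1 / (1 + u\<^sup>2))) \<le> K * (1 / (1 + u\<^sup>2))"
        by (simp add: abs_mult)
    qed
    have "(\<lambda>u. (\<lambda>y. indicator A y * f y) (x + e n * u) * (1 / (1 + u\<^sup>2))) \<in> borel_measurable lborel" for n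
      by (intro borel_measurable_times measurable_compose[OF _ fm]) auto
    then show "(\<lambda>u. (indicator A (x + e n * u) * f (x + e n * u)) * (1 / (1 + u\<^sup>2))) \<in> borel_measurable lborel" for n
      by simp
  qed simp
  also have "(LBINT u. f x * (1 / (1 + u\<^sup>2))) = pi * f x"
    by (simp only: integral_mult_right_zero cauchy_integral(2) mult.commute)
  finally have L1: "(\<lambda>n. \<integral>\<omega>. indicator A (Y \<omega>) * p n (Y \<omega>) \<partial>M) \<longlonglongrightarrow> pi * f x"
    unfolding near .
  have L2: "(\<lambda>n. \<integral>\<omega>. indicator (- A) (Y \<omega>) * p n (Y \<omega>) \<partial>M) \<longlonglongrightarrow> 0"
  proof (rule Lim_null_comparison)
    have "norm (\<integral>\<omega>. indicator (- A) (Y \<omega>) * p n (Y \<omega>) \<partial>M) \<le> e n / (x / 2)\<^sup>2" for n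
    proof -
      have "norm (\<integral>\<omega>. indicator (- A) (Y \<omega>) * p n (Y \<omega>) \<partial>M) \<le> (\<integral>\<omega>. e n / (x / 2)\<^sup>2 \<partial>M)"
      proof (rule order_trans[OF integral_norm_bound integral_mono_AE'])
        show "AE \<omega> in M. norm (indicator (- A) (Y \<omega>) * p n (Y \<omega>)) \<le> e n / (x / 2)\<^sup>2"
          using far p0 e[of n] x by (intro AE_I2) (auto simp: indicator_def abs_of_nonneg less_imp_le)
        show "AE \<omega> in M. 0 \<le> e n / (x / 2)\<^sup>2" using e[of n] by (simp add: less_imp_le)
      qed simp
      then show ?thesis by (simp add: prob_space)
    qed
    then show "\<forall>\<^sub>F n in sequentially. norm (\<integral>\<omega>. indicator (- A) (Y \<omega>) * p n (Y \<omega>) \<partial>M) \<le> e n / (x / 2)\<^sup>2"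
      by simp
    show "(\<lambda>n. e n / (x / 2)\<^sup>2) \<longlonglongrightarrow> 0" using e0 by (rule tendsto_divide_zero)
  qed
  have split: "(\<integral>\<omega>. p n (Y \<omega>) \<partial>M)
    = (\<integral>\<omega>. indicator A (Y \<omega>) * p n (Y \<omega>) \<partial>M) + (\<integral>\<omega>. indicator (- A) (Y \<omega>) * p n (Y \<omega>) \<partial>M)" for n
  proof -
    have i: "integrable M (\<lambda>\<omega>. indicator B (Y \<omega>) * p n (Y \<omega>))" if [measurable]: "B \<in> sets borel" for B
    proof (rule integrable_const_bound[where B="1 / e n"])
      show "AE \<omega> in M. norm (indicator B (Y \<omega>) * p n (Y \<omega>)) \<le> 1 / e n"
        using p0 p_le e[of n] by (intro AE_I2) (auto simp: indicator_def abs_of_nonneg less_imp_le)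
    qed measurable
    have "(\<integral>\<omega>. p n (Y \<omega>) \<partial>M) = (\<integral>\<omega>. indicator A (Y \<omega>) * p n (Y \<omega>) + indicator (- A) (Y \<omega>) * p n (Y \<omega>) \<partial>M)"
      by (intro Bochner_Integration.integral_cong) (auto simp: indicator_def)
    also have "\<dots> = (\<integral>\<omega>. indicator A (Y \<omega>) * p n (Y \<omega>) \<partial>M) + (\<integral>\<omega>. indicator (- A) (Y \<omega>) * p n (Y \<omega>) \<partial>M)"
      by (intro Bochner_Integration.integral_add i) auto
    finally show ?thesis .
  qed
  from tendsto_add[OF L1 L2] have "(\<lambda>n. \<integral>\<omega>. p n (Y \<omega>) \<partial>M) \<longlonglongrightarrow> pi * f x"
    unfolding split by simp
  then show ?thesis by (simp only: p_def e_def)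
qed

text \<open>The inversion integral need not converge absolutely; once it converges at all, its limit is its
  Abel limit, which the Poisson kernel identifies.\<close>

lemma (in prob_space) fourier_inversion_of_convergent_integral:
  fixes Y :: "'a \<Rightarrow> real"
  assumes d: "continuous_density_on_pos M Y f" and x: "0 < x"
    and lim: "((\<lambda>T. LBINT t:{0..T}. (\<integral>\<omega>. cos (t * (x - Y \<omega>)) \<partial>M)) \<longlongrightarrow> L) at_top"
    and cont: "continuous_on UNIV (\<lambda>t. \<integral>\<omega>. cos (t * (x - Y \<omega>)) \<partial>M)"
  shows "L = pi * f x"
proof -
  have Y [measurable]: "Y \<in> borel_measurable M" using d by (simp add: continuous_density_on_pos_def)
  let ?g = "\<lambda>t. \<integral>\<omega>. cos (t * (x - Y \<omega>)) \<partial>M"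
  have "\<bar>?g t\<bar> \<le> 1" for t
  proof -
    have "norm (?g t) \<le> (\<integral>\<omega>. 1 \<partial>M)"
      by (rule order_trans[OF integral_norm_bound integral_mono_AE']) auto
    then show ?thesis by (simp add: prob_space)
  qed
  then have "(\<lambda>n. LBINT t:{0..}. exp (- (1 / real (Suc n) * t)) * ?g t) \<longlonglongrightarrow> L"
    by (intro abel_limit[OF _ _ _ lim] continuous_on_subset[OF cont] borel_measurable_continuous_onI[OF cont]) auto
  moreover have "(LBINT t:{0..}. exp (- (1 / real (Suc n) * t)) * ?g t)
    = (\<integral>\<omega>. (1 / real (Suc n)) / ((1 / real (Suc n))\<^sup>2 + (x - Y \<omega>)\<^sup>2) \<partial>M)" for n
    by (rule poisson_smoothing) auto
  ultimately show ?thesis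
    using poisson_kernel_limit[OF d x] by (simp only: LIMSEQ_unique)
qed

lemma (in prob_space) continuous_charfun:
  fixes Y :: "'a \<Rightarrow> real"
  assumes [measurable]: "Y \<in> borel_measurable M"
  shows "continuous_on UNIV (\<lambda>t. \<integral>\<omega>. exp (- (\<i> * of_real t * of_real (Y \<omega>))) \<partial>M)"
proof -
  let ?N = "distr M borel (\<lambda>\<omega>. - Y \<omega>)"
  interpret N: real_distribution ?N by (rule real_distribution_distr) simp
  have "(\<lambda>t. \<integral>\<omega>. exp (- (\<i> * of_real t * of_real (Y \<omega>))) \<partial>M) = char ?N"
    unfolding char_def by (rule ext, subst integral_distr) (auto simp: mult.assoc)
  then show ?thesis
    using N.isCont_char by (simp add: continuous_at_imp_continuous_on)
qed

context spectrally_positive_stable_char begin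

lemma outer_integrand_eq_cos:
  assumes "0 \<le> t"
  shows "outer_integrand \<alpha> x t = (\<integral>\<omega>. cos (t * (x - S \<omega>)) \<partial>M)"
proof (cases "t = 0")
  case True
  have "(LBINT y:{0..0}. inner_integrand \<alpha> x 0 y) = 0"
    unfolding set_lebesgue_integral_def
    by (rule integral_eq_zero_AE) (use AE_lborel_singleton[of 0] in \<open>eventually_elim, auto\<close>)
  then show ?thesis using True by (simp add: outer_integrand_def prob_space)
next
  case False
  with assms have t: "0 < t" by simp
  have i: "integrable M (\<lambda>\<omega>. exp (\<i> * of_real (t * (x - S \<omega>))))"
    by (rule integrable_const_bound[where B=1]) auto
  have "outer_integrand \<alpha> x t = Re (exp (\<i> * of_real (t * x)) * sup_charfun \<alpha> t)"
    by (rule outer_integrand_eq_Re[OF alpha t])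
  also have "sup_charfun \<alpha> t = (\<integral>\<omega>. exp (- (\<i> * of_real t * of_real (S \<omega>))) \<partial>M)"
    unfolding charfun_S[OF t] sup_charfun_def stable_exponent_def ..
  also have "exp (\<i> * of_real (t * x)) * \<dots> = (\<integral>\<omega>. exp (\<i> * of_real (t * (x - S \<omega>))) \<partial>M)"
    by (simp add: exp_add[symmetric] algebra_simps flip: integral_mult_right_zero)
  also have "Re \<dots> = (\<integral>\<omega>. Re (exp (\<i> * of_real (t * (x - S \<omega>)))) \<partial>M)"
    by (rule integral_Re[OF i, symmetric])
  finally show ?thesis by (simp add: Re_exp)
qed

text \<open>Convergence is proved for the complex integral, whose integrand has a clean asymptotic expansion;
  the value is then computed from the real part.\<close>

lemma outer_integral_limit:
  assumes d: "continuous_density_on_pos M S f" and x: "0 < x"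
  shows "\<forall>T\<ge>0. set_integrable lborel {0..T} (outer_integrand \<alpha> x)" (is ?int)
    and "((\<lambda>T. LBINT t:{0..T}. outer_integrand \<alpha> x t) \<longlongrightarrow> pi * f x) at_top" (is ?lim)
proof -
  let ?\<phi> = "\<lambda>t. \<integral>\<omega>. exp (- (\<i> * of_real t * of_real (S \<omega>))) \<partial>M"
  let ?g = "\<lambda>t. \<integral>\<omega>. cos (t * (x - S \<omega>)) \<partial>M"
  have \<phi>c: "continuous_on UNIV ?\<phi>" by (rule continuous_charfun) simp
  have g: "?g t = Re (exp (\<i> * of_real (t * x)) * ?\<phi> t)" for t
  proof -
    have i: "integrable M (\<lambda>\<omega>. exp (\<i> * of_real (t * (x - S \<omega>))))"
      by (rule integrable_const_bound[where B=1]) auto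
    have "exp (\<i> * of_real (t * x)) * ?\<phi> t = (\<integral>\<omega>. exp (\<i> * of_real (t * (x - S \<omega>))) \<partial>M)"
      by (simp add: exp_add[symmetric] algebra_simps flip: integral_mult_right_zero)
    also have "Re \<dots> = (\<integral>\<omega>. Re (exp (\<i> * of_real (t * (x - S \<omega>)))) \<partial>M)"
      by (rule integral_Re[OF i, symmetric])
    finally show ?thesis by (simp add: Re_exp)
  qed
  have hc: "continuous_on UNIV (\<lambda>t. exp (\<i> * of_real (t * x)) * ?\<phi> t)"
    by (intro continuous_intros \<phi>c)
  have gc: "continuous_on UNIV ?g" unfolding g by (intro continuous_on_Re hc)
  have h_int: "set_integrable lborel {0..T} (\<lambda>t. exp (\<i> * of_real (t * x)) * ?\<phi> t)" for T
    unfolding set_integrable_def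
    by (rule borel_integrable_compact[OF _ continuous_on_subset[OF hc]]) auto
  have g_int: "set_integrable lborel {0..T} ?g" for T
    unfolding set_integrable_def
    by (rule borel_integrable_compact[OF _ continuous_on_subset[OF gc]]) auto
  show ?int
  proof (intro allI impI)
    fix T :: real
    have "set_integrable lborel {0..T} (outer_integrand \<alpha> x) = set_integrable lborel {0..T} ?g"
      by (rule set_integrable_cong) (auto simp: outer_integrand_eq_cos)
    with g_int show "set_integrable lborel {0..T} (outer_integrand \<alpha> x)" by simp
  qed
  obtain k C where kC: "\<And>t. 1 \<le> t \<Longrightarrow> norm (sup_charfun \<alpha> t - k * of_real (t powr (1 - \<alpha>))) \<le> C * t powr (- \<alpha>)"
    using sup_charfun_asymptotics[OF alpha] by blast
  have asym: "norm (?\<phi> t - k * of_real (t powr (1 - \<alpha>))) \<le> C * t powr (- \<alpha>)" if "1 \<le> t" for t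
  proof -
    have "?\<phi> t = sup_charfun \<alpha> t"
      using charfun_S[of t] that
      by (simp add: sup_charfun_def stable_exponent_def)
    with kC[OF that] show ?thesis by simp
  qed
  have "x \<noteq> 0" using x by simp
  obtain L where "((\<lambda>T. LBINT t:{0..T}. exp (\<i> * of_real (t * x)) * ?\<phi> t) \<longlongrightarrow> L) at_top"
    by (rule oscillatory_integral_converges
        [OF alpha(1) \<open>x \<noteq> 0\<close> borel_measurable_continuous_onI[OF \<phi>c] h_int asym])
  from tendsto_Re[OF this]
  have gL: "((\<lambda>T. LBINT t:{0..T}. ?g t) \<longlongrightarrow> Re L) at_top"
    unfolding g set_lebesgue_integral_def
    using integral_Re[OF h_int[unfolded set_integrable_def]] by simp
  have "Re L = pi * f x"
    by (rule fourier_inversion_of_convergent_integral[OF d x gL gc])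
  with gL have "((\<lambda>T. LBINT t:{0..T}. ?g t) \<longlongrightarrow> pi * f x) at_top" by simp
  moreover have "(LBINT t:{0..T}. outer_integrand \<alpha> x t) = (LBINT t:{0..T}. ?g t)" for T
    by (rule set_lebesgue_integral_cong) (auto simp: outer_integrand_eq_cos)
  ultimately show ?lim by simp
qed

end

theorem corollary2:
  fixes \<alpha> :: real and M :: "'a measure" and X :: "real \<Rightarrow> 'a \<Rightarrow> real" and f :: "real \<Rightarrow> real"
  assumes "1 < \<alpha>" and "\<alpha> < 2"
    and "stable_levy_process \<alpha> M X"
    and "no_negative_jumps M X"
    and "\<And>l t. 0 \<le> t \<Longrightarrow>
      (LINT \<omega>|M. exp (\<i> * complex_of_real (l * X t \<omega>))) =
      exp (complex_of_real t * (LBINT x:{0<..}.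
        (exp (\<i> * complex_of_real (l * x)) - 1 - \<i> * complex_of_real (l * x)) /
        complex_of_real (Gamma (-\<alpha>) * x powr (1 + \<alpha>))))"
    and "\<And>l t. 0 \<le> t \<Longrightarrow>
      (LINT \<omega>|M. exp (\<i> * complex_of_real (l * X t \<omega>))) =
      exp (complex_of_real t * (- \<i> * complex_of_real l) powr complex_of_real \<alpha>)"
    and "\<And>l t. 0 \<le> l \<Longrightarrow> 0 \<le> t \<Longrightarrow>
      (LINT \<omega>|M. exp (- l * X t \<omega>)) = exp (t * l powr \<alpha>)"
    and "continuous_density_on_pos M (running_sup X 1) f"
  shows "\<forall>x>0.
    (\<forall>t\<ge>0. set_integrable lborel {0..t powr \<alpha>} (inner_integrand \<alpha> x t)) \<and>
    (\<forall>T\<ge>0. set_integrable lborel {0..T} (outer_integrand \<alpha> x)) \<and>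
    ((\<lambda>T. 1 / pi * (LBINT t:{0..T}. outer_integrand \<alpha> x t)) \<longlongrightarrow> f x) at_top"
proof -
  interpret spectrally_positive_stable_char \<alpha> M X
  proof
    show "running_sup X 1 \<in> borel_measurable M"
      using assms(8) by (simp add: continuous_density_on_pos_def)
    show "(LINT \<omega>|M. exp (- l * X 1 \<omega>)) = exp (l powr \<alpha>)" if "0 \<le> l" for l
      using assms(7)[of l 1] that by simp
    show "(LINT \<omega>|M. exp (\<i> * complex_of_real (l * X 1 \<omega>)))
      = exp ((- \<i> * complex_of_real l) powr complex_of_real \<alpha>)" for l
      using assms(6)[of 1 l] by simp
  qed (use assms in auto)
  show ?thesis
  proof (intro allI impI conjI)
    fix x :: real assume x: "0 < x"
    show "set_integrable lborel {0..t powr \<alpha>} (inner_integrand \<alpha> x t)" if "0 \<le> t" for t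
      by (rule set_integrable_inner_integrand[OF alpha that])
    show "set_integrable lborel {0..T} (outer_integrand \<alpha> x)" if "0 \<le> T" for T
      using outer_integral_limit(1)[OF assms(8) x] that by blast
    have "((\<lambda>T. 1 / pi * (LBINT t:{0..T}. outer_integrand \<alpha> x t)) \<longlongrightarrow> 1 / pi * (pi * f x)) at_top"
      by (rule tendsto_mult_left[OF outer_integral_limit(2)[OF assms(8) x]])
    then show "((\<lambda>T. 1 / pi * (LBINT t:{0..T}. outer_integrand \<alpha> x t)) \<longlongrightarrow> f x) at_top"
      by simp
  qed
qed

end
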